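(* Let $k\in\{1,\dots,n\}$. Assume that $f:\mathbb{R}\to(0,+\infty)$ is a non-decreasing continuous function, $-1<\alpha<\frac1k-1$, $\beta<p-1$ and $p>1$. Consider the equation $$S_k^{\frac1k}[D(|Du|^{p-2}Du)]=|x|^\alpha|Du|^\beta f(u)\quad\text{in }\mathbb{R}^n. \tag{E}$$ (a) If $f$ satisfies $$\int^{+\infty}\left(\int_0^t f^{\kappa k}(s)\,ds\right)^{-\frac{1}{\kappa k(p-\beta-1)+1}}dt=+\infty,$$ where $\kappa=\frac{1-\epsilon}{k(\alpha+1)-\epsilon}$ for some constant $\epsilon\in(0,k(\alpha+1))$, then there exists an entire nontrivial admissible subsolution $u\in C^1(\mathbb{R}^n)\cap C^2(\mathbb{R}^n\setminus\{0\})$ of (E). Moreover, the following properties hold: (i) If $p\le\alpha+\beta+2$, then $u\in C^2(\mathbb{R}^n)$. (ii) If $p>\alpha+\beta+2$ and $(p-1)\alpha+\beta\ge0$, then $u\in C^2(\mathbb{R}^n\setminus\{0\})\cap W^{2,\delta}_{loc}(\mathbb{R}^n)$ for $\delta\in\left(1,\frac{p-\beta-1}{p-\alpha-\beta-2}\right)$. (b) If (E) admits an entire nontrivial admissible subsolution $u$ satisfying (i) or (ii) in (a), then $$\int^{+\infty}\left(\int_0^t f^k(s)\,ds\right)^{-\frac{1}{k(p-\beta-1)+1}}dt=+\infty.$$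
   Context: For $\lambda\in\mathbb{R}^n$, $S_k(\lambda)=\sum_{i_1<\cdots<i_k}\prod_{s=1}^k\lambda_{i_s}$ is the $k$-th elementary symmetric polynomial, and $\Gamma_k=\{\lambda\in\mathbb{R}^n: S_i(\lambda)>0,\ i=1,\dots,k\}$. For a matrix $M$ with eigenvalues $\lambda(M)=(\lambda_1,\dots,\lambda_n)$, $S_k[M]=S_k(\lambda(M))$; $S_k^{1/k}$ is its $k$-th root. $D(|Du|^{p-2}Du)$ is the Jacobian matrix of the vector field $|Du|^{p-2}Du$. A function $u\in C^2(\Omega)$ is called admissible in $\Omega$ if $\lambda(D(|Du|^{p-2}Du))\in\Gamma_k$ for all $x\in\Omega\subset\mathbb{R}^n$; the same term is used for functions in the other regularity classes named in the statement. An entire admissible subsolution of the equation is an admissible function on all of $\mathbb{R}^n$ that satisfies the equation with "$=$" replaced by "$\ge$". In an integral written $\int^{+\infty}$ the lower limit may be any positive number. *)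

theory Defs
  imports "HOL-Analysis.Analysis"
begin

subsection \<open>Elementary symmetric polynomials, eigenvalues, and the cones\<close>

definition elem_sym :: "nat \<Rightarrow> real^'n \<Rightarrow> real" where
  "elem_sym k l = (\<Sum>I | I \<subseteq> (UNIV::'n set) \<and> card I = k. \<Prod>i\<in>I. l $ i)"

definition Gamma_cone :: "nat \<Rightarrow> (real^'n) set" where
  "Gamma_cone k = {l. \<forall>i\<in>{1..k}. elem_sym i l > 0}"

text \<open>The vector \<open>l\<close> lists all eigenvalues of \<open>M\<close> with algebraic multiplicity (in some order): the
  characteristic polynomial of \<open>M\<close> splits over the reals with roots the entries of \<open>l\<close>. Such a vector
  is unique up to permutation of its entries, and \<^term>\<open>elem_sym k\<close> and \<^term>\<open>Gamma_cone k\<close> are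
  invariant under permutations, so that the choice below is immaterial.\<close>

definition has_eigenvalues :: "real^'n^'n \<Rightarrow> real^'n \<Rightarrow> bool" where
  "has_eigenvalues M l \<longleftrightarrow> (\<forall>t. det (mat t - M) = (\<Prod>i\<in>UNIV. t - l $ i))"

definition eigenvalues :: "real^'n^'n \<Rightarrow> real^'n" where
  "eigenvalues M = (SOME l. has_eigenvalues M l)"

definition S_mat :: "nat \<Rightarrow> real^'n^'n \<Rightarrow> real" where
  "S_mat k M = elem_sym k (eigenvalues M)"


subsection \<open>Classical and weak derivatives\<close>

definition partial :: "'n \<Rightarrow> (real^'n \<Rightarrow> real) \<Rightarrow> real^'n \<Rightarrow> real" where
  "partial i u x = frechet_derivative u (at x) (axis i 1)"

definition grad :: "(real^'n \<Rightarrow> real) \<Rightarrow> real^'n \<Rightarrow> real^'n" where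
  "grad u x = (\<chi> i. partial i u x)"

text \<open>The class $C^m(\Omega)$; meant for open \<open>\<Omega>\<close>.\<close>

primrec Ck_on :: "nat \<Rightarrow> (real^'n) set \<Rightarrow> (real^'n \<Rightarrow> real) \<Rightarrow> bool" where
  "Ck_on 0 \<Omega> u \<longleftrightarrow> continuous_on \<Omega> u"
| "Ck_on (Suc m) \<Omega> u \<longleftrightarrow>
     (\<forall>x\<in>\<Omega>. u differentiable (at x)) \<and> (\<forall>i. Ck_on m \<Omega> (partial i u))"

definition test_function :: "(real^'n \<Rightarrow> real) \<Rightarrow> bool" where
  "test_function \<phi> \<longleftrightarrow> (\<forall>m. Ck_on m UNIV \<phi>) \<and> compact (closure {x. \<phi> x \<noteq> 0})"

definition L_loc :: "real \<Rightarrow> (real^'n \<Rightarrow> real) \<Rightarrow> bool" where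
  "L_loc \<delta> g \<longleftrightarrow> g \<in> borel_measurable lebesgue \<and>
     (\<forall>K. compact K \<longrightarrow> set_integrable lebesgue K (\<lambda>x. \<bar>g x\<bar> powr \<delta>))"

definition weak_partial :: "'n \<Rightarrow> (real^'n \<Rightarrow> real) \<Rightarrow> (real^'n \<Rightarrow> real) \<Rightarrow> bool" where
  "weak_partial i u g \<longleftrightarrow> L_loc 1 u \<and> L_loc 1 g \<and>
     (\<forall>\<phi>. test_function \<phi> \<longrightarrow>
        integral\<^sup>L lebesgue (\<lambda>x. u x * partial i \<phi> x) = - integral\<^sup>L lebesgue (\<lambda>x. g x * \<phi> x))"

text \<open>The local Sobolev space $W^{m,\delta}_{loc}(\mathbb{R}^n)$.\<close>

primrec Sobolev_loc :: "nat \<Rightarrow> real \<Rightarrow> (real^'n \<Rightarrow> real) \<Rightarrow> bool" where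
  "Sobolev_loc 0 \<delta> u \<longleftrightarrow> L_loc \<delta> u"
| "Sobolev_loc (Suc m) \<delta> u \<longleftrightarrow>
     L_loc \<delta> u \<and> (\<forall>i. \<exists>g. weak_partial i u g \<and> Sobolev_loc m \<delta> g)"


subsection \<open>The equation\<close>

text \<open>The vector field $|Du|^{p-2}Du$. For \<open>p > 1\<close> it extends by \<open>0\<close> to critical points of \<open>u\<close>, and
  this is the value that the formula below has there.\<close>

definition p_field :: "real \<Rightarrow> (real^'n \<Rightarrow> real) \<Rightarrow> real^'n \<Rightarrow> real^'n" where
  "p_field p u x = (norm (grad u x) powr (p - 2)) *\<^sub>R grad u x"

text \<open>The pointwise admissibility condition on \<open>\<Omega>\<close>. It includes the existence of the Jacobian matrix,
  which is not automatic at critical points of \<open>u\<close> when \<open>p < 2\<close>.\<close>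

definition admissible :: "real \<Rightarrow> nat \<Rightarrow> (real^'n) set \<Rightarrow> (real^'n \<Rightarrow> real) \<Rightarrow> bool" where
  "admissible p k \<Omega> u \<longleftrightarrow>
     (\<forall>x\<in>\<Omega>. p_field p u differentiable (at x) \<and>
        (\<exists>l. has_eigenvalues (jacobian (p_field p u) (at x)) l \<and> l \<in> Gamma_cone k))"

text \<open>The power $t^b$ for \<open>t \<ge> 0\<close> with the usual values $0^b = \infty$ for \<open>b < 0\<close> and $0^0 = 1$;
  \<^term>\<open>(powr)\<close> would give \<open>0\<close> in both cases.\<close>

definition ext_power :: "real \<Rightarrow> real \<Rightarrow> ereal" where
  "ext_power t b =
     (if t = 0 then (if b < 0 then \<infinity> else if b = 0 then 1 else 0) else ereal (t powr b))"

text \<open>Entire admissible subsolutions, in the class $C^1(\mathbb{R}^n)\cap C^2(\mathbb{R}^n\setminus\{0\})$.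
  As \<open>\<alpha> < 0\<close> below, the weight $|x|^\alpha$ is infinite at the origin, where in addition \<open>u\<close> need not be
  twice differentiable; for \<open>p > 2\<close> even a subsolution of class $C^2(\mathbb{R}^n)$ has vanishing
  Jacobian \<open>D(|Du|\<^sup>p\<^sup>-\<^sup>2 Du)\<close> there. Admissibility and the inequality are therefore
  required at the points of $\mathbb{R}^n\setminus\{0\}$.\<close>

definition entire_admissible_subsolution ::
    "real \<Rightarrow> nat \<Rightarrow> real \<Rightarrow> real \<Rightarrow> (real \<Rightarrow> real) \<Rightarrow> (real^'n \<Rightarrow> real) \<Rightarrow> bool" where
  "entire_admissible_subsolution p k \<alpha> \<beta> f u \<longleftrightarrow>
     Ck_on 1 UNIV u \<and> Ck_on 2 (UNIV - {0}) u \<and>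
     admissible p k (UNIV - {0}) u \<and>
     (\<forall>x\<in>UNIV - {0}.
        ereal (root k (S_mat k (jacobian (p_field p u) (at x))))
          \<ge> ext_power (norm x) \<alpha> * ext_power (norm (grad u x)) \<beta> * ereal (f (u x)))"

definition nontrivial :: "(real^'n \<Rightarrow> real) \<Rightarrow> bool" where
  "nontrivial u \<longleftrightarrow> \<not> (\<exists>c. \<forall>x. u x = c)"

text \<open>\<open>\<integral>\<^sup>+\<^sup>\<infinity> g(t) dt = +\<infinity>\<close> for a nonnegative function \<open>g\<close>; the lower limit
  is an arbitrary positive number.\<close>

definition integral_diverges :: "(real \<Rightarrow> real) \<Rightarrow> bool" where
  "integral_diverges g \<longleftrightarrow> (\<forall>c>0. (\<integral>\<^sup>+t\<in>{c..}. ennreal (g t) \<partial>lborel) = \<infinity>)"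

end

theory Submission
  imports Defs "HOL-Computational_Algebra.Fundamental_Theorem_Algebra"
begin

text \<open>Put \<open>q = p - 1 - \<beta>\<close>, \<open>a = k q\<close> and \<open>\<gamma> = k (\<alpha> + 1)\<close>, so that \<open>a > 0\<close> and \<open>0 < \<gamma> < 1\<close>. For a radial function
  \<open>\<phi>(|x|)\<close> with \<open>\<phi>' > 0\<close> the Jacobian of the vector field \<open>|Du|^(p-2) Du\<close> has the eigenvalue
  \<open>(p - 1) \<phi>'^(p-2) \<phi>''\<close> in the radial direction and \<open>\<phi>'^(p-1) / r\<close> in all others. Raising the
  inequality to the power \<open>k\<close> and dividing by \<open>\<phi>'^(k \<beta>)\<close>, it becomes, up to constants, a comparison of
  \<open>\<phi>'^(a-1) \<phi>''\<close> with \<open>r^(\<gamma>-1) f(\<phi>)^k\<close>. The part of \<open>S_k\<close> without \<open>\<phi>''\<close> is nonnegative, so that it can be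
  dropped in (a), and it is dominated by the right-hand side in (b). Both parts use solutions
  of the autonomous equation \<open>\<Psi>' = H(\<Psi>)\<close>, where \<open>H^(a+1)\<close> is one plus a primitive of \<open>f^k\<close>, cut off on the left. They
  are inverse functions of a primitive \<open>T\<close> of \<open>1 / H\<close>, and \<open>T\<close> is bounded above exactly if the integral
  in part (b) converges; this dichotomy is what the integral condition means.

  Part (a). If the integral with exponent \<open>\<kappa> \<ge> 1\<close> diverges, then so does the one with \<open>\<kappa> = 1\<close>
  (lemma \<open>diverges_of_kappa_diverges\<close>), because convergence of the latter makes the primitive of \<open>f^k\<close>
  grow at least like \<open>t^(a+1)\<close>. Hence \<open>T\<close> maps onto the real line and
  \<open>u(x) = \<psi>(\<Lambda> (|x|^(1+\<sigma>) - 1))\<close> is defined everywhere, where \<open>\<psi>\<close> is the translate of \<open>\<Psi>\<close> with \<open>\<psi>(0) = 0\<close>. The exponent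
  \<open>\<sigma> = (\<alpha> + 1) / q\<close> satisfies \<open>\<sigma> a = \<gamma>\<close>, so that the power of \<open>|x|\<close> produces the singular weight
  \<open>r^(\<gamma>-1)\<close> near the origin, while for \<open>|x| \<ge> 1\<close> that weight is at most \<open>1\<close> and the autonomous equation
  suffices; a large \<open>\<Lambda>\<close> absorbs the constants (\<open>existence_of_subsolution\<close>). The second derivatives of \<open>u\<close> are of order
  \<open>|x|^(\<sigma>-1)\<close>. They are continuous at the origin if \<open>\<sigma> \<ge> 1\<close>, which is the condition in (i), and
  otherwise locally in \<open>L^\<delta>\<close> for \<open>\<delta> (1 - \<sigma>) < 1\<close>, which is the range in (ii).

  Part (b). If the integral converges, then \<open>T\<close> is bounded above, and
  \<open>\<phi>(r) = \<Psi>(T b + l (r - 1))\<close> starts at \<open>\<phi>(1) = b\<close> and becomes infinite at a finite radius. For small \<open>l\<close> it is a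
  strict supersolution on the annulus where it exists, because the annulus then has radius of order \<open>1 / l\<close>, and
  it stays as close to \<open>b\<close> as desired at a prescribed point. A subsolution \<open>u\<close>
  exceeds its maximum over the unit ball somewhere (\<open>admissible_sup_not_attained_in_ball\<close>), so with \<open>b\<close>
  between the two values the difference \<open>u - \<phi>(|x|)\<close> has a positive interior maximum in the annulus.
  There the gradients agree and do not vanish, and the Hessians are ordered. Both Jacobians are therefore the product
  of one positive definite matrix with the respective Hessian, and \<open>S_k\<close> is monotone on \<open>\<Gamma>_k\<close>
  (\<open>elem_sym_eigenvalues_mono\<close>), which contradicts the strictness (\<open>necessity_of_divergence\<close>). As the comparison takes
  place away from the origin, the behaviour of \<open>u\<close> there matters only for the maximum principle, where the perturbation
  \<open>u + \<epsilon> |x|\<close> moves a maximum off the origin.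

  Monotonicity of \<open>S_k\<close> on \<open>\<Gamma>_k\<close> is proved by rank-one updates: adding \<open>\<eta> \<eta>\<^sup>T\<close> changes \<open>S_j\<close> by
  \<open>\<Sum> \<xi>_i^2 S_(j-1)(\<lambda> | i)\<close>, where \<open>\<xi>\<close> are the coordinates of \<open>\<eta>\<close> in an eigenbasis and \<open>\<lambda> | i\<close>
  omits the \<open>i\<close>-th eigenvalue. These coefficients are positive by Newton's inequality.\<close>



section \<open>Real-rooted polynomials and Newton's inequality\<close>

text \<open>The Gauss--Lucas argument: off the real axis the logarithmic derivative \<open>\<Sum> 1 / (z - a)\<close> is a sum of numbers
  whose imaginary parts all have the sign opposite to that of \<open>Im z\<close>.\<close>

lemma pderiv_of_roots_nonzero_off_axis:
  fixes as :: "real list" and z :: complex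
  assumes "Im z \<noteq> 0" and "as \<noteq> []"
  shows "poly (pderiv (\<Prod>a\<leftarrow>as. [:- complex_of_real a, 1:])) z \<noteq> 0"
proof -
  have nz: "z - complex_of_real a \<noteq> 0" for a
    using assms(1) by (metis Im_complex_of_real eq_iff_diff_eq_0)
  have pnz: "poly (\<Prod>a\<leftarrow>as. [:- complex_of_real a, 1:]) z \<noteq> 0" for as
    by (induction as) (use nz in auto)
  have logd: "poly (pderiv (\<Prod>a\<leftarrow>as. [:- complex_of_real a, 1:])) z
      = poly (\<Prod>a\<leftarrow>as. [:- complex_of_real a, 1:]) z * (\<Sum>a\<leftarrow>as. 1 / (z - complex_of_real a))" for as
  proof (induction as)
    case (Cons a as)
    show ?case
      using nz[of a] by (simp add: pderiv_mult pderiv_pCons Cons field_simps del: mult_pCons_left)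
  qed simp
  have im: "Im (1 / (z - complex_of_real a)) = - Im z * (1 / (cmod (z - complex_of_real a))\<^sup>2)" for a
    by (simp add: Im_divide cmod_power2)
  have ims: "Im (\<Sum>a\<leftarrow>as. 1 / (z - complex_of_real a)) = - Im z * (\<Sum>a\<leftarrow>as. 1 / (cmod (z - complex_of_real a))\<^sup>2)" for as
  proof (induction as)
    case (Cons a as)
    then show ?case by (simp only: im list.map sum_list.Cons plus_complex.sel distrib_left)
  qed simp
  have "(\<Sum>a\<leftarrow>as. 1 / (cmod (z - complex_of_real a))\<^sup>2) > 0"
    using assms(2)
  proof (induction as)
    case (Cons a as)
    have "1 / (cmod (z - complex_of_real a))\<^sup>2 > 0" using nz by simp
    moreover have "(\<Sum>a\<leftarrow>as. 1 / (cmod (z - complex_of_real a))\<^sup>2) \<ge> 0"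
      by (rule sum_list_nonneg) auto
    ultimately show ?case unfolding list.map sum_list.Cons by (rule add_pos_nonneg)
  qed simp
  then have "(\<Sum>a\<leftarrow>as. 1 / (z - complex_of_real a)) \<noteq> 0"
    using ims[of as] assms(1) by (metis less_irrefl mult_eq_0_iff neg_equal_0_iff_equal zero_complex.simps(2))
  then show ?thesis unfolding logd using pnz by simp
qed

lemma coeff_prod_of_real_roots:
  "coeff (\<Prod>a\<leftarrow>as. [:- complex_of_real a, 1:]) j = of_real (coeff (\<Prod>a\<leftarrow>as. [:- a, 1:]) j)"
  by (induction as arbitrary: j) (auto simp: coeff_pCons split: nat.split)

text \<open>Over the complex numbers the derivative factors, and all its roots lie on the real axis.\<close>

lemma pderiv_real_roots:
  fixes as :: "real list"
  shows "\<exists>bs c. pderiv (\<Prod>a\<leftarrow>as. [:- a, 1:]) = smult c (\<Prod>b\<leftarrow>bs. [:- b, 1:])"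
proof (cases "as = []")
  case True
  then show ?thesis by (intro exI[of _ "[]"] exI[of _ 0]) simp
next
  case False
  let ?C = "\<lambda>as. \<Prod>a\<leftarrow>as. [:- complex_of_real a, 1:]"
  let ?R = "\<lambda>as::real list. \<Prod>a\<leftarrow>as. [:- a, 1:]"
  have nz: "pderiv (?C as) \<noteq> 0"
    using pderiv_of_roots_nonzero_off_axis[of \<i> as] False by auto
  obtain A where A: "pderiv (?C as) = smult (lead_coeff (pderiv (?C as))) (\<Prod>x\<in>#A. [:-x, 1:])"
    using alg_closed_imp_factorization[OF nz] by (elim exE conjE)
  obtain d where d: "d = lead_coeff (pderiv (?C as))" by blast
  obtain zs where zs: "A = mset zs" by (metis ex_mset)
  have fac: "pderiv (?C as) = smult d (\<Prod>z\<leftarrow>zs. [:-z, 1:])"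
    using A unfolding d[symmetric] zs by (simp only: mset_map[symmetric] prod_mset_prod_list)
  have "Im z = 0" if "z \<in> set zs" for z
  proof (rule ccontr)
    assume "Im z \<noteq> 0"
    then have "poly (pderiv (?C as)) z \<noteq> 0" using False by (rule pderiv_of_roots_nonzero_off_axis)
    moreover have "poly (\<Prod>z\<leftarrow>zs. [:-z, 1:]) z = 0" using that
      by (induction zs) (auto simp del: mult_pCons_left)
    ultimately show False unfolding fac poly_smult by simp
  qed
  then have re: "map (\<lambda>z. [:- z, 1:]) zs = map (\<lambda>b. [:- complex_of_real b, 1:]) (map Re zs)"
    by (auto simp: complex_eq_iff)
  have co: "coeff (pderiv (?C as)) m = of_real (coeff (pderiv (?R as)) m)" for m
    by (simp only: coeff_pderiv coeff_prod_of_real_roots of_real_mult of_real_of_nat_eq)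
  then have d': "d = of_real (Re d)" unfolding d by (simp only: Re_complex_of_real)
  have "pderiv (?R as) = smult (Re d) (?R (map Re zs))"
  proof (rule poly_eqI)
    fix j
    have "complex_of_real (coeff (pderiv (?R as)) j) = d * coeff (?C (map Re zs)) j"
      by (simp only: co[symmetric] fac re coeff_smult)
    also have "\<dots> = of_real (Re d) * of_real (coeff (?R (map Re zs)) j)"
      by (simp only: coeff_prod_of_real_roots d'[symmetric])
    also have "\<dots> = of_real (coeff (smult (Re d) (?R (map Re zs))) j)"
      by (simp only: coeff_smult of_real_mult)
    finally show "coeff (pderiv (?R as)) j = coeff (smult (Re d) (?R (map Re zs))) j"
      by (simp only: of_real_eq_iff)
  qed
  then show ?thesis by blast
qed

text \<open>The zero polynomial counts as split (\<open>c = 0\<close>), so that the class is closed under differentiation.\<close>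

definition real_splitting :: "real poly \<Rightarrow> bool" where
  "real_splitting p \<longleftrightarrow> (\<exists>c as. p = smult c (\<Prod>a\<leftarrow>as. [:- a, 1:]))"

lemma real_splitting_higher_pderiv: "real_splitting p \<Longrightarrow> real_splitting ((pderiv ^^ m) p)"
proof (induction m)
  case (Suc m)
  then obtain c as where "(pderiv ^^ m) p = smult c (\<Prod>a\<leftarrow>as. [:- a, 1:])"
    unfolding real_splitting_def by blast
  moreover obtain bs d where "pderiv (\<Prod>a\<leftarrow>as. [:- a, 1:]) = smult d (\<Prod>b\<leftarrow>bs. [:- b, 1:])"
    using pderiv_real_roots by blast
  ultimately show ?case unfolding real_splitting_def
    by (intro exI[of _ "c * d"] exI[of _ bs]) (simp add: pderiv_smult)
qed simp

lemma laguerre_step: "(q + y * r)\<^sup>2 - y * q * (2 * r + y * s) = q\<^sup>2 + y\<^sup>2 * (r\<^sup>2 - q * (s::real))"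
  by (simp add: power2_eq_square algebra_simps)

text \<open>Laguerre's inequality. For a product \<open>(x - a) Q\<close> the left-hand side minus the right-hand side equals
  \<open>Q\<^sup>2\<close> plus \<open>(x - a)\<^sup>2\<close> times the corresponding difference for \<open>Q\<close>.\<close>

lemma laguerre_inequality:
  assumes "real_splitting p"
  shows "(poly (pderiv p) x)\<^sup>2 \<ge> poly p x * poly (pderiv (pderiv p)) x"
proof -
  obtain c as where p: "p = smult c (\<Prod>a\<leftarrow>as. [:- a, 1:])"
    using assms unfolding real_splitting_def by blast
  have *: "(poly (pderiv (\<Prod>a\<leftarrow>as. [:- a, 1:])) x)\<^sup>2 \<ge> poly (\<Prod>a\<leftarrow>as. [:- a, 1:]) x * poly (pderiv (pderiv (\<Prod>a\<leftarrow>as. [:- a, 1:]))) x"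
  proof (induction as)
    case (Cons a as)
    define Q where "Q = (\<Prod>a\<leftarrow>as. [:- a, 1:])"
    have e1: "pderiv ([:-a, 1:] * P) = P + [:-a,1:] * pderiv P" for P :: "real poly"
      by (simp add: pderiv_mult pderiv_pCons del: mult_pCons_left)
    have p0: "poly ([:-a, 1:] * P) x = (x - a) * poly P x" for P
      by (simp add: algebra_simps)
    have p1: "poly (pderiv ([:-a, 1:] * Q)) x = poly Q x + (x - a) * poly (pderiv Q) x"
      by (simp only: e1 poly_add p0)
    have p2: "poly (pderiv (pderiv ([:-a, 1:] * Q))) x = 2 * poly (pderiv Q) x + (x - a) * poly (pderiv (pderiv Q)) x"
      by (simp only: e1 pderiv_add poly_add p0 mult_2 add.assoc)
    have "(poly (pderiv ([:-a, 1:] * Q)) x)\<^sup>2 - poly ([:-a, 1:] * Q) x * poly (pderiv (pderiv ([:-a, 1:] * Q))) x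
      = (poly Q x)\<^sup>2 + (x - a)\<^sup>2 * ((poly (pderiv Q) x)\<^sup>2 - poly Q x * poly (pderiv (pderiv Q)) x)"
      unfolding p0 p1 p2 by (rule laguerre_step)
    also have "\<dots> \<ge> 0" using Cons unfolding Q_def by simp
    finally show ?case unfolding Q_def by (simp del: mult_pCons_left)
  qed simp
  have "c\<^sup>2 * (poly (\<Prod>a\<leftarrow>as. [:- a, 1:]) x * poly (pderiv (pderiv (\<Prod>a\<leftarrow>as. [:- a, 1:]))) x)
     \<le> c\<^sup>2 * (poly (pderiv (\<Prod>a\<leftarrow>as. [:- a, 1:])) x)\<^sup>2"
    by (rule mult_left_mono[OF *]) simp
  then show ?thesis unfolding p pderiv_smult poly_smult power_mult_distrib power2_eq_square
    by (simp only: mult_ac)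
qed

text \<open>Laguerre's inequality at \<open>0\<close> for the \<open>m\<close>-th derivative compares three consecutive coefficients. It even
  gains the factor \<open>(m + 2) / (m + 1)\<close>.\<close>

lemma newton_weak_coeff:
  assumes "real_splitting p"
  shows "(coeff p (Suc m))\<^sup>2 \<ge> coeff p m * coeff p (Suc (Suc m))"
proof (cases "coeff p m * coeff p (Suc (Suc m)) \<ge> 0")
  case True
  have c: "coeff ((pderiv ^^ m) p) i = (fact (i + m) / fact i) * coeff p (i + m)" for i m
  proof (induction m arbitrary: i)
    case (Suc m)
    have "coeff ((pderiv ^^ Suc m) p) i = real (Suc i) * coeff ((pderiv ^^ m) p) (Suc i)"
      by (simp add: coeff_pderiv)
    also have "\<dots> = real (Suc i) * (fact (Suc i + m) / fact (Suc i) * coeff p (Suc i + m))"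
      by (simp only: Suc)
    also have "\<dots> = fact (i + Suc m) / fact i * coeff p (i + Suc m)"
      by (simp del: of_nat_Suc fact_Suc add: fact_Suc[of i])
    finally show ?case .
  qed simp
  have L: "(poly (pderiv ((pderiv ^^ m) p)) 0)\<^sup>2 \<ge> poly ((pderiv ^^ m) p) 0 * poly (pderiv (pderiv ((pderiv ^^ m) p))) 0"
    using laguerre_inequality real_splitting_higher_pderiv assms by blast
  have e0: "poly ((pderiv ^^ m) p) 0 = fact m * coeff p m"
    and e1: "poly (pderiv ((pderiv ^^ m) p)) 0 = (1 + real m) * fact m * coeff p (Suc m)"
    and e2: "poly (pderiv (pderiv ((pderiv ^^ m) p))) 0 = (2 + real m) * (1 + real m) * fact m * coeff p (Suc (Suc m))"
    by (simp_all add: poly_0_coeff_0 coeff_pderiv c algebra_simps numeral_2_eq_2)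
  have "(1 + real m) * (fact m)\<^sup>2 * ((2 + real m) * (coeff p m * coeff p (Suc (Suc m))))
      \<le> (1 + real m) * (fact m)\<^sup>2 * ((1 + real m) * (coeff p (Suc m))\<^sup>2)"
    using L unfolding e0 e1 e2 by (simp add: power2_eq_square mult_ac)
  then have "(2 + real m) * (coeff p m * coeff p (Suc (Suc m))) \<le> (1 + real m) * (coeff p (Suc m))\<^sup>2"
    by (subst (asm) mult_le_cancel_left_pos) simp_all
  moreover have "(1 + real m) * (coeff p m * coeff p (Suc (Suc m))) \<le> (2 + real m) * (coeff p m * coeff p (Suc (Suc m)))"
    using True by (intro mult_right_mono) auto
  ultimately have "(1 + real m) * (coeff p m * coeff p (Suc (Suc m))) \<le> (1 + real m) * (coeff p (Suc m))\<^sup>2"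
    by linarith
  then show ?thesis by (subst (asm) mult_le_cancel_left_pos) simp_all
next
  case False
  then show ?thesis using zero_le_power2[of "coeff p (Suc m)"] by linarith
qed

section \<open>Elementary symmetric polynomials\<close>

text \<open>In contrast to \<^const>\<open>elem_sym\<close> the index set is a parameter, so that single entries can be removed.\<close>

definition esym :: "nat \<Rightarrow> 'i set \<Rightarrow> ('i \<Rightarrow> real) \<Rightarrow> real" where
  "esym k A l = (\<Sum>I | I \<subseteq> A \<and> card I = k. \<Prod>i\<in>I. l i)"

lemma elem_sym_esym: "elem_sym k l = esym k UNIV (($) l)"
  unfolding elem_sym_def esym_def ..

lemma esym_0: "finite A \<Longrightarrow> esym 0 A l = 1"
proof -
  assume "finite A"
  then have "{I. I \<subseteq> A \<and> card I = 0} = {{}}"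
    by (auto simp: finite_subset)
  then show ?thesis unfolding esym_def by simp
qed

lemma esym_insert:
  assumes "finite A" "x \<notin> A"
  shows "esym (Suc k) (insert x A) l = esym (Suc k) A l + l x * esym k A l"
proof -
  let ?T = "insert x ` {I. I \<subseteq> A \<and> card I = k}"
  have fin: "finite {I. I \<subseteq> A \<and> card I = j}" for j using assms(1) by simp
  have eq: "{I. I \<subseteq> insert x A \<and> card I = Suc k} = {I. I \<subseteq> A \<and> card I = Suc k} \<union> ?T" (is "?L = ?R")
  proof
    show "?L \<subseteq> ?R"
    proof
      fix I assume I: "I \<in> ?L"
      show "I \<in> ?R"
      proof (cases "x \<in> I")
        case True
        then have "I = insert x (I - {x})" "I - {x} \<subseteq> A" "card (I - {x}) = k"
          using I assms finite_subset by (auto simp: card_Diff_singleton)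
        then show ?thesis by blast
      qed (use I in auto)
    qed
    show "?R \<subseteq> ?L"
    proof
      fix I assume "I \<in> ?R"
      then consider "I \<in> ?L" | J where "I = insert x J" "J \<subseteq> A" "card J = k" by auto
      then show "I \<in> ?L"
      proof cases
        case 2
        then have "finite J" "x \<notin> J" using assms finite_subset by auto
        then show ?thesis using 2 by auto
      qed
    qed
  qed
  have disj: "{I. I \<subseteq> A \<and> card I = Suc k} \<inter> ?T = {}"
    using assms by auto
  have inj: "inj_on (insert x) {I. I \<subseteq> A \<and> card I = k}"
    using assms by (auto simp: inj_on_def)
  have "esym (Suc k) (insert x A) l = esym (Suc k) A l + (\<Sum>I\<in>?T. \<Prod>i\<in>I. l i)"
    unfolding esym_def eq using fin disj by (subst sum.union_disjoint) auto
  also have "(\<Sum>I\<in>?T. \<Prod>i\<in>I. l i) = (\<Sum>I | I \<subseteq> A \<and> card I = k. l x * (\<Prod>i\<in>I. l i))"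
    unfolding sum.reindex[OF inj] o_def
  proof (rule sum.cong[OF refl])
    fix I assume "I \<in> {I. I \<subseteq> A \<and> card I = k}"
    then have "finite I" "x \<notin> I" using assms finite_subset by auto
    then show "prod l (insert x I) = l x * prod l I" by simp
  qed
  finally show ?thesis unfolding esym_def by (simp add: sum_distrib_left)
qed

lemma esym_gt_card: "finite A \<Longrightarrow> card A < k \<Longrightarrow> esym k A l = 0"
proof -
  assume A: "finite A" "card A < k"
  have "\<not> (I \<subseteq> A \<and> card I = k)" for I
    using A card_mono[of A I] by auto
  then have "{I. I \<subseteq> A \<and> card I = k} = {}" by blast
  then show ?thesis unfolding esym_def by (simp only: sum.empty)
qed

text \<open>Vieta's formula; the hypothesis \<open>j \<le> card A\<close> keeps the truncated subtraction meaningful.\<close>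

lemma coeff_prod_linear:
  assumes "finite A"
  shows "j \<le> card A \<Longrightarrow> coeff (\<Prod>i\<in>A. [:- l i, 1:]) (card A - j) = (- 1) ^ j * esym j A l"
  using assms
proof (induction A arbitrary: j rule: finite_induct)
  case empty
  then show ?case by (simp add: esym_0)
next
  case (insert x A)
  let ?Q = "\<Prod>i\<in>A. [:- l i, 1:]"
  have dQ: "degree ?Q = card A"
    by (subst degree_prod_eq_sum_degree) simp_all
  have Q: "coeff (\<Prod>i\<in>insert x A. [:- l i, 1:]) m = - l x * coeff ?Q m + (case m of 0 \<Rightarrow> 0 | Suc m' \<Rightarrow> coeff ?Q m')" for m
    unfolding prod.insert[OF insert.hyps(1,2)] by (simp add: coeff_pCons)
  have cI: "card (insert x A) = Suc (card A)" using insert.hyps by simp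
  have Q0: "coeff ?Q (Suc (card A)) = 0" by (rule coeff_eq_0) (simp add: dQ)
  show ?case
  proof (cases j)
    case 0
    have "coeff ?Q (card A) = 1"
      using insert.IH[of 0] insert.hyps(1) by (simp add: esym_0)
    then show ?thesis unfolding Q cI 0 using Q0 insert.hyps by (simp add: esym_0)
  next
    case (Suc j')
    have ins: "esym j (insert x A) l = esym j A l + l x * esym j' A l"
      unfolding Suc using insert.hyps by (rule esym_insert)
    have m: "card (insert x A) - j = card A - j'" unfolding cI Suc by simp
    have IH': "coeff ?Q (card A - j') = (-1) ^ j' * esym j' A l"
      using insert.prems(1) unfolding cI Suc by (intro insert.IH insert.hyps) simp
    have cs: "(case card A - j' of 0 \<Rightarrow> 0 | Suc m' \<Rightarrow> coeff ?Q m') = (-1) ^ j * esym j A l"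
    proof (cases "j' = card A")
      case True
      then show ?thesis using esym_gt_card[OF insert.hyps(1), of j l] Suc by simp
    next
      case False
      then have "j \<le> card A" "card A - j' = Suc (card A - j)"
        using insert.prems(1) unfolding cI Suc by auto
      then show ?thesis using insert.IH[of j] insert.hyps(1) by simp
    qed
    show ?thesis unfolding Q m IH' ins cs by (simp add: Suc algebra_simps)
  qed
qed

lemma esym_newton:
  assumes "finite A"
  shows "(esym (Suc j) A l)\<^sup>2 \<ge> esym j A l * esym (Suc (Suc j)) A l"
proof (cases "Suc (Suc j) \<le> card A")
  case True
  let ?P = "\<Prod>i\<in>A. [:- l i, 1:]"
  obtain xs where xs: "set xs = A" "distinct xs" using assms finite_distinct_list by blast
  have "?P = (\<Prod>a\<leftarrow>map l xs. [:- a, 1:])"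
    unfolding xs(1)[symmetric] prod.distinct_set_conv_list[OF xs(2)] by (simp add: o_def)
  then have sp: "real_splitting ?P" unfolding real_splitting_def by (metis smult_1_left)
  define m where "m = card A - Suc (Suc j)"
  have m: "Suc m = card A - Suc j" "Suc (Suc m) = card A - j" using True unfolding m_def by auto
  have c1: "coeff ?P m = (-1) ^ j * esym (Suc (Suc j)) A l"
    unfolding m_def using True coeff_prod_linear[OF assms, of "Suc (Suc j)" l] by simp
  have c2: "coeff ?P (Suc m) = - ((-1) ^ j * esym (Suc j) A l)"
    unfolding m(1) using True coeff_prod_linear[OF assms, of "Suc j" l] by simp
  have c3: "coeff ?P (Suc (Suc m)) = (-1) ^ j * esym j A l"
    unfolding m(2) using True coeff_prod_linear[OF assms, of j l] by simp
  have sg: "((-1) ^ j * a) * ((-1) ^ j * b) = a * b" for a b :: real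
    by (cases "even j") auto
  have "coeff ?P m * coeff ?P (Suc (Suc m)) \<le> (coeff ?P (Suc m))\<^sup>2" by (rule newton_weak_coeff[OF sp])
  then show ?thesis unfolding c1 c2 c3 power2_eq_square minus_mult_minus sg by (simp only: mult.commute)
next
  case False
  then show ?thesis using esym_gt_card[OF assms, of "Suc (Suc j)"] by simp
qed

text \<open>The positivity of \<open>S_(j)(\<lambda> | x)\<close> on the cone. If \<open>e_j > 0 \<ge> e_(j+1)\<close> for the entries other than \<open>x\<close>, then positivity of
  \<open>S_(j+1)\<close> forces \<open>l x > 0\<close>, and positivity of \<open>S_(j+2)\<close> then contradicts Newton's inequality
  \<open>e_(j+1)\<^sup>2 \<ge> e_j e_(j+2)\<close>.\<close>

lemma esym_remove_pos:
  assumes "finite A" "x \<in> A" and pos: "\<And>j. j \<le> k \<Longrightarrow> esym j A l > 0"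
  shows "j < k \<Longrightarrow> esym j (A - {x}) l > 0"
proof (induction j)
  case 0
  then show ?case using assms by (simp add: esym_0)
next
  case (Suc j)
  let ?E = "\<lambda>j. esym j (A - {x}) l"
  have ins: "esym (Suc j) A l = ?E (Suc j) + l x * ?E j" for j
    using esym_insert[of "A - {x}" x j l] assms by (simp add: insert_absorb)
  have E: "?E j > 0" using Suc by simp
  have p1: "?E (Suc j) + l x * ?E j > 0" and p2: "?E (Suc (Suc j)) + l x * ?E (Suc j) > 0"
    using pos[of "Suc j"] pos[of "Suc (Suc j)"] ins Suc by auto
  have N: "(?E (Suc j))\<^sup>2 \<ge> ?E j * ?E (Suc (Suc j))" using assms by (intro esym_newton) auto
  show ?case
  proof (rule ccontr)
    assume "\<not> ?E (Suc j) > 0"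
    then have le: "?E (Suc j) \<le> 0" by simp
    have "?E j * (?E (Suc (Suc j)) + l x * ?E (Suc j)) > 0" using E p2 by simp
    then have "(?E (Suc j))\<^sup>2 + (l x * ?E j) * ?E (Suc j) > 0" using N by (simp add: algebra_simps)
    then have "?E (Suc j) * (?E (Suc j) + l x * ?E j) > 0" by (simp add: power2_eq_square algebra_simps)
    then show False using le p1 by (simp add: zero_less_mult_iff)
  qed
qed

text \<open>Elementary symmetric functions of the eigenvalues are coefficients of the characteristic polynomial.\<close>

lemma elem_sym_eigenvalues_unique:
  fixes M :: "real^'n^'n"
  assumes "has_eigenvalues M l" "has_eigenvalues M l'"
  shows "elem_sym k l = elem_sym k l'"
proof (cases "k \<le> CARD('n)")
  case True
  have "(\<Prod>i\<in>UNIV. [:- l $ i, 1:]) = (\<Prod>i\<in>UNIV. [:- l' $ i, 1:])"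
    using assms unfolding has_eigenvalues_def
    by (intro poly_eq_poly_eq_iff[THEN iffD1] ext) (simp add: poly_prod)
  then show ?thesis
    using coeff_prod_linear[of UNIV k "($) l"] coeff_prod_linear[of UNIV k "($) l'"] True
    unfolding elem_sym_esym by simp
next
  case False
  then show ?thesis unfolding elem_sym_esym by (simp add: esym_gt_card)
qed


section \<open>Symmetric matrices and rank-one updates\<close>

text \<open>A maximiser of the Rayleigh quotient over an invariant subspace is an eigenvector: the first variation in the
  direction of \<open>z = M x - \<mu> x\<close>, which lies in the subspace, is \<open>2 |z|\<^sup>2\<close>.\<close>

lemma symmetric_matrix_eigenvector_in_subspace:
  fixes M :: "real^'n^'n"
  assumes sym: "transpose M = M" and S: "subspace S" "S \<noteq> {0}" and inv: "\<And>x. x \<in> S \<Longrightarrow> M *v x \<in> S"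
  obtains x \<mu> where "x \<in> S" "norm x = 1" "M *v x = \<mu> *\<^sub>R x"
proof -
  have symi: "a \<bullet> (M *v b) = (M *v a) \<bullet> b" for a b
    using dot_lmul_matrix[of a M b] sym by (metis transpose_matrix_vector)
  have 0: "0 \<in> S" using S(1) by (rule subspace_0)
  obtain y where y: "y \<in> S" "y \<noteq> 0" using S 0 by auto
  let ?K = "S \<inter> sphere 0 1"
  have "y /\<^sub>R norm y \<in> ?K" using y S(1) by (simp add: subspace_scale)
  moreover have "compact ?K"
    by (rule closed_Int_compact[OF closed_subspace[OF S(1)] compact_sphere])
  moreover have "continuous_on ?K (\<lambda>x. x \<bullet> (M *v x))"
    by (intro continuous_intros linear_continuous_on matrix_vector_mul_bounded_linear)
  ultimately obtain x where x: "x \<in> ?K" and max: "\<And>y. y \<in> ?K \<Longrightarrow> y \<bullet> (M *v y) \<le> x \<bullet> (M *v x)"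
    using continuous_attains_sup[of ?K "\<lambda>x. x \<bullet> (M *v x)"] by blast
  define \<mu> where "\<mu> = x \<bullet> (M *v x)"
  have xS: "x \<in> S" and xn: "x \<bullet> x = 1" using x by (auto simp: norm_eq_1)
  have le: "y \<bullet> (M *v y) \<le> \<mu> * (y \<bullet> y)" if "y \<in> S" for y
  proof (cases "y = 0")
    case False
    have "y /\<^sub>R norm y \<in> ?K" using that False S(1) by (simp add: subspace_scale)
    from max[OF this] have "(y \<bullet> (M *v y)) / (norm y)\<^sup>2 \<le> \<mu>"
      by (simp add: \<mu>_def matrix_vector_mult_scaleR power2_eq_square divide_inverse mult_ac)
    then show ?thesis using False by (simp add: power2_norm_eq_inner divide_le_eq)
  qed simp
  define z where "z = M *v x - \<mu> *\<^sub>R x"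
  define c where "c = \<mu> * (z \<bullet> z) - z \<bullet> (M *v z)"
  have zS: "z \<in> S" unfolding z_def using inv[OF xS] xS S(1) by (intro subspace_diff subspace_scale)
  have key: "2 * t * (z \<bullet> z) \<le> t\<^sup>2 * c" for t
  proof -
    have "x + t *\<^sub>R z \<in> S" using xS zS S(1) by (intro subspace_add subspace_scale)
    from le[OF this] have ineq: "\<mu> + 2 * t * (z \<bullet> (M *v x)) + t\<^sup>2 * (z \<bullet> (M *v z)) \<le> \<mu> * (1 + 2 * t * (x \<bullet> z) + t\<^sup>2 * (z \<bullet> z))"
      using symi[of x z] by (simp add: matrix_vector_mult_scaleR matrix_vector_right_distrib inner_add_left
          inner_add_right \<mu>_def[symmetric] xn power2_eq_square inner_commute algebra_simps)
    have "z \<bullet> z = z \<bullet> (M *v x) - \<mu> * (x \<bullet> z)"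
      by (subst (2) z_def) (simp add: inner_diff_right inner_commute)
    then have "z \<bullet> (M *v x) = z \<bullet> z + \<mu> * (x \<bullet> z)" by simp
    with ineq show ?thesis unfolding c_def by (simp add: algebra_simps)
  qed
  have "z \<bullet> z \<le> 0"
  proof (rule ccontr)
    assume "\<not> z \<bullet> z \<le> 0"
    then have pos: "z \<bullet> z > 0" by (simp only: not_le)
    define t where "t = (z \<bullet> z) / (\<bar>c\<bar> + 1)"
    have t: "t > 0" unfolding t_def using pos by (intro divide_pos_pos) auto
    have "t * (2 * (z \<bullet> z)) \<le> t * (t * c)" using key[of t] by (simp add: power2_eq_square mult_ac)
    then have "2 * (z \<bullet> z) \<le> t * c" using t by (subst (asm) mult_le_cancel_left_pos)
    also have "\<dots> \<le> t * (\<bar>c\<bar> + 1)" using t by (intro mult_left_mono) auto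
    also have "\<dots> = z \<bullet> z" unfolding t_def by simp
    finally show False using pos by simp
  qed
  then have "z = 0" by (metis inner_gt_zero_iff not_le)
  then have "M *v x = \<mu> *\<^sub>R x" unfolding z_def by simp
  then show ?thesis using that xS x by auto
qed

lemma symmetric_matrix_eigenbasis_subspace:
  fixes M :: "real^'n^'n"
  assumes sym: "transpose M = M"
  shows "subspace S \<Longrightarrow> (\<And>x. x \<in> S \<Longrightarrow> M *v x \<in> S) \<Longrightarrow>
    \<exists>B. B \<subseteq> S \<and> span B = S \<and> pairwise orthogonal B \<and> (\<forall>b\<in>B. norm b = 1 \<and> (\<exists>\<mu>. M *v b = \<mu> *\<^sub>R b))"
proof (induction "dim S" arbitrary: S rule: less_induct)
  case less
  show ?case
  proof (cases "S = {0}")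
    case True
    then show ?thesis by (intro exI[of _ "{}"]) auto
  next
    case False
    obtain x \<mu> where x: "x \<in> S" "norm x = 1" "M *v x = \<mu> *\<^sub>R x"
      using symmetric_matrix_eigenvector_in_subspace[OF sym less.prems(1) False less.prems(2)] by blast
    have xx: "x \<bullet> x = 1" using x(2) by (simp add: norm_eq_1)
    define T where "T = {y \<in> S. x \<bullet> y = 0}"
    have symi: "a \<bullet> (M *v b) = (M *v a) \<bullet> b" for a b
      using dot_lmul_matrix[of a M b] sym by (metis transpose_matrix_vector)
    have T: "subspace T" unfolding T_def using less.prems(1)
      by (auto simp: subspace_def inner_add_right)
    have Tinv: "M *v y \<in> T" if "y \<in> T" for y
      using that less.prems(2) symi[of x y] x(3) unfolding T_def by simp
    have "x \<notin> T" unfolding T_def using xx by simp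
    then have "T \<subset> S" using x(1) unfolding T_def by blast
    then have "dim T < dim S" using T less.prems(1) by (intro dim_psubset) (simp add: span_eq_iff[THEN iffD2])
    then obtain B where B: "B \<subseteq> T" "span B = T" "pairwise orthogonal B"
      "\<forall>b\<in>B. norm b = 1 \<and> (\<exists>\<mu>. M *v b = \<mu> *\<^sub>R b)"
      using less.hyps[of T] T Tinv by blast
    have "span (insert x B) = S"
    proof
      show "span (insert x B) \<subseteq> S"
        using B x T_def less.prems(1) by (intro span_minimal) auto
      show "S \<subseteq> span (insert x B)"
      proof
        fix y assume "y \<in> S"
        then have "y - (x \<bullet> y) *\<^sub>R x \<in> T" unfolding T_def using x xx less.prems(1)
          by (auto intro!: subspace_diff subspace_scale simp: inner_diff_right)
        then have "y - (x \<bullet> y) *\<^sub>R x \<in> span B" using B by simp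
        then show "y \<in> span (insert x B)" by (metis span_breakdown_eq)
      qed
    qed
    moreover have "pairwise orthogonal (insert x B)"
      using B(1,3) unfolding T_def by (auto simp: pairwise_insert orthogonal_def inner_commute)
    ultimately show ?thesis using B x T_def by (intro exI[of _ "insert x B"]) auto
  qed
qed

lemma symmetric_matrix_eigenbasis:
  fixes M :: "real^'n^'n"
  assumes sym: "transpose M = M"
  obtains v :: "'n \<Rightarrow> real^'n" and d where "\<And>i j. v i \<bullet> v j = (if i = j then 1 else 0)"
    "\<And>i. M *v v i = d i *\<^sub>R v i"
proof -
  obtain B where B: "span B = (UNIV :: (real^'n) set)" "pairwise orthogonal B"
      "\<forall>b\<in>B. norm b = 1 \<and> (\<exists>\<mu>. M *v b = \<mu> *\<^sub>R b)"
    using symmetric_matrix_eigenbasis_subspace[OF sym subspace_UNIV] by auto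
  have "0 \<notin> B" using B(3) by (metis norm_zero zero_neq_one)
  then have ind: "independent B" using B(2) by (rule pairwise_orthogonal_independent[rotated])
  then have fin: "finite B" by (rule independent_imp_finite)
  have "card B = dim (UNIV :: (real^'n) set)" using ind B(1) dim_eq_card[of B UNIV] by simp
  then have "card B = card (UNIV :: 'n set)" by simp
  then obtain v where v: "bij_betw v (UNIV :: 'n set) B"
    using fin finite_same_card_bij[of "UNIV :: 'n set" B] by auto
  have vB: "v i \<in> B" for i using v bij_betwE by blast
  have "\<forall>i. \<exists>\<mu>. M *v v i = \<mu> *\<^sub>R v i" using B(3) vB by blast
  then obtain d where d: "\<And>i. M *v v i = d i *\<^sub>R v i" by metis
  have "v i \<bullet> v j = (if i = j then 1 else 0)" for i j
  proof (cases "i = j")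
    case True
    then show ?thesis using B(3) vB[of j] by (simp add: norm_eq_1)
  next
    case False
    then have "v i \<noteq> v j" using v by (auto simp: bij_betw_def inj_def)
    then show ?thesis using B(2) vB False by (auto simp: pairwise_def orthogonal_def)
  qed
  then show ?thesis using that d by blast
qed

text \<open>Adding multiples of one row to other rows does not change a determinant. Together with the next lemma this
  expands the determinant of a rank-one update by linearity in each row.\<close>

lemma det_replace_row_update:
  fixes A :: "real^'n^'n" and r w :: "real^'n"
  assumes "finite S"
  shows "i \<notin> S \<Longrightarrow> det (\<chi> j. if j = i then w else if j \<in> S then row j A + r $ j *s w else row j A)
    = det (\<chi> j. if j = i then w else row j A)"
  using assms
proof (induction S rule: finite_induct)
  case (insert m S)
  then have mi: "m \<noteq> i" by auto
  let ?c = "\<lambda>j. if j = i then w else if j \<in> S then row j A + r $ j *s w else row j A"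
  have "det (\<chi> j. if j = i then w else if j \<in> insert m S then row j A + r $ j *s w else row j A)
    = det (\<chi> j. if j = m then row m A + r $ m *s w else ?c j)"
    using mi by (intro arg_cong[of _ _ det]) (auto simp: vec_eq_iff)
  also have "\<dots> = det (\<chi> j. if j = m then row m A else ?c j) + r $ m * det (\<chi> j. if j = m then w else ?c j)"
    by (simp only: det_row_add det_row_mul)
  also have "det (\<chi> j. if j = m then w else ?c j) = 0"
    using mi by (intro det_identical_rows[of m i]) (auto simp: row_def vec_eq_iff)
  also have "(\<chi> j. if j = m then row m A else ?c j) = (\<chi> j. ?c j)"
    using insert mi by (auto simp: vec_eq_iff)
  finally show ?case using insert by simp
qed (simp cong: if_cong)

lemma det_rank_one_update_rows:
  fixes A :: "real^'n^'n" and r w :: "real^'n"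
  assumes "finite S"
  shows "det (\<chi> j. if j \<in> S then row j A + r $ j *s w else row j A)
    = det A + (\<Sum>i\<in>S. r $ i * det (\<chi> j. if j = i then w else row j A))"
  using assms
proof (induction S rule: finite_induct)
  case empty
  have "(\<chi> j. row j A) = A" by (simp add: vec_eq_iff row_def)
  then show ?case by simp
next
  case (insert m S)
  let ?c = "\<lambda>j. if j \<in> S then row j A + r $ j *s w else row j A"
  have "det (\<chi> j. if j \<in> insert m S then row j A + r $ j *s w else row j A)
    = det (\<chi> j. if j = m then row m A + r $ m *s w else ?c j)"
    using insert by (intro arg_cong[of _ _ det]) (auto simp: vec_eq_iff)
  also have "\<dots> = det (\<chi> j. if j = m then row m A else ?c j) + r $ m * det (\<chi> j. if j = m then w else ?c j)"
    by (simp only: det_row_add det_row_mul)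
  also have "det (\<chi> j. if j = m then w else ?c j) = det (\<chi> j. if j = m then w else row j A)"
    using insert by (intro det_replace_row_update) auto
  also have "(\<chi> j. if j = m then row m A else ?c j) = (\<chi> j. ?c j)"
    using insert by (auto simp: vec_eq_iff)
  finally show ?case using insert by simp
qed

definition outer :: "real^'n \<Rightarrow> real^'n \<Rightarrow> real^'n^'n" where
  "outer a b = (\<chi> i j. a $ i * b $ j)"

definition diag :: "('n \<Rightarrow> real) \<Rightarrow> real^'n^'n" where
  "diag c = (\<chi> i j. if i = j then c i else 0)"

lemma det_diag: "det (diag c) = (\<Prod>i\<in>UNIV. c i)"
  unfolding diag_def by (subst det_diagonal) auto

text \<open>The determinants in the expansion over rows are evaluated by Cramer's rule, since \<open>w\<close> is a
  combination of the rows of the diagonal matrix.\<close>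

lemma det_diag_minus_outer:
  fixes r w :: "real^'n"
  assumes c: "\<And>i. c i \<noteq> 0"
  shows "det (diag c - outer r w) = (\<Prod>i\<in>UNIV. c i) - (\<Sum>i\<in>UNIV. r $ i * w $ i * (\<Prod>j\<in>UNIV - {i}. c j))"
proof -
  have eq: "diag c - outer r w = (\<chi> j. if j \<in> UNIV then row j (diag c) + (- r) $ j *s w else row j (diag c))"
    by (simp add: vec_eq_iff row_def outer_def)
  have w: "w = (\<Sum>i\<in>UNIV. (\<chi> i. w $ i / c i) $ i *s row i (diag c))"
    using c by (simp add: vec_eq_iff row_def diag_def if_distrib sum.delta cong: if_cong)
  have repl: "det (\<chi> j. if j = i then w else row j (diag c)) = w $ i * (\<Prod>j\<in>UNIV - {i}. c j)" for i
  proof -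
    have "det (\<chi> j. if j = i then w else row j (diag c)) = (\<chi> i. w $ i / c i) $ i * det (diag c)"
      using cramer_lemma_transpose[of i "\<chi> i. w $ i / c i" "diag c"] unfolding w[symmetric] .
    also have "\<dots> = w $ i / c i * (c i * (\<Prod>j\<in>UNIV - {i}. c j))"
      unfolding det_diag by (subst prod.remove[of _ i]) auto
    finally show ?thesis using c[of i] by simp
  qed
  show ?thesis unfolding eq det_rank_one_update_rows[OF finite] repl det_diag
    by (simp add: sum_negf mult_ac)
qed

lemma matrix_sub_ldistrib: "(A :: real^'n^'m) ** (B - C) = A ** B - A ** C"
  by (simp add: vec_eq_iff matrix_matrix_mult_def algebra_simps sum_subtractf)

lemma matrix_sub_rdistrib: "(A - B) ** (C :: real^'n^'m) = A ** C - B ** C"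
  by (simp add: vec_eq_iff matrix_matrix_mult_def algebra_simps sum_subtractf)

context
  fixes M :: "real^'n^'n" and v :: "'n \<Rightarrow> real^'n" and d :: "'n \<Rightarrow> real"
  assumes on: "\<And>i j. v i \<bullet> v j = (if i = j then 1 else 0)" and ev: "\<And>i. M *v v i = d i *\<^sub>R v i"
begin

definition "basis_matrix = (\<chi> i j. v j $ i)"

lemma basis_matrix_orthogonal: "transpose basis_matrix ** basis_matrix = mat 1" "basis_matrix ** transpose basis_matrix = mat 1"
proof -
  show "transpose basis_matrix ** basis_matrix = mat 1"
    using on by (simp add: vec_eq_iff matrix_matrix_mult_def transpose_def basis_matrix_def mat_def inner_vec_def)
  then show "basis_matrix ** transpose basis_matrix = mat 1" by (simp add: matrix_left_right_inverse)
qed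

lemma mult_basis_matrix: "M ** basis_matrix = basis_matrix ** diag d"
proof -
  have "(\<Sum>k\<in>UNIV. M $ i $ k * v j $ k) = d j * v j $ i" for i j
    using arg_cong[OF ev[of j], of "\<lambda>x. x $ i"] by (simp add: matrix_vector_mult_def)
  then show ?thesis
    by (simp add: vec_eq_iff matrix_matrix_mult_def basis_matrix_def diag_def if_distrib mult_ac cong: if_cong)
qed

text \<open>The characteristic polynomial of a rank-one update, written in an eigenbasis of \<open>M\<close>.\<close>

lemma det_shift_minus_outer:
  "det (mat t - (M + outer (basis_matrix *v w) (basis_matrix *v w))) = det (diag (\<lambda>i. t - d i) - outer w w)"
proof -
  have o: "outer (basis_matrix *v w) (basis_matrix *v w) = basis_matrix ** outer w w ** transpose basis_matrix"
    by (simp add: vec_eq_iff outer_def matrix_matrix_mult_def matrix_vector_mult_def transpose_def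
        sum_distrib_left sum_distrib_right mult_ac)
  have m: "M = basis_matrix ** diag d ** transpose basis_matrix"
    by (metis mult_basis_matrix basis_matrix_orthogonal(2) matrix_mul_assoc matrix_mul_rid)
  have t: "mat t = basis_matrix ** diag (\<lambda>i. t) ** transpose basis_matrix"
  proof -
    have "basis_matrix ** diag (\<lambda>i. t) = t *\<^sub>R basis_matrix"
      by (simp add: vec_eq_iff matrix_matrix_mult_def diag_def if_distrib mult_ac cong: if_cong)
    moreover have "(t *\<^sub>R basis_matrix) ** transpose basis_matrix = t *\<^sub>R (basis_matrix ** transpose basis_matrix)"
      by (simp add: vec_eq_iff matrix_matrix_mult_def sum_distrib_left mult_ac)
    moreover have "mat t = t *\<^sub>R (mat 1 :: real^'n^'n)" by (simp add: vec_eq_iff mat_def)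
    ultimately show ?thesis by (simp only: basis_matrix_orthogonal)
  qed
  have dd: "diag (\<lambda>i. t - d i) = diag (\<lambda>i. t) - diag d" by (simp add: vec_eq_iff diag_def)
  have "mat t - (M + outer (basis_matrix *v w) (basis_matrix *v w)) = basis_matrix ** (diag (\<lambda>i. t - d i) - outer w w) ** transpose basis_matrix"
    unfolding dd o by (subst m, subst t) (simp add: matrix_sub_ldistrib matrix_sub_rdistrib)
  moreover have "det basis_matrix * det (transpose basis_matrix) = 1"
    by (metis basis_matrix_orthogonal(2) det_I det_mul)
  ultimately show ?thesis by (simp add: det_mul)
qed

lemma has_eigenvalues_eigenbasis: "has_eigenvalues M (\<chi> i. d i)"
proof -
  have "det (mat t - M) = (\<Prod>i\<in>UNIV. t - d i)" for t
  proof -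
    have "outer (basis_matrix *v 0) (basis_matrix *v 0) = 0" "outer 0 0 = (0 :: real^'n^'n)"
      by (simp_all add: outer_def vec_eq_iff)
    then show ?thesis using det_shift_minus_outer[of t 0] by (simp add: det_diag)
  qed
  then show ?thesis unfolding has_eigenvalues_def by simp
qed

end

text \<open>Comparing coefficients in the characteristic polynomial of a rank-one update. The hypothesis asks for the identity
  only beyond all \<open>d $ i\<close>, where the determinant formula has nonzero diagonal entries; polynomials
  that agree there are equal.\<close>

lemma prod_shift_expand_unique:
  fixes d l' w :: "real^'n"
  assumes eq: "\<And>t. (\<And>i. t > d $ i) \<Longrightarrow>
      (\<Prod>i\<in>UNIV. t - l' $ i) = (\<Prod>i\<in>UNIV. t - d $ i) - (\<Sum>i\<in>UNIV. (w $ i)\<^sup>2 * (\<Prod>j\<in>UNIV - {i}. t - d $ j))"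
    and j: "Suc j \<le> CARD('n)"
  shows "elem_sym (Suc j) l' = elem_sym (Suc j) d + (\<Sum>i\<in>UNIV. (w $ i)\<^sup>2 * esym j (UNIV - {i}) (($) d))"
proof -
  define P1 where "P1 = (\<Prod>i\<in>UNIV. [:- l' $ i, 1:])"
  define P2 where "P2 = (\<Prod>i\<in>UNIV. [:- d $ i, 1:]) - (\<Sum>i\<in>UNIV. smult ((w $ i)\<^sup>2) (\<Prod>j\<in>UNIV - {i}. [:- d $ j, 1:]))"
  have "P1 = P2"
  proof (rule ccontr)
    assume "P1 \<noteq> P2"
    then have "finite {t. poly (P1 - P2) t = 0}" by (intro poly_roots_finite) simp
    moreover have "{Max (range (($) d)) <..} \<subseteq> {t. poly (P1 - P2) t = 0}"
    proof
      fix t assume "t \<in> {Max (range (($) d)) <..}"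
      then have "t > d $ i" for i
        using Max_ge[of "range (($) d)" "d $ i"] by (simp add: less_le_trans le_less_trans)
      from eq[OF this] show "t \<in> {t. poly (P1 - P2) t = 0}"
        unfolding P1_def P2_def by (simp add: poly_prod poly_sum)
    qed
    ultimately show False using infinite_Ioi finite_subset by blast
  qed
  have m: "CARD('n) - Suc j = card (UNIV - {i :: 'n}) - j" for i
    by (simp add: card_Diff_singleton)
  have "coeff P1 (CARD('n) - Suc j) = (-1) ^ Suc j * elem_sym (Suc j) l'"
    unfolding P1_def elem_sym_esym using j by (intro coeff_prod_linear) auto
  moreover have "coeff P2 (CARD('n) - Suc j) = (-1) ^ Suc j * (elem_sym (Suc j) d + (\<Sum>i\<in>UNIV. (w $ i)\<^sup>2 * esym j (UNIV - {i}) (($) d)))"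
  proof -
    have a: "coeff (\<Prod>i\<in>UNIV. [:- d $ i, 1:]) (CARD('n) - Suc j) = (-1) ^ Suc j * elem_sym (Suc j) d"
      unfolding elem_sym_esym using j by (intro coeff_prod_linear) auto
    have b: "coeff (\<Prod>k\<in>UNIV - {i}. [:- d $ k, 1:]) (CARD('n) - Suc j) = (-1) ^ j * esym j (UNIV - {i}) (($) d)" for i
      unfolding m[of i] using j by (intro coeff_prod_linear) (auto simp: card_Diff_singleton)
    show ?thesis unfolding P2_def coeff_diff a coeff_sum coeff_smult b
      by (simp add: sum_distrib_left algebra_simps sum_negf)
  qed
  ultimately show ?thesis using \<open>P1 = P2\<close> by simp
qed

lemma elem_sym_0: "elem_sym 0 l = 1"
  unfolding elem_sym_esym by (simp add: esym_0)

lemma symmetric_has_eigenvalues: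
  fixes M :: "real^'n^'n"
  assumes "transpose M = M"
  shows "\<exists>l. has_eigenvalues M l"
  using symmetric_matrix_eigenbasis[OF assms] has_eigenvalues_eigenbasis by metis

text \<open>The increments \<open>(w $ i)\<^sup>2 S_(j-1)(\<lambda> | i)\<close> are nonnegative by \<open>esym_remove_pos\<close>. The cone is
  preserved, so that the update can be iterated.\<close>

lemma elem_sym_rank_one_update:
  fixes M :: "real^'n^'n"
  assumes sym: "transpose M = M" and l: "has_eigenvalues M l" "l \<in> Gamma_cone k" and k: "k \<le> CARD('n)"
  shows "\<exists>l'. has_eigenvalues (M + outer \<eta> \<eta>) l' \<and> l' \<in> Gamma_cone k \<and> (\<forall>j\<le>k. elem_sym j l \<le> elem_sym j l')"
proof -
  obtain v :: "'n \<Rightarrow> real^'n" and d where v: "\<And>i j. v i \<bullet> v j = (if i = j then 1 else 0)" "\<And>i. M *v v i = d i *\<^sub>R v i"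
    using symmetric_matrix_eigenbasis[OF sym] by blast
  define D where "D = (\<chi> i. d i)"
  have D: "has_eigenvalues M D" unfolding D_def by (rule has_eigenvalues_eigenbasis[OF v])
  have eD: "elem_sym j D = elem_sym j l" for j by (rule elem_sym_eigenvalues_unique[OF D l(1)])
  have "transpose (M + outer \<eta> \<eta>) = M + outer \<eta> \<eta>"
    using sym by (simp add: vec_eq_iff transpose_def outer_def mult.commute)
  then obtain l' where l': "has_eigenvalues (M + outer \<eta> \<eta>) l'"
    using symmetric_has_eigenvalues by blast
  define w where "w = transpose (basis_matrix v) *v \<eta>"
  have \<eta>: "\<eta> = basis_matrix v *v w"
    unfolding w_def matrix_vector_mul_assoc basis_matrix_orthogonal(2)[OF v] matrix_vector_mul_lid ..
  have prodeq: "(\<Prod>i\<in>UNIV. t - l' $ i) = (\<Prod>i\<in>UNIV. t - D $ i) - (\<Sum>i\<in>UNIV. (w $ i)\<^sup>2 * (\<Prod>j\<in>UNIV - {i}. t - D $ j))"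
    if "\<And>i. t > D $ i" for t
  proof -
    have "(\<Prod>i\<in>UNIV. t - l' $ i) = det (diag (\<lambda>i. t - d i) - outer w w)"
      using l' unfolding has_eigenvalues_def \<eta> det_shift_minus_outer[OF v] by simp
    also have "\<dots> = (\<Prod>i\<in>UNIV. t - d i) - (\<Sum>i\<in>UNIV. (w $ i)\<^sup>2 * (\<Prod>j\<in>UNIV - {i}. t - d j))"
      using that by (subst det_diag_minus_outer)
        (auto simp: D_def power2_eq_square less_imp_neq[THEN not_sym])
    finally show ?thesis by (simp add: D_def)
  qed
  have pos: "esym j UNIV (($) D) > 0" if "j \<le> k" for j
    using that l(2) eD[of j] by (cases j) (auto simp: Gamma_cone_def elem_sym_esym esym_0)
  have le: "elem_sym j l \<le> elem_sym j l'" if "j \<le> k" for j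
  proof (cases j)
    case (Suc i)
    have "esym i (UNIV - {x}) (($) D) > 0" for x
      by (rule esym_remove_pos[where k = k]) (use pos that Suc in auto)
    then have "(\<Sum>x\<in>UNIV. (w $ x)\<^sup>2 * esym i (UNIV - {x}) (($) D)) \<ge> 0"
      by (intro sum_nonneg mult_nonneg_nonneg) (auto simp: less_imp_le)
    then show ?thesis
      using prod_shift_expand_unique[OF prodeq, of i] that k eD Suc by simp
  qed (simp add: elem_sym_0)
  have "l' \<in> Gamma_cone k"
    using le l(2) unfolding Gamma_cone_def by (auto intro: less_le_trans)
  then show ?thesis using l' le by blast
qed

lemma psd_matrix_sum_of_squares:
  fixes P :: "real^'n^'n"
  assumes sym: "transpose P = P" and psd: "\<And>x. x \<bullet> (P *v x) \<ge> 0"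
  obtains \<eta> :: "'n \<Rightarrow> real^'n" where "P = (\<Sum>i\<in>UNIV. outer (\<eta> i) (\<eta> i))"
proof -
  obtain v :: "'n \<Rightarrow> real^'n" and d where v: "\<And>i j. v i \<bullet> v j = (if i = j then 1 else 0)" "\<And>i. P *v v i = d i *\<^sub>R v i"
    using symmetric_matrix_eigenbasis[OF sym] by blast
  have d: "d i \<ge> 0" for i using psd[of "v i"] v by simp
  let ?Q = "basis_matrix v"
  have P: "P = ?Q ** diag d ** transpose ?Q"
    by (metis mult_basis_matrix[OF v] basis_matrix_orthogonal(2)[OF v] matrix_mul_assoc matrix_mul_rid)
  have "P $ a $ b = (\<Sum>i\<in>UNIV. outer (sqrt (d i) *\<^sub>R v i) (sqrt (d i) *\<^sub>R v i)) $ a $ b" for a b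
  proof -
    have sq: "sqrt (d i) * (sqrt (d i) * y) = d i * y" for i y
      using d[of i] by (metis mult.assoc real_sqrt_mult_self abs_of_nonneg)
    show ?thesis
      by (subst P) (simp add: matrix_matrix_mult_def diag_def transpose_def basis_matrix_def[OF v] outer_def sq
          if_distrib mult_ac cong: if_cong)
  qed
  then have "P = (\<Sum>i\<in>UNIV. outer (sqrt (d i) *\<^sub>R v i) (sqrt (d i) *\<^sub>R v i))"
    by (simp add: vec_eq_iff)
  then show ?thesis by (rule that)
qed

text \<open>A positive semidefinite difference is a sum of rank-one matrices, which are added one after the other.\<close>

lemma elem_sym_eigenvalues_mono:
  fixes M N :: "real^'n^'n"
  assumes symM: "transpose M = M" and symN: "transpose N = N"
    and psd: "\<And>x. x \<bullet> (M *v x) \<le> x \<bullet> (N *v x)"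
    and l: "has_eigenvalues M l" "l \<in> Gamma_cone k" and l': "has_eigenvalues N l'"
    and k: "k \<le> CARD('n)" and j: "j \<le> k"
  shows "elem_sym j l \<le> elem_sym j l'"
proof -
  have "transpose (N - M) = N - M" using symM symN by (simp add: transpose_def vec_eq_iff)
  moreover have "x \<bullet> ((N - M) *v x) \<ge> 0" for x
    using psd[of x] by (simp add: matrix_vector_mult_diff_rdistrib inner_diff_right)
  ultimately obtain \<eta> :: "'n \<Rightarrow> real^'n" where \<eta>: "N - M = (\<Sum>i\<in>UNIV. outer (\<eta> i) (\<eta> i))"
    using psd_matrix_sum_of_squares by blast
  have "\<exists>m. has_eigenvalues (M + (\<Sum>i\<in>A. outer (\<eta> i) (\<eta> i))) m \<and> m \<in> Gamma_cone k \<and> (\<forall>j\<le>k. elem_sym j l \<le> elem_sym j m)"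
    if "finite A" for A
    using that
  proof (induction A rule: finite_induct)
    case empty
    then show ?case using l by auto
  next
    case (insert a A)
    let ?M = "M + (\<Sum>i\<in>A. outer (\<eta> i) (\<eta> i))"
    obtain m where m: "has_eigenvalues ?M m" "m \<in> Gamma_cone k" "\<forall>j\<le>k. elem_sym j l \<le> elem_sym j m"
      using insert by blast
    have "transpose ?M = ?M"
      using symM by (simp add: vec_eq_iff transpose_def outer_def mult.commute)
    then obtain m' where "has_eigenvalues (?M + outer (\<eta> a) (\<eta> a)) m'" "m' \<in> Gamma_cone k"
      "\<forall>j\<le>k. elem_sym j m \<le> elem_sym j m'"
      using elem_sym_rank_one_update[OF _ m(1,2) k] by blast
    moreover have "?M + outer (\<eta> a) (\<eta> a) = M + (\<Sum>i\<in>insert a A. outer (\<eta> i) (\<eta> i))"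
      using insert by (simp add: algebra_simps)
    ultimately show ?case using m(3) by (intro exI[of _ m']) (metis order_trans)
  qed
  from this[of UNIV] obtain m where m: "has_eigenvalues (M + (N - M)) m" "\<forall>j\<le>k. elem_sym j l \<le> elem_sym j m"
    unfolding \<eta> by auto
  then have "elem_sym j m = elem_sym j l'" using elem_sym_eigenvalues_unique[of N m l'] l' by simp
  then show ?thesis using m j by auto
qed

text \<open>\<open>R B\<close> and \<open>B R\<close> are conjugate by \<open>R\<close>.\<close>

lemma has_eigenvalues_similar:
  fixes R A :: "real^'n^'n"
  assumes "R ** R' = mat 1"
  shows "has_eigenvalues (R ** B) l \<longleftrightarrow> has_eigenvalues (B ** R) l"
proof -
  have inv: "R' ** R = mat 1" using assms by (simp add: matrix_left_right_inverse)
  have "det (mat t - R ** B) = det (mat t - B ** R)" for t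
  proof -
    have "R' ** mat t ** R = mat t"
    proof -
      have "R' ** mat t = t *\<^sub>R R'" for t
        by (simp add: vec_eq_iff matrix_matrix_mult_def mat_def if_distrib mult_ac cong: if_cong)
      moreover have "(t *\<^sub>R R') ** R = t *\<^sub>R (R' ** R)"
        by (simp add: vec_eq_iff matrix_matrix_mult_def sum_distrib_left mult_ac)
      moreover have "t *\<^sub>R (mat 1 :: real^'n^'n) = mat t" by (simp add: vec_eq_iff mat_def)
      ultimately show ?thesis by (simp only: inv)
    qed
    moreover have "R' ** (R ** B) ** R = B ** R" by (simp add: matrix_mul_assoc inv)
    ultimately have "mat t - B ** R = R' ** (mat t - R ** B) ** R"
      by (simp add: matrix_sub_ldistrib matrix_sub_rdistrib)
    moreover have "det R' * det R = 1" by (metis inv det_I det_mul)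
    ultimately show ?thesis by (simp add: det_mul)
  qed
  then show ?thesis unfolding has_eigenvalues_def by simp
qed


section \<open>Second-order comparison at a maximum\<close>

lemma partial_eqI: "(u has_derivative D) (at x) \<Longrightarrow> partial i u x = D (axis i 1)"
  unfolding partial_def using frechet_derivative_at by metis

lemma grad_eqI: "(u has_derivative (\<lambda>h. g \<bullet> h)) (at x) \<Longrightarrow> grad u x = g"
  unfolding grad_def by (simp add: vec_eq_iff partial_eqI inner_axis)

lemma has_derivative_grad:
  fixes u :: "real^'n \<Rightarrow> real"
  assumes "u differentiable (at x)"
  shows "(u has_derivative (\<lambda>h. grad u x \<bullet> h)) (at x)"
proof -
  let ?D = "frechet_derivative u (at x)"
  have D: "(u has_derivative ?D) (at x)" using assms by (simp add: frechet_derivative_works)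
  then have lin: "linear ?D" by (rule has_derivative_linear)
  have "?D h = grad u x \<bullet> h" for h
  proof -
    have "?D h = ?D (\<Sum>i\<in>UNIV. h $ i *\<^sub>R axis i 1)"
      by (metis basis_expansion scalar_mult_eq_scaleR)
    also have "\<dots> = (\<Sum>i\<in>UNIV. h $ i *\<^sub>R ?D (axis i 1))"
      by (simp add: linear_sum[OF lin] linear_scale[OF lin])
    finally show ?thesis by (simp add: grad_def partial_def inner_vec_def mult.commute)
  qed
  then have "?D = (\<lambda>h. grad u x \<bullet> h)" by blast
  with D show ?thesis by simp
qed

lemma Ck_on_2_iff:
  "Ck_on 2 \<Omega> u \<longleftrightarrow> (\<forall>x\<in>\<Omega>. u differentiable (at x)) \<and>
     (\<forall>i. (\<forall>x\<in>\<Omega>. partial i u differentiable (at x)) \<and> (\<forall>j. continuous_on \<Omega> (partial j (partial i u))))"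
  by (simp add: numeral_2_eq_2)

lemma Ck_on_1_iff:
  "Ck_on 1 \<Omega> u \<longleftrightarrow> (\<forall>x\<in>\<Omega>. u differentiable (at x)) \<and> (\<forall>i. continuous_on \<Omega> (partial i u))"
  unfolding One_nat_def by simp

lemma grad_differentiable:
  fixes u :: "real^'n \<Rightarrow> real"
  assumes "\<And>i. partial i u differentiable (at x)"
  shows "grad u differentiable (at x)"
proof -
  have "(\<lambda>x. grad u x \<bullet> axis i 1) differentiable (at x)" for i
    using assms[of i] by (simp add: grad_def inner_axis)
  then show ?thesis
    by (subst differentiable_componentwise_within) (auto simp: Basis_vec_def)
qed

lemma DERIV_along_line:
  fixes u :: "real^'n \<Rightarrow> real"
  assumes "(u has_derivative (\<lambda>h. G \<bullet> h)) (at (x + t *\<^sub>R e))"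
  shows "((\<lambda>t. u (x + t *\<^sub>R e)) has_real_derivative (G \<bullet> e)) (at t)"
proof -
  have "((\<lambda>t. x + t *\<^sub>R e) has_derivative (\<lambda>h. h *\<^sub>R e)) (at t)"
    by (auto intro!: derivative_eq_intros)
  from has_derivative_compose[OF this assms]
  show ?thesis by (simp add: has_field_derivative_def mult_commute_abs)
qed

text \<open>The mean value theorem along \<open>e\<close> reduces the second difference to a difference of gradients at points at
  distance at most \<open>2 t\<close> from \<open>x\<close>, which the derivative \<open>H\<close> of the gradient controls at \<open>x\<close> alone.\<close>

lemma second_difference_estimate:
  fixes u :: "real^'n \<Rightarrow> real" and e f :: "real^'n"
  assumes U: "open U" "x \<in> U" and G: "\<And>y. y \<in> U \<Longrightarrow> (u has_derivative (\<lambda>h. G y \<bullet> h)) (at y)"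
    and H: "(G has_derivative (\<lambda>h. H *v h)) (at x)" and e: "norm e \<le> 1" and f: "norm f \<le> 1" and eps: "\<epsilon> > 0"
  shows "\<exists>d>0. \<forall>t. 0 < t \<and> t < d \<longrightarrow>
    \<bar>u (x + t *\<^sub>R e + t *\<^sub>R f) - u (x + t *\<^sub>R e) - u (x + t *\<^sub>R f) + u x - t\<^sup>2 * (e \<bullet> (H *v f))\<bar> \<le> 3 * \<epsilon> * t\<^sup>2"
proof -
  obtain r where r: "r > 0" "ball x r \<subseteq> U" using U openE by blast
  obtain d where d: "d > 0" "\<And>y. norm (y - x) < d \<Longrightarrow> norm (G y - G x - H *v (y - x)) \<le> \<epsilon> * norm (y - x)"
    using H eps unfolding has_derivative_at_alt by metis
  define D where "D = min r d / 2"
  have D: "D > 0" using r d by (simp add: D_def)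
  have "\<bar>u (x + t *\<^sub>R e + t *\<^sub>R f) - u (x + t *\<^sub>R e) - u (x + t *\<^sub>R f) + u x - t\<^sup>2 * (e \<bullet> (H *v f))\<bar> \<le> 3 * \<epsilon> * t\<^sup>2"
    if t: "0 < t" "t < D" for t
  proof -
    have small: "norm (s *\<^sub>R e + c *\<^sub>R f) < min r d" if "0 \<le> s" "s \<le> t" "c \<in> {0, t}" for s c
    proof -
      have "norm (s *\<^sub>R e + c *\<^sub>R f) \<le> s * norm e + c * norm f"
        using that t by (intro order_trans[OF norm_triangle_ineq]) auto
      also have "\<dots> \<le> t * 1 + t * 1"
        using that t e f by (intro add_mono mult_mono) auto
      finally show ?thesis using t by (simp add: D_def)
    qed
    have inU: "x + s *\<^sub>R e + c *\<^sub>R f \<in> U" if "0 \<le> s" "s \<le> t" "c \<in> {0, t}" for s c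
      using small[OF that] r(2) by (auto simp: dist_norm algebra_simps norm_minus_commute subset_eq)
    let ?p = "\<lambda>s. u (x + s *\<^sub>R e + t *\<^sub>R f) - u (x + s *\<^sub>R e)"
    have "\<exists>s. 0 < s \<and> s < t \<and> ?p t - ?p 0 = (t - 0) * ((G (x + s *\<^sub>R e + t *\<^sub>R f) - G (x + s *\<^sub>R e)) \<bullet> e)"
    proof (rule MVT2)
      show "(?p has_real_derivative ((G (x + s *\<^sub>R e + t *\<^sub>R f) - G (x + s *\<^sub>R e)) \<bullet> e)) (at s)"
        if "0 \<le> s" "s \<le> t" for s
      proof -
        have "((\<lambda>s. u ((x + t *\<^sub>R f) + s *\<^sub>R e)) has_real_derivative (G (x + s *\<^sub>R e + t *\<^sub>R f) \<bullet> e)) (at s)"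
          using G[OF inU[OF that, of t]] by (intro DERIV_along_line) (simp add: algebra_simps)
        moreover have "((\<lambda>s. u (x + s *\<^sub>R e)) has_real_derivative (G (x + s *\<^sub>R e) \<bullet> e)) (at s)"
          using G[OF inU[OF that, of 0]] by (intro DERIV_along_line) simp
        ultimately show ?thesis
          unfolding inner_diff_left by (intro derivative_intros) (simp_all add: algebra_simps)
      qed
    qed (use t in simp)
    then obtain s where s: "0 < s" "s < t"
      and mv: "?p t - ?p 0 = t * ((G (x + s *\<^sub>R e + t *\<^sub>R f) - G (x + s *\<^sub>R e)) \<bullet> e)" by auto
    define E1 where "E1 = G (x + s *\<^sub>R e + t *\<^sub>R f) - G x - H *v (s *\<^sub>R e + t *\<^sub>R f)"
    define E2 where "E2 = G (x + s *\<^sub>R e) - G x - H *v (s *\<^sub>R e)"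
    have n1: "norm (s *\<^sub>R e + t *\<^sub>R f) \<le> 2 * t"
    proof -
      have "norm (s *\<^sub>R e + t *\<^sub>R f) \<le> s * norm e + t * norm f"
        using s t by (intro order_trans[OF norm_triangle_ineq]) auto
      also have "\<dots> \<le> t * 1 + t * 1" using s t e f by (intro add_mono mult_mono) auto
      finally show ?thesis by simp
    qed
    have n2: "norm (s *\<^sub>R e) \<le> t" using s e mult_mono[of s t "norm e" 1] by simp
    have "norm E1 \<le> \<epsilon> * (2 * t)"
      unfolding E1_def using d(2)[of "x + s *\<^sub>R e + t *\<^sub>R f"] small[of s t] s n1 eps
      by (simp add: add.assoc) (meson less_eq_real_def mult_le_cancel_left_pos order_trans)
    moreover have "norm E2 \<le> \<epsilon> * t"
      unfolding E2_def using d(2)[of "x + s *\<^sub>R e"] small[of s 0] s n2 eps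
      by simp (meson less_eq_real_def mult_le_cancel_left_pos order_trans)
    ultimately have "norm (E1 - E2) \<le> 3 * \<epsilon> * t" using norm_triangle_ineq4[of E1 E2] by simp
    then have "\<bar>(E1 - E2) \<bullet> e\<bar> \<le> 3 * \<epsilon> * t * 1"
      using e eps t by (intro order_trans[OF Cauchy_Schwarz_ineq2] mult_mono) auto
    then have bound: "t * \<bar>(E1 - E2) \<bullet> e\<bar> \<le> t * (3 * \<epsilon> * t)" using t by (intro mult_left_mono) auto
    have "?p t - ?p 0 - t\<^sup>2 * (e \<bullet> (H *v f)) = t * ((E1 - E2) \<bullet> e)"
      unfolding mv E1_def E2_def
      by (simp add: matrix_vector_right_distrib matrix_vector_mult_scaleR inner_diff_left inner_add_left
          power2_eq_square inner_commute algebra_simps)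
    then have eqE: "u (x + t *\<^sub>R e + t *\<^sub>R f) - u (x + t *\<^sub>R e) - u (x + t *\<^sub>R f) + u x - t\<^sup>2 * (e \<bullet> (H *v f))
      = t * ((E1 - E2) \<bullet> e)" by simp
    show ?thesis unfolding eqE abs_mult using bound t by (simp add: power2_eq_square mult_ac)
  qed
  then show ?thesis using D by blast
qed

text \<open>The second difference is symmetric in the two directions.\<close>

lemma hessian_symmetric:
  fixes u :: "real^'n \<Rightarrow> real"
  assumes U: "open U" "x \<in> U" and G: "\<And>y. y \<in> U \<Longrightarrow> (u has_derivative (\<lambda>h. G y \<bullet> h)) (at y)"
    and H: "(G has_derivative (\<lambda>h. H *v h)) (at x)"
  shows "transpose H = H"
proof -
  have *: "H $ i $ j = H $ j $ i" for i j
  proof -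
    let ?e = "axis i 1 :: real^'n" and ?f = "axis j 1 :: real^'n"
    have "\<bar>H $ i $ j - H $ j $ i\<bar> \<le> 6 * \<epsilon>" if eps: "\<epsilon> > 0" for \<epsilon>
    proof -
      obtain d1 where d1: "d1 > 0" "\<And>t. 0 < t \<and> t < d1 \<Longrightarrow>
        \<bar>u (x + t *\<^sub>R ?e + t *\<^sub>R ?f) - u (x + t *\<^sub>R ?e) - u (x + t *\<^sub>R ?f) + u x - t\<^sup>2 * (?e \<bullet> (H *v ?f))\<bar> \<le> 3 * \<epsilon> * t\<^sup>2"
        using second_difference_estimate[OF U G H _ _ eps, of ?e ?f] by (auto simp: norm_axis_1)
      obtain d2 where d2: "d2 > 0" "\<And>t. 0 < t \<and> t < d2 \<Longrightarrow>
        \<bar>u (x + t *\<^sub>R ?f + t *\<^sub>R ?e) - u (x + t *\<^sub>R ?f) - u (x + t *\<^sub>R ?e) + u x - t\<^sup>2 * (?f \<bullet> (H *v ?e))\<bar> \<le> 3 * \<epsilon> * t\<^sup>2"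
        using second_difference_estimate[OF U G H _ _ eps, of ?f ?e] by (auto simp: norm_axis_1)
      define t where "t = min d1 d2 / 2"
      have t: "0 < t" "t < d1" "t < d2" using d1 d2 by (auto simp: t_def)
      have c: "x + t *\<^sub>R ?f + t *\<^sub>R ?e = x + t *\<^sub>R ?e + t *\<^sub>R ?f" by simp
      have "\<bar>t\<^sup>2 * (?e \<bullet> (H *v ?f)) - t\<^sup>2 * (?f \<bullet> (H *v ?e))\<bar> \<le> 6 * \<epsilon> * t\<^sup>2"
        using d1(2)[of t] d2(2)[of t] t unfolding c by linarith
      then have "t\<^sup>2 * \<bar>(?e \<bullet> (H *v ?f)) - (?f \<bullet> (H *v ?e))\<bar> \<le> t\<^sup>2 * (6 * \<epsilon>)"
        unfolding right_diff_distrib[symmetric] abs_mult by (simp add: mult.commute)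
      then have "\<bar>(?e \<bullet> (H *v ?f)) - (?f \<bullet> (H *v ?e))\<bar> \<le> 6 * \<epsilon>"
        using t by (subst (asm) mult_le_cancel_left_pos) auto
      moreover have "?e \<bullet> (H *v ?f) = H $ i $ j" "?f \<bullet> (H *v ?e) = H $ j $ i"
        by (simp_all add: inner_axis' matrix_vector_mul_component inner_axis)
      ultimately show ?thesis by simp
    qed
    from this[of "\<bar>H $ i $ j - H $ j $ i\<bar> / 12"] show ?thesis by (cases "H $ i $ j = H $ j $ i") auto
  qed
  then show ?thesis by (simp add: vec_eq_iff transpose_def)
qed

lemma local_max_second_order:
  fixes w :: "real^'n \<Rightarrow> real"
  assumes U: "open U" "x \<in> U" and G: "\<And>y. y \<in> U \<Longrightarrow> (w has_derivative (\<lambda>h. G y \<bullet> h)) (at y)"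
    and H: "(G has_derivative (\<lambda>h. H *v h)) (at x)" and max: "\<And>y. y \<in> U \<Longrightarrow> w y \<le> w x"
  shows "G x = 0" and "\<xi> \<bullet> (H *v \<xi>) \<le> 0"
proof -
  obtain r where r: "r > 0" "ball x r \<subseteq> U" using U openE by blast
  have "(\<lambda>h. G x \<bullet> h) = (\<lambda>h. 0)"
    using differential_zero_maxmin[OF U(2,1) G[OF U(2)]] max by blast
  then show G0: "G x = 0" by (metis inner_eq_zero_iff)
  show "\<xi> \<bullet> (H *v \<xi>) \<le> 0"
  proof (cases "\<xi> = 0")
    case False
    show ?thesis
    proof (rule ccontr)
      assume "\<not> ?thesis"
      then have pos: "\<xi> \<bullet> (H *v \<xi>) > 0" by simp
      let ?g = "\<lambda>t. G (x + t *\<^sub>R \<xi>) \<bullet> \<xi>"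
      have "((\<lambda>t. x + t *\<^sub>R \<xi>) has_derivative (\<lambda>h. h *\<^sub>R \<xi>)) (at 0)"
        by (auto intro!: derivative_eq_intros)
      from has_derivative_compose[OF this, of G "(*v) H"] H
      have "((\<lambda>t. G (x + t *\<^sub>R \<xi>)) has_derivative (\<lambda>h. H *v (h *\<^sub>R \<xi>))) (at 0)" by simp
      then have "(?g has_derivative (\<lambda>h. (H *v (h *\<^sub>R \<xi>)) \<bullet> \<xi>)) (at 0)"
        by (rule has_derivative_inner_left)
      then have "(?g has_real_derivative (\<xi> \<bullet> (H *v \<xi>))) (at 0)"
        by (simp add: has_field_derivative_def matrix_vector_mult_scaleR inner_commute mult_commute_abs)
      then obtain d where d: "d > 0" "\<And>h. 0 < h \<Longrightarrow> h < d \<Longrightarrow> ?g 0 < ?g (0 + h)"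
        using DERIV_pos_inc_right[OF _ pos] by blast
      define t where "t = min d (r / norm \<xi>) / 2"
      have t: "t > 0" "t < d" "t * norm \<xi> < r" using d(1) r(1) False by (auto simp: t_def min_def field_simps)
      have inU: "x + s *\<^sub>R \<xi> \<in> U" if "0 \<le> s" "s \<le> t" for s
      proof -
        have "s * norm \<xi> < r" using that t mult_right_mono[of s t "norm \<xi>"] by auto
        then show ?thesis using r(2) that by (auto simp: subset_eq dist_norm)
      qed
      have "\<exists>s. 0 < s \<and> s < t \<and> w (x + t *\<^sub>R \<xi>) - w (x + 0 *\<^sub>R \<xi>) = (t - 0) * ?g s"
        by (rule MVT2) (use t inU G in \<open>auto intro!: DERIV_along_line\<close>)
      then obtain s where s: "0 < s" "s < t" "w (x + t *\<^sub>R \<xi>) - w x = t * ?g s" by auto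
      then have "?g s > 0" using d(2)[of s] t G0 by simp
      then have "t * ?g s > 0" using t(1) by (intro mult_pos_pos)
      then have "w (x + t *\<^sub>R \<xi>) > w x" using s(3) by linarith
      then show False using max[OF inU[of t]] t by simp
    qed
  qed simp
qed

text \<open>The derivative of \<open>y \<mapsto> |y|^(p-2) y\<close> at \<open>y \<noteq> 0\<close>.\<close>

definition p_map_deriv :: "real \<Rightarrow> real^'n \<Rightarrow> real^'n^'n" where
  "p_map_deriv p y = (norm y powr (p - 2)) *\<^sub>R (mat 1 + ((p - 2) / (norm y)\<^sup>2) *\<^sub>R outer y y)"

lemma outer_mult_vec: "outer a b *v x = (b \<bullet> x) *\<^sub>R a"
  by (simp add: vec_eq_iff outer_def matrix_vector_mult_def inner_vec_def sum_distrib_left mult_ac)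

lemma has_derivative_norm_at:
  fixes y :: "real^'n"
  assumes "y \<noteq> 0"
  shows "(norm has_derivative (\<lambda>h. (y \<bullet> h) / norm y)) (at y)"
  using has_derivative_norm[OF assms] by (simp add: sgn_div_norm inner_commute divide_inverse mult.commute)

lemma has_derivative_p_map:
  fixes y :: "real^'n"
  assumes y: "y \<noteq> 0"
  shows "((\<lambda>y. (norm y powr (p - 2)) *\<^sub>R y) has_derivative (\<lambda>h. p_map_deriv p y *v h)) (at y)"
proof -
  have ny: "norm y > 0" using y by simp
  have "((\<lambda>r. r powr (p - 2)) has_real_derivative ((p - 2) * norm y powr (p - 2 - 1))) (at (norm y))"
    by (rule has_real_derivative_powr[OF ny])
  from has_derivative_compose[OF has_derivative_norm_at[OF y] this[unfolded has_field_derivative_def]]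
  have "((\<lambda>y. norm y powr (p - 2)) has_derivative (\<lambda>h. (p - 2) * norm y powr (p - 2 - 1) * ((y \<bullet> h) / norm y))) (at y)" .
  from has_derivative_scaleR[OF this has_derivative_ident]
  have "((\<lambda>y. (norm y powr (p - 2)) *\<^sub>R y) has_derivative
     (\<lambda>h. norm y powr (p - 2) *\<^sub>R h + ((p - 2) * norm y powr (p - 2 - 1) * ((y \<bullet> h) / norm y)) *\<^sub>R y)) (at y)" .
  moreover have "norm y powr (p - 2 - 1) = norm y powr (p - 2) / norm y"
    using powr_diff[of "norm y" "p - 2" 1] unfolding powr_one[OF less_imp_le[OF ny]] .
  ultimately show ?thesis
    by (simp add: p_map_deriv_def matrix_vector_mult_add_rdistrib outer_mult_vec scaleR_add_right power2_eq_square mult_ac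
        scaleR_matrix_vector_assoc[symmetric])
qed

text \<open>The positive square root of \<open>p_map_deriv p y\<close>: on the line of \<open>y\<close> it multiplies by
  \<open>|y|^((p-2)/2)\<close> times \<open>sqrt (p - 1)\<close>, and on the orthogonal complement by \<open>|y|^((p-2)/2)\<close>.\<close>

definition p_map_root :: "real \<Rightarrow> real^'n \<Rightarrow> real^'n^'n" where
  "p_map_root p y = (norm y powr ((p - 2) / 2)) *\<^sub>R (mat 1 + ((sqrt (p - 1) - 1) / (norm y)\<^sup>2) *\<^sub>R outer y y)"

lemma rank_one_mult:
  fixes y :: "real^'n"
  assumes "y \<noteq> 0"
  shows "(a *\<^sub>R (mat 1 + (c / (norm y)\<^sup>2) *\<^sub>R outer y y)) ** (b *\<^sub>R (mat 1 + (d / (norm y)\<^sup>2) *\<^sub>R outer y y))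
    = (a * b) *\<^sub>R (mat 1 + ((c + d + c * d) / (norm y)\<^sup>2) *\<^sub>R outer y y)"
proof (rule matrix_eq[THEN iffD2], rule allI)
  fix x
  have n: "y \<bullet> y = (norm y)\<^sup>2" "(norm y)\<^sup>2 \<noteq> 0" using assms by (auto simp: power2_norm_eq_inner)
  have app: "(a *\<^sub>R (mat 1 + (c / (norm y)\<^sup>2) *\<^sub>R outer y y)) *v x = a *\<^sub>R (x + (c / (norm y)\<^sup>2 * (y \<bullet> x)) *\<^sub>R y)" for a c x
    by (simp add: matrix_vector_mult_add_rdistrib outer_mult_vec scaleR_matrix_vector_assoc[symmetric])
  show "((a *\<^sub>R (mat 1 + (c / (norm y)\<^sup>2) *\<^sub>R outer y y)) ** (b *\<^sub>R (mat 1 + (d / (norm y)\<^sup>2) *\<^sub>R outer y y))) *v x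
    = ((a * b) *\<^sub>R (mat 1 + ((c + d + c * d) / (norm y)\<^sup>2) *\<^sub>R outer y y)) *v x"
    unfolding matrix_vector_mul_assoc[symmetric] app
  proof -
    have yX: "y \<bullet> (b *\<^sub>R (x + (d / (norm y)\<^sup>2 * (y \<bullet> x)) *\<^sub>R y)) = b * ((y \<bullet> x) + d * (y \<bullet> x))"
      using n(2) by (simp add: inner_add_right n(1))
    show "a *\<^sub>R (b *\<^sub>R (x + (d / (norm y)\<^sup>2 * (y \<bullet> x)) *\<^sub>R y) +
        (c / (norm y)\<^sup>2 * (y \<bullet> (b *\<^sub>R (x + (d / (norm y)\<^sup>2 * (y \<bullet> x)) *\<^sub>R y)))) *\<^sub>R y)
      = (a * b) *\<^sub>R (x + ((c + d + c * d) / (norm y)\<^sup>2 * (y \<bullet> x)) *\<^sub>R y)"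
      unfolding yX using n(2) by (simp add: vec_eq_iff algebra_simps add_divide_distrib)
  qed
qed

lemma p_map_root_square:
  assumes "y \<noteq> 0" "p > 1"
  shows "p_map_root p y ** p_map_root p y = p_map_deriv p y"
proof -
  have "sqrt (p - 1) * sqrt (p - 1) = p - 1" using assms by simp
  then have "sqrt (p - 1) - 1 + (sqrt (p - 1) - 1) + (sqrt (p - 1) - 1) * (sqrt (p - 1) - 1) = p - 2"
    by (simp add: algebra_simps)
  then show ?thesis unfolding p_map_root_def p_map_deriv_def rank_one_mult[OF assms(1)]
    by (simp flip: powr_add)
qed

lemma p_map_root_invertible:
  fixes y :: "real^'n"
  assumes "y \<noteq> 0" "p > 1"
  shows "\<exists>R'. p_map_root p y ** R' = mat 1"
proof -
  let ?s = "sqrt (p - 1)"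
  have s: "?s > 0" using assms by simp
  have "?s - 1 + (1 / ?s - 1) + (?s - 1) * (1 / ?s - 1) = 0" using s by (simp add: field_simps)
  moreover have "norm y powr ((p - 2) / 2) * norm y powr (- ((p - 2) / 2)) = 1"
    using assms by (simp flip: powr_add)
  ultimately have "p_map_root p y ** ((norm y powr (- ((p - 2) / 2))) *\<^sub>R (mat 1 + ((1 / ?s - 1) / (norm y)\<^sup>2) *\<^sub>R outer y y)) = mat 1"
    unfolding p_map_root_def rank_one_mult[OF assms(1)] by simp
  then show ?thesis by blast
qed

lemma p_map_root_symmetric: "transpose (p_map_root p y) = p_map_root p y"
  by (simp add: p_map_root_def vec_eq_iff transpose_def outer_def mat_def mult.commute)

text \<open>With \<open>A = R R\<close> the derivative of \<open>y \<mapsto> |y|^(p-2) y\<close> at the common gradient, the two Jacobians are \<open>A Hu\<close> and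
  \<open>A Hv\<close>. They are not symmetric but have the eigenvalues of \<open>R Hu R\<close> and \<open>R Hv R\<close>, which are
  symmetric and inherit the order \<open>Hu \<le> Hv\<close> of the Hessians.\<close>

lemma elem_sym_p_field_comparison:
  fixes u v :: "real^'n \<Rightarrow> real"
  assumes U: "open U" "x \<in> U" and Gu: "\<And>y. y \<in> U \<Longrightarrow> (u has_derivative (\<lambda>h. Gu y \<bullet> h)) (at y)"
    and Hu: "(Gu has_derivative (\<lambda>h. Hu *v h)) (at x)"
    and Gv: "\<And>y. y \<in> U \<Longrightarrow> (v has_derivative (\<lambda>h. Gv y \<bullet> h)) (at y)"
    and Hv: "(Gv has_derivative (\<lambda>h. Hv *v h)) (at x)"
    and max: "\<And>y. y \<in> U \<Longrightarrow> u y - v y \<le> u x - v x"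
    and nz: "Gv x \<noteq> 0" and p: "p > 1" and k: "k \<le> CARD('n)" "j \<le> k"
    and l: "has_eigenvalues (jacobian (p_field p u) (at x)) l" "l \<in> Gamma_cone k"
    and l': "has_eigenvalues (jacobian (p_field p v) (at x)) l'"
  shows "Gu x = Gv x" and "elem_sym j l \<le> elem_sym j l'"
proof -
  have w: "((\<lambda>y. u y - v y) has_derivative (\<lambda>h. (Gu y - Gv y) \<bullet> h)) (at y)" if "y \<in> U" for y
    using has_derivative_diff[OF Gu[OF that] Gv[OF that]] by (simp add: inner_diff_left)
  have H: "((\<lambda>y. Gu y - Gv y) has_derivative (\<lambda>h. (Hu - Hv) *v h)) (at x)"
    using has_derivative_diff[OF Hu Hv] by (simp add: matrix_vector_mult_diff_rdistrib)
  show eq: "Gu x = Gv x" using local_max_second_order(1)[OF U w H] max by simp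
  have le: "\<xi> \<bullet> (Hu *v \<xi>) \<le> \<xi> \<bullet> (Hv *v \<xi>)" for \<xi>
    using local_max_second_order(2)[OF U w H, of \<xi>] max
    by (simp add: matrix_vector_mult_diff_rdistrib inner_diff_right)
  define y where "y = Gv x"
  define R where "R = p_map_root p y"
  have y: "y \<noteq> 0" using nz by (simp add: y_def)
  have jac: "jacobian (p_field p z) (at x) = R ** (R ** H)"
    if "\<And>y. y \<in> U \<Longrightarrow> (z has_derivative (\<lambda>h. G y \<bullet> h)) (at y)" "(G has_derivative (\<lambda>h. H *v h)) (at x)" "G x = y" for z G H
  proof -
    have "((\<lambda>a. (norm (G a) powr (p - 2)) *\<^sub>R G a) has_derivative (\<lambda>h. p_map_deriv p y *v (H *v h))) (at x)"
      using has_derivative_compose[OF that(2) has_derivative_p_map[of "G x" p]] y that(3) by simp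
    then have "(p_field p z has_derivative (\<lambda>h. p_map_deriv p y *v (H *v h))) (at x)"
      by (rule has_derivative_transform_within_open[OF _ U]) (simp add: p_field_def grad_eqI[OF that(1)])
    then have "(p_field p z has_derivative (\<lambda>h. (R ** (R ** H)) *v h)) (at x)"
      by (simp add: matrix_vector_mul_assoc R_def matrix_mul_assoc p_map_root_square[OF y p])
    then have "frechet_derivative (p_field p z) (at x) = (\<lambda>h. (R ** (R ** H)) *v h)"
      using frechet_derivative_at by metis
    then show ?thesis by (simp add: jacobian_def)
  qed
  obtain R' where R': "R ** R' = mat 1" using p_map_root_invertible[OF y p] unfolding R_def by blast
  have symR: "transpose R = R" unfolding R_def by (rule p_map_root_symmetric)
  have "jacobian (p_field p u) (at x) = R ** (R ** Hu)"
    by (rule jac[OF _ Hu]) (use Gu eq in \<open>auto simp: y_def\<close>)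
  then have ju: "has_eigenvalues (R ** Hu ** R) l"
    using l(1) has_eigenvalues_similar[OF R'] by simp
  have "jacobian (p_field p v) (at x) = R ** (R ** Hv)"
    by (rule jac[OF _ Hv]) (use Gv in \<open>auto simp: y_def\<close>)
  then have jv: "has_eigenvalues (R ** Hv ** R) l'"
    using l' has_eigenvalues_similar[OF R'] by simp
  have symHu: "transpose Hu = Hu" by (rule hessian_symmetric[OF U _ Hu]) (rule Gu)
  have symHv: "transpose Hv = Hv" by (rule hessian_symmetric[OF U _ Hv]) (rule Gv)
  have sym: "transpose (R ** H ** R) = R ** H ** R" if "transpose H = H" for H
    using that symR by (simp add: matrix_transpose_mul matrix_mul_assoc)
  have quad: "a \<bullet> ((R ** H ** R) *v a) = (R *v a) \<bullet> (H *v (R *v a))" for H a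
    using symR by (metis dot_lmul_matrix matrix_vector_mul_assoc transpose_matrix_vector)
  show "elem_sym j l \<le> elem_sym j l'"
    by (rule elem_sym_eigenvalues_mono[OF sym[OF symHu] sym[OF symHv] _ ju l(2) jv k])
      (simp only: quad le)
qed


section \<open>Radial functions\<close>

text \<open>For a symmetric matrix the characteristic polynomial is known to split, so that an identity of polynomials can be
  checked up to finitely many arguments.\<close>

lemma has_eigenvalues_if_cofinitely:
  fixes M :: "real^'n^'n"
  assumes sym: "transpose M = M" and S: "finite S"
    and eq: "\<And>t. t \<notin> S \<Longrightarrow> det (mat t - M) = (\<Prod>i\<in>UNIV. t - l $ i)"
  shows "has_eigenvalues M l"
proof -
  obtain l' where l': "has_eigenvalues M l'" using symmetric_has_eigenvalues[OF sym] by blast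
  define D where "D = (\<Prod>i\<in>UNIV. [:- l' $ i, 1:]) - (\<Prod>i\<in>UNIV. [:- l $ i, 1:])"
  have "D = 0"
  proof (rule ccontr)
    assume "D \<noteq> 0"
    then have "finite {t. poly D t = 0}" by (rule poly_roots_finite)
    moreover have "UNIV - S \<subseteq> {t. poly D t = 0}"
      using l' eq unfolding has_eigenvalues_def D_def by (auto simp: poly_prod)
    ultimately have "finite (UNIV - S)" by (rule finite_subset[rotated])
    then show False using S infinite_UNIV_char_0[where 'a = real] by simp
  qed
  then have "poly D t = 0" for t by simp
  then show ?thesis using l' unfolding has_eigenvalues_def D_def by (simp add: poly_prod)
qed

text \<open>The eigenvalues of a radial Jacobian: \<open>m\<close> once, for the radial direction, and \<open>a\<close> for all tangential
  directions. The index \<open>i0\<close> that carries \<open>m\<close> is arbitrary.\<close>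

definition spike :: "'n \<Rightarrow> real \<Rightarrow> real \<Rightarrow> real^'n" where
  "spike i0 m a = (\<chi> i. if i = i0 then m else a)"

text \<open>Eigenvalue \<open>m\<close> on the line of \<open>x\<close> and \<open>a\<close> on its orthogonal complement.\<close>

definition radial_jac :: "real \<Rightarrow> real \<Rightarrow> real^'n \<Rightarrow> real^'n^'n" where
  "radial_jac m a x = a *\<^sub>R mat 1 + ((m - a) / (norm x)\<^sup>2) *\<^sub>R outer x x"

lemma radial_jac_eigenvalues:
  fixes x :: "real^'n"
  assumes x: "x \<noteq> 0"
  shows "has_eigenvalues (radial_jac m a x) (spike i0 m a)"
proof (rule has_eigenvalues_if_cofinitely[of _ "{a}"])
  show "transpose (radial_jac m a x) = radial_jac m a x"
    by (simp add: radial_jac_def vec_eq_iff transpose_def outer_def mat_def mult.commute)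
  fix t assume "t \<notin> {a}"
  then have ta: "t - a \<noteq> 0" by simp
  let ?c = "(m - a) / (norm x)\<^sup>2"
  have n: "CARD('n) = Suc (CARD('n) - 1)" by simp
  have pw: "(t - a) ^ CARD('n) = (t - a) * (t - a) ^ (CARD('n) - 1)"
    using power_Suc n by metis
  have eq: "mat t - radial_jac m a x = diag (\<lambda>i. t - a) - outer (?c *\<^sub>R x) x"
    by (simp add: radial_jac_def vec_eq_iff mat_def diag_def outer_def)
  have xx: "(\<Sum>i\<in>UNIV. x $ i * x $ i) = (norm x)\<^sup>2"
    by (simp add: power2_norm_eq_inner inner_vec_def)
  have "(\<Sum>i\<in>UNIV. (?c *\<^sub>R x) $ i * x $ i * (\<Prod>j\<in>UNIV - {i}. t - a))
      = ?c * (\<Sum>i\<in>UNIV. x $ i * x $ i) * (t - a) ^ (CARD('n) - 1)"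
    by (simp add: card_Diff_singleton sum_distrib_left sum_distrib_right sum_divide_distrib mult_ac)
  also have "\<dots> = (m - a) * (t - a) ^ (CARD('n) - 1)" unfolding xx using x by simp
  finally have "det (mat t - radial_jac m a x) = (t - a) ^ CARD('n) - (m - a) * (t - a) ^ (CARD('n) - 1)"
    unfolding eq by (subst det_diag_minus_outer) (use ta in auto)
  also have "\<dots> = (t - m) * (t - a) ^ (CARD('n) - 1)"
    unfolding pw by (simp only: left_diff_distrib[symmetric]) simp
  also have "\<dots> = (\<Prod>i\<in>UNIV. t - spike i0 m a $ i)"
    by (subst prod.remove[of _ i0]) (auto simp: spike_def card_Diff_singleton)
  finally show "det (mat t - radial_jac m a x) = (\<Prod>i\<in>UNIV. t - spike i0 m a $ i)" .
qed simp

lemma elem_sym_1_sum: "elem_sym 1 (l :: real^'n) = (\<Sum>i\<in>UNIV. l $ i)"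
proof -
  have "{I. I \<subseteq> (UNIV::'n set) \<and> card I = 1} = range (\<lambda>i. {i})"
    by (auto simp: card_1_singleton_iff)
  then show ?thesis unfolding elem_sym_def by (simp add: sum.reindex)
qed

lemma elem_sym_1_spike: "elem_sym 1 (spike i0 m a :: real^'n) = m + (real CARD('n) - 1) * a"
  unfolding elem_sym_1_sum
  by (subst sum.remove[of _ i0]) (auto simp: spike_def card_Diff_singleton of_nat_diff)

lemma prod_spike:
  fixes I :: "'n::finite set"
  assumes "card I = k"
  shows "(\<Prod>i\<in>I. spike i0 m a $ i) = (if i0 \<in> I then m * a ^ (k - 1) else a ^ k)"
proof (cases "i0 \<in> I")
  case True
  then show ?thesis using assms
    by (subst prod.remove[of _ i0]) (auto simp: spike_def card_Diff_singleton)
next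
  case False
  then have "(\<Prod>i\<in>I. spike i0 m a $ i) = (\<Prod>i\<in>I. a)"
    by (intro prod.cong) (auto simp: spike_def)
  then show ?thesis using assms False by simp
qed

lemma elem_sym_spike_lower:
  assumes "m > 0" "a > 0" "1 \<le> k" "k \<le> CARD('n)"
  shows "elem_sym k (spike i0 m a :: real^'n) \<ge> m * a ^ (k - 1)"
proof -
  have "k - 1 \<le> card (UNIV - {i0})" using assms(4) by (simp add: card_Diff_singleton)
  then obtain J where J: "J \<subseteq> UNIV - {i0}" "card J = k - 1"
    by (rule obtain_subset_with_card_n)
  then have I: "card (insert i0 J) = k" using assms(3) finite_subset by (subst card_insert_disjoint) auto
  have "m * a ^ (k - 1) = (\<Prod>i\<in>insert i0 J. spike i0 m a $ i)" using prod_spike[OF I] by simp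
  also have "\<dots> \<le> elem_sym k (spike i0 m a :: real^'n)"
  proof -
    have "0 \<le> (\<Prod>i\<in>K. spike i0 m a $ i)" for K :: "'n set"
      using assms by (intro prod_nonneg) (auto simp: spike_def)
    then show ?thesis unfolding elem_sym_def using I
      by (intro member_le_sum[of _ _ "\<lambda>I. \<Prod>i\<in>I. spike i0 m a $ i"]) auto
  qed
  finally show ?thesis .
qed

lemma spike_in_Gamma_cone:
  assumes "m > 0" "a > 0" "k \<le> CARD('n)"
  shows "(spike i0 m a :: real^'n) \<in> Gamma_cone k"
  unfolding Gamma_cone_def
proof safe
  fix j assume "j \<in> {1..k}"
  then have "m * a ^ (j - 1) \<le> elem_sym j (spike i0 m a :: real^'n)"
    using assms by (intro elem_sym_spike_lower) auto
  moreover have "m * a ^ (j - 1) > 0" using assms by simp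
  ultimately show "elem_sym j (spike i0 m a :: real^'n) > 0" by linarith
qed

text \<open>There are at most \<open>2^n\<close> index sets, and each contributes one of two products. This crude constant is good
  enough because the supersolution leaves an arbitrarily small factor to spare.\<close>

lemma elem_sym_spike_upper:
  assumes "m \<ge> 0" "a \<ge> 0"
  shows "elem_sym k (spike i0 m a :: real^'n) \<le> 2 ^ CARD('n) * (m * a ^ (k - 1) + a ^ k)"
proof -
  have "elem_sym k (spike i0 m a :: real^'n) \<le> (\<Sum>I | I \<subseteq> (UNIV::'n set) \<and> card I = k. m * a ^ (k - 1) + a ^ k)"
    unfolding elem_sym_def using assms by (intro sum_mono) (auto simp: prod_spike)
  also have "\<dots> = real (card {I. I \<subseteq> (UNIV::'n set) \<and> card I = k}) * (m * a ^ (k - 1) + a ^ k)" by simp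
  also have "\<dots> \<le> real (2 ^ CARD('n)) * (m * a ^ (k - 1) + a ^ k)"
  proof (intro mult_right_mono)
    have "card {I. I \<subseteq> (UNIV::'n set) \<and> card I = k} \<le> card (Pow (UNIV :: 'n set))"
      by (intro card_mono) auto
    then show "real (card {I. I \<subseteq> (UNIV::'n set) \<and> card I = k}) \<le> real (2 ^ CARD('n))"
      by (simp only: card_Pow finite of_nat_le_iff)
  qed (use assms in auto)
  finally show ?thesis by simp
qed

lemma has_derivative_radial:
  fixes x :: "real^'n"
  assumes x: "x \<noteq> 0" and d: "(\<phi> has_real_derivative \<phi>') (at (norm x))"
  shows "((\<lambda>x. \<phi> (norm x)) has_derivative (\<lambda>h. ((\<phi>' / norm x) *\<^sub>R x) \<bullet> h)) (at x)"
  using has_derivative_compose[OF has_derivative_norm_at[OF x] d[unfolded has_field_derivative_def]]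
  by simp

lemma has_derivative_radial_field:
  fixes x :: "real^'n"
  assumes x: "x \<noteq> 0" and d: "(g has_real_derivative g') (at (norm x))"
  shows "((\<lambda>x. (g (norm x) / norm x) *\<^sub>R x) has_derivative (\<lambda>h. radial_jac g' (g (norm x) / norm x) x *v h)) (at x)"
proof -
  have nx: "norm x > 0" using x by simp
  have "((\<lambda>r. g r / r) has_real_derivative ((g' - g (norm x) / norm x) / norm x)) (at (norm x))"
    using nx by (auto intro!: derivative_eq_intros d simp: field_simps power2_eq_square)
  from has_derivative_scaleR[OF has_derivative_radial[OF x this] has_derivative_ident]
  have "((\<lambda>x. (g (norm x) / norm x) *\<^sub>R x) has_derivative
    (\<lambda>h. (g (norm x) / norm x) *\<^sub>R h + (((g' - g (norm x) / norm x) / norm x / norm x) *\<^sub>R x \<bullet> h) *\<^sub>R x)) (at x)" .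
  then show ?thesis
    by (simp add: radial_jac_def matrix_vector_mult_add_rdistrib outer_mult_vec scaleR_matrix_vector_assoc[symmetric]
        power2_eq_square)
qed

lemma radial_p_field:
  fixes x :: "real^'n"
  assumes U: "open U" "x \<in> U" "0 \<notin> U"
    and \<phi>: "\<And>y. y \<in> U \<Longrightarrow> (\<phi> has_real_derivative \<phi>1 (norm y)) (at (norm y))"
    and g: "((\<lambda>r. \<bar>\<phi>1 r\<bar> powr (p - 2) * \<phi>1 r) has_real_derivative g') (at (norm x))"
  shows "(p_field p (\<lambda>x. \<phi> (norm x)) has_derivative
      (\<lambda>h. radial_jac g' (\<bar>\<phi>1 (norm x)\<bar> powr (p - 2) * \<phi>1 (norm x) / norm x) x *v h)) (at x)" (is ?A)
    and "has_eigenvalues (jacobian (p_field p (\<lambda>x. \<phi> (norm x))) (at x))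
      (spike i0 g' (\<bar>\<phi>1 (norm x)\<bar> powr (p - 2) * \<phi>1 (norm x) / norm x))" (is ?B)
proof -
  have x: "x \<noteq> 0" using U by auto
  show A: ?A
  proof (rule has_derivative_transform_within_open[OF has_derivative_radial_field[OF x g] U(1,2)])
    fix y assume y: "y \<in> U"
    then have y0: "y \<noteq> 0" using U by auto
    have "grad (\<lambda>x. \<phi> (norm x)) y = (\<phi>1 (norm y) / norm y) *\<^sub>R y"
      by (rule grad_eqI[OF has_derivative_radial[OF y0 \<phi>[OF y]]])
    then show "(\<bar>\<phi>1 (norm y)\<bar> powr (p - 2) * \<phi>1 (norm y) / norm y) *\<^sub>R y = p_field p (\<lambda>x. \<phi> (norm x)) y"
      using y0 by (simp add: p_field_def)
  qed
  let ?J = "radial_jac g' (\<bar>\<phi>1 (norm x)\<bar> powr (p - 2) * \<phi>1 (norm x) / norm x) x"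
  have "frechet_derivative (p_field p (\<lambda>x. \<phi> (norm x))) (at x) = (\<lambda>h. ?J *v h)"
    using frechet_derivative_at[OF A] by simp
  then have "jacobian (p_field p (\<lambda>x. \<phi> (norm x))) (at x) = ?J" by (simp add: jacobian_def)
  then show ?B using radial_jac_eigenvalues[OF x] by simp
qed

text \<open>Comparison with a radial function, whose Jacobian is known explicitly. It is used with the blow-up profile for
  \<open>j = k\<close> and with \<open>- \<epsilon> |x|\<close> for \<open>j = 1\<close>.\<close>

lemma radial_comparison:
  fixes u :: "real^'n \<Rightarrow> real"
  assumes U: "open U" "x \<in> U" "0 \<notin> U" and C2: "Ck_on 2 (UNIV - {0}) u"
    and \<phi>: "\<And>y. y \<in> U \<Longrightarrow> (\<phi> has_real_derivative \<phi>1 (norm y)) (at (norm y))"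
    and \<phi>2: "(\<phi>1 has_real_derivative \<phi>2) (at (norm x))"
    and g: "((\<lambda>r. \<bar>\<phi>1 r\<bar> powr (p - 2) * \<phi>1 r) has_real_derivative g') (at (norm x))"
    and max: "\<And>y. y \<in> U \<Longrightarrow> u y - \<phi> (norm y) \<le> u x - \<phi> (norm x)"
    and nz: "\<phi>1 (norm x) \<noteq> 0" and p: "p > 1" and k: "k \<le> CARD('n)" "j \<le> k"
    and l: "has_eigenvalues (jacobian (p_field p u) (at x)) l" "l \<in> Gamma_cone k"
  shows "grad u x = (\<phi>1 (norm x) / norm x) *\<^sub>R x"
    and "elem_sym j l \<le> elem_sym j (spike i0 g' (\<bar>\<phi>1 (norm x)\<bar> powr (p - 2) * \<phi>1 (norm x) / norm x) :: real^'n)"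
proof -
  have x: "x \<noteq> 0" using U by auto
  have Gu: "(u has_derivative (\<lambda>h. grad u y \<bullet> h)) (at y)" if "y \<in> U" for y
    using that C2 U(3) unfolding Ck_on_2_iff by (intro has_derivative_grad) auto
  have Hu: "(grad u has_derivative (\<lambda>h. jacobian (grad u) (at x) *v h)) (at x)"
    using C2 x unfolding Ck_on_2_iff jacobian_works[symmetric] by (intro grad_differentiable) auto
  have Gv: "((\<lambda>x. \<phi> (norm x)) has_derivative (\<lambda>h. ((\<phi>1 (norm y) / norm y) *\<^sub>R y) \<bullet> h)) (at y)" if "y \<in> U" for y
    using that U(3) by (intro has_derivative_radial \<phi>) auto
  note cmp = elem_sym_p_field_comparison[OF U(1,2) _ Hu _ has_derivative_radial_field[OF x \<phi>2] _ _ p k l radial_p_field(2)[OF U _ g]]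
  show "grad u x = (\<phi>1 (norm x) / norm x) *\<^sub>R x"
    by (rule cmp(1)) (use Gu Gv max nz x \<phi> in auto)
  show "elem_sym j l \<le> elem_sym j (spike i0 g' (\<bar>\<phi>1 (norm x)\<bar> powr (p - 2) * \<phi>1 (norm x) / norm x) :: real^'n)"
    by (rule cmp(2)) (use Gu Gv max nz x \<phi> in auto)
qed

section \<open>The maximum principle for admissible functions\<close>

text \<open>At a maximum the gradient vanishes, where the vector field is in general not a smooth function of it, so the
  comparison of Hessians is not available. The Jacobian of the vector
  field has real eigenvalues with a positive sum, hence an eigenvector \<open>\<xi>\<close> with a positive eigenvalue. Along \<open>\<xi>\<close> the field, and with
  it \<open>Du\<close>, points outwards, so \<open>u\<close> increases.\<close>

lemma admissible_no_max_off_origin: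
  fixes u :: "real^'n \<Rightarrow> real"
  assumes C1: "Ck_on 1 UNIV u" and adm: "admissible p k (UNIV - {0}) u" and k: "1 \<le> k" and x: "x \<noteq> 0"
  shows "\<exists>y. u y > u x"
proof (rule ccontr)
  assume "\<not> ?thesis"
  then have max: "u y \<le> u x" for y by (simp add: not_less)
  have G: "(u has_derivative (\<lambda>h. grad u y \<bullet> h)) (at y)" for y
    using C1 unfolding Ck_on_1_iff by (intro has_derivative_grad) auto
  have "(\<lambda>h. grad u x \<bullet> h) = (\<lambda>h. 0)"
    using differential_zero_maxmin[OF UNIV_I open_UNIV G] max by blast
  then have G0: "grad u x = 0" by (metis inner_eq_zero_iff)
  let ?J = "jacobian (p_field p u) (at x)"
  have J: "(p_field p u has_derivative (\<lambda>h. ?J *v h)) (at x)"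
    using adm x unfolding admissible_def jacobian_works[symmetric] by auto
  obtain l where l: "has_eigenvalues ?J l" "l \<in> Gamma_cone k" using adm x unfolding admissible_def by auto
  have "elem_sym 1 l > 0" using l(2) k unfolding Gamma_cone_def by auto
  then have "(\<Sum>i\<in>UNIV. l $ i) > 0" unfolding elem_sym_1_sum .
  then obtain i where i: "l $ i > 0" by (meson not_le sum_nonpos)
  let ?m = "l $ i"
  have "det (mat ?m - ?J) = 0" using l(1) unfolding has_eigenvalues_def by auto
  then have "\<not> invertible (mat ?m - ?J)" by (simp add: invertible_det_nz)
  then have "\<not> (\<exists>B. B ** (mat ?m - ?J) = mat 1)" by (simp add: invertible_left_inverse)
  then obtain \<xi> where \<xi>: "(mat ?m - ?J) *v \<xi> = 0" "\<xi> \<noteq> 0"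
    unfolding matrix_left_invertible_ker by blast
  have "mat ?m *v \<xi> = ?m *\<^sub>R \<xi>"
    by (simp add: vec_eq_iff matrix_vector_mult_def mat_def if_distrib[of "\<lambda>y. y * _"] cong: if_cong)
  then have J\<xi>: "?J *v \<xi> = ?m *\<^sub>R \<xi>" using \<xi>(1) by (simp add: matrix_vector_mult_diff_rdistrib)
  let ?g = "\<lambda>t. p_field p u (x + t *\<^sub>R \<xi>) \<bullet> \<xi>"
  have "((\<lambda>t. x + t *\<^sub>R \<xi>) has_derivative (\<lambda>h. h *\<^sub>R \<xi>)) (at 0)"
    by (auto intro!: derivative_eq_intros)
  from has_derivative_compose[OF this, of "p_field p u" "(*v) ?J"] J
  have "((\<lambda>t. p_field p u (x + t *\<^sub>R \<xi>)) has_derivative (\<lambda>h. ?J *v (h *\<^sub>R \<xi>))) (at 0)" by simp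
  then have "(?g has_derivative (\<lambda>h. (?J *v (h *\<^sub>R \<xi>)) \<bullet> \<xi>)) (at 0)"
    by (rule has_derivative_inner_left)
  then have "(?g has_derivative (\<lambda>h. (?m * (\<xi> \<bullet> \<xi>)) * h)) (at 0)"
    by (simp add: matrix_vector_mult_scaleR J\<xi> mult_ac)
  then have "(?g has_real_derivative (?m * (\<xi> \<bullet> \<xi>))) (at 0)"
    unfolding has_field_derivative_def .
  moreover have "?m * (\<xi> \<bullet> \<xi>) > 0" using i \<xi>(2) by simp
  ultimately obtain d where d: "d > 0" "\<And>h. 0 < h \<Longrightarrow> h < d \<Longrightarrow> ?g 0 < ?g (0 + h)"
    using DERIV_pos_inc_right by blast
  define t where "t = d / 2"
  have t: "0 < t" "t < d" using d by (auto simp: t_def)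
  have "\<exists>s. 0 < s \<and> s < t \<and> u (x + t *\<^sub>R \<xi>) - u (x + 0 *\<^sub>R \<xi>) = (t - 0) * (grad u (x + s *\<^sub>R \<xi>) \<bullet> \<xi>)"
    by (rule MVT2) (use t G in \<open>auto intro!: DERIV_along_line\<close>)
  then obtain s where s: "0 < s" "s < t" "u (x + t *\<^sub>R \<xi>) - u x = t * (grad u (x + s *\<^sub>R \<xi>) \<bullet> \<xi>)" by auto
  have "?g s > 0" using d(2)[of s] s t G0 by (simp add: p_field_def)
  then have "grad u (x + s *\<^sub>R \<xi>) \<bullet> \<xi> > 0" by (simp add: p_field_def zero_less_mult_iff)
  then have "t * (grad u (x + s *\<^sub>R \<xi>) \<bullet> \<xi>) > 0" using t by simp
  then show False using s(3) max[of "x + t *\<^sub>R \<xi>"] by linarith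
qed

text \<open>If the origin were a maximum point, it would be a strict one. Then \<open>u + \<epsilon> |x|\<close> with small
  \<open>\<epsilon> > 0\<close> has a maximum over the unit ball that is neither at the origin, where \<open>Du = 0\<close> and the cone
  \<open>\<epsilon> |x|\<close> dominates, nor on the sphere. Comparison with \<open>- \<epsilon> |x|\<close> there bounds the trace of the Jacobian by that of
  \<open>- \<epsilon>^(p-1) x / |x|\<close>, which is not positive.\<close>

lemma admissible_no_max_at_origin:
  fixes u :: "real^'n \<Rightarrow> real"
  assumes C1: "Ck_on 1 UNIV u" and C2: "Ck_on 2 (UNIV - {0}) u" and adm: "admissible p k (UNIV - {0}) u"
    and k: "1 \<le> k" "k \<le> CARD('n)" and p: "p > 1"
  shows "\<exists>y. u y > u 0"
proof (rule ccontr)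
  assume "\<not> ?thesis"
  then have max: "u y \<le> u 0" for y by (simp add: not_less)
  have strict: "u y < u 0" if "y \<noteq> 0" for y
    using admissible_no_max_off_origin[OF C1 adm k(1) that] max[of y] max order_less_le_trans by (metis not_less)
  have G: "(u has_derivative (\<lambda>h. grad u y \<bullet> h)) (at y)" for y
    using C1 unfolding Ck_on_1_iff by (intro has_derivative_grad) auto
  then have cont: "continuous_on A u" for A
    by (meson continuous_at_imp_continuous_on has_derivative_continuous)
  have "(\<lambda>h. grad u 0 \<bullet> h) = (\<lambda>h. 0)"
    using differential_zero_maxmin[OF UNIV_I open_UNIV G] max by blast
  then have G0: "(u has_derivative (\<lambda>h. 0)) (at 0)" using G[of 0] by simp
  have e1: "axis undefined 1 \<in> sphere (0 :: real^'n) 1" by (simp add: norm_axis_1)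
  obtain z where z: "z \<in> sphere 0 1" "\<And>y. y \<in> sphere 0 1 \<Longrightarrow> u y \<le> u z"
    using continuous_attains_sup[OF compact_sphere _ cont, of 0 1] e1 by blast
  have uz: "u z < u 0" using z(1) by (intro strict) auto
  \<comment> \<open>on the sphere \<open>u + \<epsilon> |x|\<close> is at most \<open>u z + \<epsilon>\<close>, which has to stay below \<open>u 0\<close>\<close>
  define \<epsilon> where "\<epsilon> = (u 0 - u z) / 2"
  have \<epsilon>: "\<epsilon> > 0" using uz by (simp add: \<epsilon>_def)
  let ?w = "\<lambda>x. u x - (- \<epsilon> * norm x)"
  obtain x where x: "x \<in> cball 0 1" "\<And>y. y \<in> cball 0 1 \<Longrightarrow> ?w y \<le> ?w x"
  proof -
    have "continuous_on (cball 0 1) ?w" by (intro continuous_intros cont)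
    then show ?thesis using continuous_attains_sup[OF compact_cball, of 0 1 ?w] that by auto
  qed
  have "norm x \<noteq> 1"
  proof
    assume "norm x = 1"
    then have "?w x \<le> u z + \<epsilon>" using z(2)[of x] by simp
    also have "\<dots> < u 0" using uz by (simp add: \<epsilon>_def field_simps)
    also have "\<dots> = ?w 0" by simp
    finally show False using x(2)[of 0] by simp
  qed
  moreover have "x \<noteq> 0"
  proof
    assume x0: "x = 0"
    obtain d where d: "d > 0" "\<And>y. norm (y - 0) < d \<Longrightarrow> norm (u y - u 0 - 0) \<le> (\<epsilon> / 2) * norm (y - 0)"
      using G0 \<epsilon> unfolding has_derivative_at_alt by (metis half_gt_zero)
    define y :: "real^'n" where "y = (min d 1 / 2) *\<^sub>R axis undefined 1"
    have ny: "norm y = min d 1 / 2" using d(1) by (simp add: y_def norm_axis_1)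
    then have "norm (y - 0) < d" "norm y \<le> 1" "norm y > 0" using d(1) by auto
    then have "\<bar>u y - u 0\<bar> \<le> (\<epsilon> / 2) * norm y" using d(2)[of y] by (simp only: real_norm_def diff_zero)
    then have "u y - u 0 \<ge> - (\<epsilon> / 2) * norm y" by linarith
    moreover have "\<epsilon> / 2 * norm y < \<epsilon> * norm y" using \<epsilon> \<open>norm y > 0\<close> by simp
    ultimately have "?w y > ?w 0" by simp
    then show False using x(2)[of y] x0 \<open>norm y \<le> 1\<close> by simp
  qed
  ultimately have xU: "x \<in> ball 0 1 - {0}" using x(1) by auto
  obtain l where l: "has_eigenvalues (jacobian (p_field p u) (at x)) l" "l \<in> Gamma_cone k"
    using adm xU unfolding admissible_def by auto
  have "elem_sym 1 l \<le> elem_sym 1 (spike undefined 0 (\<bar>- \<epsilon>\<bar> powr (p - 2) * (- \<epsilon>) / norm x) :: real^'n)"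
  proof (rule radial_comparison(2)[where \<phi> = "\<lambda>r. - \<epsilon> * r" and U = "ball 0 1 - {0}" and ?\<phi>1.0 = "\<lambda>r. - \<epsilon>" and ?\<phi>2.0 = 0, OF _ xU _ C2 _ _ _ _ _ p k(2,1) l])
    show "open (ball (0::real^'n) 1 - {0})" by (intro open_delete open_ball)
    show "((\<lambda>r. - \<epsilon> * r) has_real_derivative - \<epsilon>) (at (norm y))" for y :: "real^'n"
      by (auto intro!: derivative_eq_intros)
    show "u y - - \<epsilon> * norm y \<le> u x - - \<epsilon> * norm x" if "y \<in> ball 0 1 - {0}" for y
      using x(2)[of y] that by auto
    show "- \<epsilon> \<noteq> 0" using \<epsilon> by simp
  qed auto
  also have "\<dots> \<le> 0"
  proof -
    have c: "real CARD('n) - 1 \<ge> 0" by (simp add: Suc_leI)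
    have "\<bar>- \<epsilon>\<bar> powr (p - 2) * (- \<epsilon>) / norm x \<le> 0"
      using \<epsilon> by (intro divide_nonpos_nonneg mult_nonneg_nonpos) auto
    from mult_nonneg_nonpos[OF c this] show ?thesis unfolding elem_sym_1_spike by (simp only: add_0)
  qed
  finally show False using l(2) k(1) unfolding Gamma_cone_def by force
qed

lemma admissible_sup_not_attained_in_ball:
  fixes u :: "real^'n \<Rightarrow> real"
  assumes C1: "Ck_on 1 UNIV u" and C2: "Ck_on 2 (UNIV - {0}) u" and adm: "admissible p k (UNIV - {0}) u"
    and k: "1 \<le> k" "k \<le> CARD('n)" and p: "p > 1" and \<rho>: "\<rho> \<ge> 0"
  shows "\<exists>y. \<forall>x\<in>cball 0 \<rho>. u x < u y"
proof -
  have "(u has_derivative (\<lambda>h. grad u y \<bullet> h)) (at y)" for y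
    using C1 unfolding Ck_on_1_iff by (intro has_derivative_grad) auto
  then have "continuous_on (cball 0 \<rho>) u"
    by (meson continuous_at_imp_continuous_on has_derivative_continuous)
  then obtain z where z: "z \<in> cball 0 \<rho>" "\<And>x. x \<in> cball 0 \<rho> \<Longrightarrow> u x \<le> u z"
    using continuous_attains_sup[OF compact_cball, of 0 \<rho> u] \<rho> by auto
  obtain y where "u y > u z"
    using admissible_no_max_at_origin[OF C1 C2 adm k p] admissible_no_max_off_origin[OF C1 adm k(1), of z]
    by (cases "z = 0") auto
  then show ?thesis using z(2) by (meson le_less_trans)
qed


section \<open>The integral condition and the autonomous equation\<close>

lemma antiderivative_exists:
  fixes h :: "real \<Rightarrow> real"
  assumes "continuous_on UNIV h"
  shows "\<exists>F. \<forall>t. (F has_real_derivative h t) (at t)"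
proof -
  have "\<exists>F. \<forall>x. -\<infinity> < ereal x \<longrightarrow> ereal x < \<infinity> \<longrightarrow> (F has_vector_derivative h x) (at x)"
    using assms by (intro einterval_antiderivative) (auto simp: continuous_on_eq_continuous_at)
  then show ?thesis by (simp add: has_real_derivative_iff_has_vector_derivative)
qed

lemma ennreal_finiteE:
  assumes "x < (\<infinity> :: ennreal)"
  obtains r where "x = ennreal r" "r \<ge> 0"
  using assms by (cases x) auto

text \<open>The role of \<open>w\<close> is played by \<open>f^k\<close> and that of \<open>a\<close> by \<open>k (p - 1 - \<beta>)\<close>.\<close>

locale growth =
  fixes w :: "real \<Rightarrow> real" and a :: real
  assumes w_cont: "continuous_on UNIV w" and w_mono: "mono w" and w_pos: "\<And>t. w t > 0" and a_pos: "a > 0"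
begin

definition "G t = integral {0..t} w"

lemma G_antiderivative:
  assumes A: "\<And>t. (A has_real_derivative w t) (at t)" and t: "0 \<le> t"
  shows "G t = A t - A 0"
proof -
  have "(w has_integral (A t - A 0)) {0..t}"
    using t A by (intro fundamental_theorem_of_calculus)
      (auto simp flip: has_real_derivative_iff_has_vector_derivative intro: has_field_derivative_at_within)
  then show ?thesis unfolding G_def by (rule integral_unique)
qed

lemma G_diff:
  assumes "0 \<le> s" "s \<le> t"
  shows "(t - s) * w s \<le> G t - G s" "G t - G s \<le> (t - s) * w t"
proof -
  obtain A where A: "\<And>t. (A has_real_derivative w t) (at t)" using antiderivative_exists[OF w_cont] by blast
  have eq: "G t - G s = A t - A s" using G_antiderivative[OF A] assms by simp
  have "(t - s) * w s \<le> A t - A s \<and> A t - A s \<le> (t - s) * w t"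
  proof (cases "s = t")
    case False
    then obtain z where z: "s < z" "z < t" "A t - A s = (t - s) * w z"
      using MVT2[of s t A w] A assms by auto
    then show ?thesis using w_mono assms by (auto intro!: mult_left_mono monoD[OF w_mono])
  qed simp
  then show "(t - s) * w s \<le> G t - G s" "G t - G s \<le> (t - s) * w t" unfolding eq by auto
qed

lemma G_0: "t \<le> 0 \<Longrightarrow> G t = 0"
  unfolding G_def by (cases "t = 0") auto

lemma G_mono: "mono G"
proof (rule monoI)
  fix s t :: real assume st: "s \<le> t"
  have *: "0 \<le> s \<Longrightarrow> s \<le> t \<Longrightarrow> G s \<le> G t" for s t
  proof -
    fix s t :: real assume "0 \<le> s" "s \<le> t"
    moreover from this have "(t - s) * w s \<ge> 0" using w_pos[of s] by (intro mult_nonneg_nonneg) auto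
    ultimately show "G s \<le> G t" using G_diff(1)[of s t] by linarith
  qed
  show "G s \<le> G t"
  proof (cases "0 \<le> s")
    case False
    then show ?thesis using *[of 0 t] G_0[of s] G_0[of 0] G_0[of t] by (cases "t \<ge> 0") auto
  qed (use * st in auto)
qed

lemma G_pos: "t > 0 \<Longrightarrow> G t > 0"
  using G_diff(1)[of 0 t] G_0[of 0] mult_pos_pos[OF _ w_pos[of 0], of t] by (simp add: less_le_trans)

lemma G_measurable [measurable]: "G \<in> borel_measurable borel"
  by (rule borel_measurable_mono[OF G_mono])

lemma G_le: "t \<ge> 0 \<Longrightarrow> G t \<le> t * w t"
  using G_diff(2)[of 0 t] G_0[of 0] by simp

text \<open>The integrand is nonincreasing, so convergence bounds \<open>t\<close> times its value at \<open>t\<close>.\<close>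

lemma G_grows:
  assumes c: "c > 0" and fin: "(\<integral>\<^sup>+t\<in>{c..}. ennreal (G t powr (- (1 / (a + 1)))) \<partial>lborel) < \<infinity>"
  shows "\<exists>C>0. \<forall>t\<ge>2 * c. t \<le> C * G t powr (1 / (a + 1))"
proof -
  let ?g = "\<lambda>t. G t powr (- (1 / (a + 1)))"
  obtain J where J: "(\<integral>\<^sup>+t\<in>{c..}. ennreal (?g t) \<partial>lborel) = ennreal J" "J \<ge> 0"
    using ennreal_finiteE[OF fin] by blast
  have "t \<le> (2 * J + 1) * G t powr (1 / (a + 1))" if t: "t \<ge> 2 * c" for t
  proof -
    have Gt: "G t > 0" using G_pos t c by simp
    have "(\<integral>\<^sup>+s. ennreal (?g t) * indicator {t / 2..t} s \<partial>lborel) = ennreal (?g t) * ennreal (t / 2)"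
      using t c by (subst nn_integral_cmult_indicator) simp_all
    then have "ennreal (t / 2 * ?g t) = (\<integral>\<^sup>+s. ennreal (?g t) * indicator {t / 2..t} s \<partial>lborel)"
      by (simp only: ennreal_mult'[OF powr_ge_zero] mult.commute[of "t / 2"])
    also have "\<dots> \<le> (\<integral>\<^sup>+s\<in>{c..}. ennreal (?g s) \<partial>lborel)"
    proof (rule nn_integral_mono)
      fix s
      show "ennreal (?g t) * indicator {t / 2..t} s \<le> ennreal (?g s) * indicator {c..} s"
      proof (cases "s \<in> {t/2..t}")
        case True
        then have "s \<ge> c" "G s > 0" "G s \<le> G t" using t c by (auto intro!: G_pos monoD[OF G_mono])
        then show ?thesis using a_pos True by (auto intro!: ennreal_leI powr_mono2')
      qed simp
    qed
    finally have "t / 2 * ?g t \<le> J" using J by (simp add: ennreal_le_iff)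
    then have "t \<le> 2 * J * G t powr (1 / (a + 1))" using Gt by (simp add: powr_minus field_simps)
    also have "\<dots> \<le> (2 * J + 1) * G t powr (1 / (a + 1))" by (intro mult_right_mono) auto
    finally show ?thesis .
  qed
  then show ?thesis using J(2) by (intro exI[of _ "2 * J + 1"]) auto
qed

text \<open>Jensen's inequality for the average \<open>G t / t\<close> of \<open>w\<close>, from the tangent of \<open>x \<mapsto> x^\<kappa>\<close> at this average.\<close>

lemma power_mean:
  assumes t: "t > 0" and \<kappa>: "\<kappa> \<ge> 1"
  shows "integral {0..t} (\<lambda>s. w s powr \<kappa>) \<ge> G t powr \<kappa> * t powr (1 - \<kappa>)"
proof -
  define y where "y = G t / t"
  have y: "y > 0" using G_pos[OF t] t by (simp add: y_def)
  have tangent: "y powr \<kappa> + \<kappa> * y powr (\<kappa> - 1) * (x - y) \<le> x powr \<kappa>" if "x > 0" for x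
  proof -
    have "(\<lambda>x. x powr \<kappa>) x - (\<lambda>x. x powr \<kappa>) y \<ge> (\<kappa> * y powr (\<kappa> - 1)) * (x - y)"
    proof (rule convex_on_imp_above_tangent[of "{0<..}"])
      show "convex_on {0<..} (\<lambda>x. x powr \<kappa>)" 
        using \<kappa> by (rule powr_convex)
      show "((\<lambda>x. x powr \<kappa>) has_real_derivative \<kappa> * y powr (\<kappa> - 1)) (at y within {0<..})"
        using has_real_derivative_powr[OF y] has_field_derivative_at_within by blast
    qed (use y that in \<open>auto simp: interior_open\<close>)
    then show ?thesis by simp
  qed
  have int: "w integrable_on {0..t}" "(\<lambda>s. w s powr \<kappa>) integrable_on {0..t}"
    by (intro integrable_continuous_interval continuous_intros continuous_on_subset[OF w_cont] subset_UNIV;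
        use w_pos in \<open>simp add: less_imp_neq[THEN not_sym]\<close>)+
  have w_int: "(w has_integral G t) {0..t}"
    unfolding G_def using int(1) by (rule integrable_integral)
  have const: "((\<lambda>s. c) has_integral t * c) {0..t}" for c :: real
    using has_integral_const_real[of c 0 t] t by simp
  have "((\<lambda>s. y powr \<kappa> + \<kappa> * y powr (\<kappa> - 1) * (w s - y)) has_integral
      t * y powr \<kappa> + \<kappa> * y powr (\<kappa> - 1) * (G t - t * y)) {0..t}"
    by (intro has_integral_add has_integral_mult_right has_integral_diff w_int const)
  from has_integral_le[OF this integrable_integral[OF int(2)]]
  have "t * y powr \<kappa> + \<kappa> * y powr (\<kappa> - 1) * (G t - t * y) \<le> integral {0..t} (\<lambda>s. w s powr \<kappa>)"
    using tangent w_pos by blast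
  moreover have "t * y powr \<kappa> + \<kappa> * y powr (\<kappa> - 1) * (G t - t * y) = G t powr \<kappa> * t powr (1 - \<kappa>)"
    using t G_pos[OF t] by (simp add: y_def powr_divide powr_diff)
  ultimately show ?thesis by simp
qed

text \<open>Suppose that the integral of \<open>G^(-1/(a+1))\<close> converges. By Jensen's inequality the integrand with \<open>\<kappa>\<close> is at most
  \<open>G^(-\<kappa>/(\<kappa> a + 1)) t^e\<close> with \<open>e = (\<kappa> - 1) / (\<kappa> a + 1)\<close>. Replacing \<open>t\<close> by its bound
  \<open>C G^(1/(a+1))\<close> turns the exponent of \<open>G\<close> into exactly \<open>- 1 / (a + 1)\<close>.\<close>

lemma diverges_of_kappa_diverges:
  assumes \<kappa>: "\<kappa> \<ge> 1"
    and div: "integral_diverges (\<lambda>t. (integral {0..t} (\<lambda>s. w s powr \<kappa>)) powr (- (1 / (\<kappa> * a + 1))))"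
  shows "integral_diverges (\<lambda>t. G t powr (- (1 / (a + 1))))"
proof (rule ccontr)
  assume "\<not> ?thesis"
  then obtain c where c: "c > 0" "(\<integral>\<^sup>+t\<in>{c..}. ennreal (G t powr (- (1 / (a + 1)))) \<partial>lborel) < \<infinity>"
    unfolding integral_diverges_def by (auto simp: top.not_eq_extremum)
  obtain C where C: "C > 0" "\<And>t. t \<ge> 2 * c \<Longrightarrow> t \<le> C * G t powr (1 / (a + 1))"
    using G_grows[OF c] by blast
  let ?F = "\<lambda>t. integral {0..t} (\<lambda>s. w s powr \<kappa>)"
  define e where "e = (\<kappa> - 1) / (\<kappa> * a + 1)"
  have K: "\<kappa> * a + 1 > 0" using \<kappa> a_pos by (simp add: add_nonneg_pos)
  have e: "e \<ge> 0" using \<kappa> K by (simp add: e_def)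
  have le: "?F t powr (- (1 / (\<kappa> * a + 1))) \<le> C powr e * G t powr (- (1 / (a + 1)))" if t: "t \<ge> 2 * c" for t
  proof -
    have t0: "t > 0" using t c by simp
    have G: "G t > 0" by (rule G_pos[OF t0])
    have "?F t powr (- (1 / (\<kappa> * a + 1))) \<le> (G t powr \<kappa> * t powr (1 - \<kappa>)) powr (- (1 / (\<kappa> * a + 1)))"
      using power_mean[OF t0 \<kappa>] G t0 K by (intro powr_mono2') (auto intro!: mult_pos_pos divide_nonneg_pos)
    also have "\<dots> = G t powr (- (\<kappa> / (\<kappa> * a + 1))) * t powr e"
    proof -
      have "\<kappa> * - (1 / (\<kappa> * a + 1)) = - (\<kappa> / (\<kappa> * a + 1))" by simp
      moreover have "(1 - \<kappa>) * - (1 / (\<kappa> * a + 1)) = e" by (simp add: e_def diff_divide_distrib)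
      ultimately show ?thesis using G t0 by (simp only: powr_mult powr_powr powr_ge_zero)
    qed
    also have "\<dots> \<le> G t powr (- (\<kappa> / (\<kappa> * a + 1))) * (C * G t powr (1 / (a + 1))) powr e"
      using C(2)[OF t] t0 e by (intro mult_left_mono powr_mono2) auto
    also have "\<dots> = C powr e * G t powr (- (\<kappa> / (\<kappa> * a + 1)) + 1 / (a + 1) * e)"
      by (simp only: powr_mult powr_powr powr_add mult_ac)
    also have "- (\<kappa> / (\<kappa> * a + 1)) + 1 / (a + 1) * e = - (1 / (a + 1))"
    proof -
      have "a + 1 \<noteq> 0" using a_pos by simp
      then show ?thesis using K unfolding e_def by (simp add: divide_simps) (simp add: algebra_simps)
    qed
    finally show ?thesis .
  qed
  have "(\<integral>\<^sup>+t\<in>{2 * c..}. ennreal (?F t powr (- (1 / (\<kappa> * a + 1)))) \<partial>lborel)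
      \<le> (\<integral>\<^sup>+t. ennreal (C powr e) * (ennreal (G t powr (- (1 / (a + 1)))) * indicator {c..} t) \<partial>lborel)"
    using le c by (intro nn_integral_mono) (auto simp: indicator_def ennreal_mult'[symmetric] intro!: ennreal_leI)
  also have "\<dots> = ennreal (C powr e) * (\<integral>\<^sup>+t\<in>{c..}. ennreal (G t powr (- (1 / (a + 1)))) \<partial>lborel)"
    by (intro nn_integral_cmult) measurable
  also have "\<dots> < \<infinity>" using c(2) by (simp add: ennreal_mult_less_top)
  finally show False using div c(1) unfolding integral_diverges_def by (auto dest!: spec[of _ "2 * c"])
qed

end

text \<open>A continuous cut-off. The primitive of \<open>ramp b * w\<close> vanishes below \<open>b - 1\<close> and is
  continuously differentiable also at the point where it starts to grow, which makes the solutions below twice differentiable.\<close>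

definition ramp :: "real \<Rightarrow> real \<Rightarrow> real" where
  "ramp b t = min 1 (max 0 (t - b + 1))"

lemma ramp: "0 \<le> ramp b t" "ramp b t \<le> 1" "t \<ge> b \<Longrightarrow> ramp b t = 1" "t \<le> b - 1 \<Longrightarrow> ramp b t = 0"
  by (auto simp: ramp_def)

lemma ramp_cont: "continuous_on A (ramp b)"
  unfolding ramp_def by (intro continuous_intros)

text \<open>The data of \<open>\<Psi>' = H(\<Psi>)\<close> with \<open>H = (1 + \<Phi>)^(1/(a+1))\<close>, solved by separation of variables: \<open>T\<close> is a
  primitive of \<open>1 / H\<close> and \<open>\<Psi>\<close> is its inverse. The truncation \<open>max 0\<close> makes the integrand continuous without
  reference to the sign of \<open>\<Phi>\<close>, which turns out to be nonnegative.\<close>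

locale separable_ode = growth +
  fixes b :: real and \<Phi> T :: "real \<Rightarrow> real"
  assumes \<Phi>_deriv: "\<And>t. (\<Phi> has_real_derivative ramp b t * w t) (at t)"
    and \<Phi>_bot: "\<Phi> (b - 1) = 0" and
    T_deriv: "\<And>t. (T has_real_derivative (1 + max 0 (\<Phi> t)) powr (- (1 / (a + 1)))) (at t)"
begin

lemma \<Phi>_mono: "s \<le> t \<Longrightarrow> \<Phi> s \<le> \<Phi> t"
  by (rule DERIV_nonneg_imp_nondecreasing[of s t \<Phi>])
    (auto intro!: exI conjI \<Phi>_deriv mult_nonneg_nonneg ramp less_imp_le[OF w_pos])

lemma \<Phi>_nonneg: "\<Phi> t \<ge> 0"
proof (cases "t \<ge> b - 1")
  case False
  then obtain z where z: "t < z" "z < b - 1" "\<Phi> (b - 1) - \<Phi> t = (b - 1 - t) * (ramp b z * w z)"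
    using MVT2[of t "b - 1" \<Phi> "\<lambda>t. ramp b t * w t"] \<Phi>_deriv by auto
  then show ?thesis using \<Phi>_bot by (simp add: ramp)
qed (use \<Phi>_mono[of "b - 1" t] \<Phi>_bot in auto)

lemma \<Phi>_le:
  assumes "t \<ge> b"
  shows "\<Phi> t \<le> (t - b + 1) * w t"
proof -
  obtain z where z: "b - 1 < z" "z < t" "\<Phi> t - \<Phi> (b - 1) = (t - (b - 1)) * (ramp b z * w z)"
    using MVT2[of "b - 1" t \<Phi> "\<lambda>t. ramp b t * w t"] \<Phi>_deriv assms by auto
  have "ramp b z * w z \<le> 1 * w t" using z ramp w_pos[of z] w_mono by (intro mult_mono) (auto intro: monoD)
  then have "(t - (b - 1)) * (ramp b z * w z) \<le> (t - (b - 1)) * w t" using assms by (intro mult_left_mono) auto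
  then show ?thesis using z(3) \<Phi>_bot by (simp add: algebra_simps)
qed

lemma \<Phi>_G:
  assumes "t \<ge> max b 0"
  shows "\<Phi> t = G t + (\<Phi> (max b 0) - G (max b 0))"
proof (cases "t = max b 0")
  case False
  obtain A where A: "\<And>t. (A has_real_derivative w t) (at t)" using antiderivative_exists[OF w_cont] by blast
  have "\<exists>z. max b 0 < z \<and> z < t \<and> (\<Phi> t - A t) - (\<Phi> (max b 0) - A (max b 0)) = (t - max b 0) * (ramp b z * w z - w z)"
    using assms False by (intro MVT2) (auto intro!: derivative_intros \<Phi>_deriv A)
  then obtain z where "max b 0 < z" "(\<Phi> t - A t) - (\<Phi> (max b 0) - A (max b 0)) = (t - max b 0) * (ramp b z * w z - w z)"
    by blast
  then have "\<Phi> t - A t = \<Phi> (max b 0) - A (max b 0)" using ramp(3)[of b z] by simp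
  then show ?thesis using G_antiderivative[OF A, of t] G_antiderivative[OF A, of "max b 0"] assms by simp
qed simp

definition "H t = (1 + \<Phi> t) powr (1 / (a + 1))"
definition "H1 t = (1 / (a + 1)) * (1 + \<Phi> t) powr (1 / (a + 1) - 1) * (ramp b t * w t)"

lemma H_ge_1: "H t \<ge> 1"
  using \<Phi>_nonneg[of t] a_pos unfolding H_def by (intro ge_one_powr_ge_zero) auto

lemma H_pos: "H t > 0" using H_ge_1[of t] by linarith

lemma H_mono: "s \<le> t \<Longrightarrow> H s \<le> H t"
  unfolding H_def using \<Phi>_mono[of s t] \<Phi>_nonneg[of s] a_pos by (intro powr_mono2) auto

lemma H_deriv: "(H has_real_derivative H1 t) (at t)"
  unfolding H_def H1_def using \<Phi>_nonneg[of t]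
  by (auto intro!: derivative_eq_intros \<Phi>_deriv)

lemma \<Phi>_cont: "continuous_on A \<Phi>"
  using \<Phi>_deriv by (meson DERIV_isCont continuous_at_imp_continuous_on)

lemma H1_cont: "continuous_on A H1"
  unfolding H1_def using \<Phi>_nonneg
  by (intro continuous_intros \<Phi>_cont ramp_cont continuous_on_subset[OF w_cont] subset_UNIV)
    (simp add: add_nonneg_eq_0_iff)

text \<open>The derivative of \<open>H^(a+1) = 1 + \<Phi>\<close>, divided by \<open>a + 1\<close>; this is the reason for the choice of \<open>H\<close>.\<close>

lemma H_power_H1: "H t powr a * H1 t = ramp b t * w t / (a + 1)"
proof -
  have p: "1 + \<Phi> t > 0" using \<Phi>_nonneg[of t] by simp
  have "(1 / (a + 1)) * a + (1 / (a + 1) - 1) = 0" using a_pos by (simp add: field_simps)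
  then have "H t powr a * (1 + \<Phi> t) powr (1 / (a + 1) - 1) = 1"
    unfolding H_def powr_powr using p by (simp flip: powr_add)
  then show ?thesis unfolding H1_def by (simp add: mult_ac)
qed

lemma H1_nonneg: "H1 t \<ge> 0"
  unfolding H1_def using a_pos ramp w_pos[of t] by simp

lemma T_deriv': "(T has_real_derivative (1 / H t)) (at t)"
proof -
  have "(1 + max 0 (\<Phi> t)) powr (- (1 / (a + 1))) = 1 / H t"
    using \<Phi>_nonneg[of t] unfolding H_def by (simp add: powr_minus divide_inverse max_def)
  then show ?thesis using T_deriv[of t] by simp
qed

lemma T_strict: "s < t \<Longrightarrow> T s < T t"
  by (rule DERIV_pos_imp_increasing[of s t T]) (auto intro!: exI conjI T_deriv' H_pos)

lemma T_less_iff: "T s < T t \<longleftrightarrow> s < t"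
  using T_strict by (metis less_asym linorder_cases)

lemma T_inj: "inj T"
  by (rule injI) (metis T_strict less_irrefl linorder_cases)

definition "\<Psi> = inv T"

lemma \<Psi>_T: "\<Psi> (T s) = s" unfolding \<Psi>_def by (rule inv_f_f[OF T_inj])

lemma T_isCont: "isCont T t" using T_deriv' DERIV_isCont by blast

lemma \<Psi>_deriv: "(\<Psi> has_real_derivative H s) (at (T s))"
proof -
  have "isCont \<Psi> (T s)"
    by (rule isCont_inverse_function[of 1]) (auto simp: \<Psi>_T T_isCont)
  moreover have "T (\<Psi> y) = y" if "T (s - 1) < y" "y < T (s + 1)" for y
  proof -
    have "\<exists>x\<ge>s - 1. x \<le> s + 1 \<and> T x = y"
      using that T_isCont by (intro IVT) auto
    then show ?thesis by (auto simp: \<Psi>_T)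
  qed
  ultimately have "(\<Psi> has_real_derivative inverse (1 / H s)) (at (T s))"
    using T_strict[of "s - 1" s] T_strict[of s "s + 1"] H_pos[of s] T_deriv'[of s]
    by (intro DERIV_inverse_function[where f = T and a = "T (s - 1)" and b = "T (s + 1)"]) (auto simp: \<Psi>_T)
  then show ?thesis by simp
qed

lemma range_T_interval: "T s \<le> y \<Longrightarrow> y \<le> T t \<Longrightarrow> y \<in> range T"
proof -
  assume y: "T s \<le> y" "y \<le> T t"
  then have "s \<le> t" using T_less_iff[of t s] by (meson le_less_trans not_le)
  then have "\<exists>x\<ge>s. x \<le> t \<and> T x = y" using y T_isCont by (intro IVT) auto
  then show ?thesis by auto
qed

lemma H_cont: "continuous_on A H"
  using H_deriv by (meson DERIV_isCont continuous_at_imp_continuous_on)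

lemma H_inverse_measurable [measurable]: "(\<lambda>t. 1 / H t) \<in> borel_measurable borel"
  by (intro borel_measurable_continuous_onI continuous_intros H_cont) (use H_pos in \<open>simp add: less_imp_neq[THEN not_sym]\<close>)

text \<open>For large \<open>t\<close> the functions \<open>1 + \<Phi>\<close> and \<open>G\<close> are comparable, and the integral of \<open>1 / H\<close> is the increment
  of \<open>T\<close>.\<close>

lemma T_unbounded_above:
  assumes b: "b \<le> 0" and div: "integral_diverges (\<lambda>t. G t powr (- (1 / (a + 1))))"
  shows "\<exists>t. T t \<ge> y"
proof (rule ccontr)
  assume "\<not> ?thesis"
  then have bd: "T t \<le> y" for t by (meson linear not_le)
  have bdd: "bdd_above (range T)" using bd by (intro bdd_aboveI2)
  define L where "L = (SUP t. T t)"
  have L: "(T \<longlongrightarrow> L) at_top"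
  proof (rule order_tendstoI)
    fix x assume "x < L"
    then obtain s where s: "x < T s" using less_cSUP_iff[OF _ bdd] unfolding L_def by auto
    have "T t > x" if "t \<ge> s" for t
      using s T_less_iff[of t s] that by (meson less_le_trans not_le)
    then show "\<forall>\<^sub>F t in at_top. x < T t" unfolding eventually_at_top_linorder by blast
  next
    fix x assume "L < x"
    moreover have "T t \<le> L" for t unfolding L_def by (rule cSUP_upper[OF UNIV_I bdd])
    ultimately show "\<forall>\<^sub>F t in at_top. T t < x" by (intro always_eventually allI) (metis le_less_trans)
  qed
  define C where "C = (1 + \<bar>\<Phi> 0 - G 0\<bar>) / G 1 + 1"
  have G1: "G 1 > 0" by (rule G_pos) simp
  have C: "C > 0" unfolding C_def using G1 by (intro add_nonneg_pos divide_nonneg_pos) auto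
  have le: "G t powr (- (1 / (a + 1))) \<le> C powr (1 / (a + 1)) * (1 / H t)" if t: "t \<ge> 1" for t
  proof -
    have Gt: "G t \<ge> G 1" "G t > 0" using monoD[OF G_mono t] G1 by auto
    have "1 + \<Phi> t \<le> (1 + \<bar>\<Phi> 0 - G 0\<bar>) * 1 + G t"
      using \<Phi>_G[of t] t b by (simp add: max_def split: if_splits)
    also have "\<dots> \<le> (1 + \<bar>\<Phi> 0 - G 0\<bar>) * (G t / G 1) + G t"
      using Gt G1 by (intro add_right_mono mult_left_mono) auto
    also have "\<dots> = C * G t" unfolding C_def by (simp add: algebra_simps add_divide_distrib)
    finally have "H t \<le> (C * G t) powr (1 / (a + 1))"
      unfolding H_def using \<Phi>_nonneg[of t] a_pos by (intro powr_mono2) auto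
    also have "\<dots> = C powr (1 / (a + 1)) * G t powr (1 / (a + 1))" using C Gt by (simp add: powr_mult)
    finally show ?thesis using H_pos[of t] Gt by (simp add: powr_minus field_simps)
  qed
  have "(\<integral>\<^sup>+t\<in>{1..}. ennreal (G t powr (- (1 / (a + 1)))) \<partial>lborel)
    \<le> (\<integral>\<^sup>+t. ennreal (C powr (1 / (a + 1))) * (ennreal (1 / H t) * indicator {1..} t) \<partial>lborel)"
    using le H_pos by (intro nn_integral_mono) (auto simp: indicator_def ennreal_mult'[symmetric] intro!: ennreal_leI)
  also have "\<dots> = ennreal (C powr (1 / (a + 1))) * (\<integral>\<^sup>+t. ennreal (1 / H t) * indicator {1..} t \<partial>lborel)"
    by (intro nn_integral_cmult) measurable
  also have "(\<integral>\<^sup>+t. ennreal (1 / H t) * indicator {1..} t \<partial>lborel) = ennreal (L - T 1)"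
    by (rule nn_integral_FTC_atLeast[OF _ T_deriv' _ L]) (use H_pos in \<open>auto intro: less_imp_le\<close>)
  also have "ennreal (C powr (1 / (a + 1))) * ennreal (L - T 1) < \<infinity>" by (simp add: ennreal_mult_less_top)
  finally show False using div unfolding integral_diverges_def by (auto dest!: spec[of _ 1])
qed

lemma T_unbounded_below: "\<exists>t. T t \<le> y"
proof -
  have "T (b - 1) - T t \<ge> (b - 1 - t) / H (b - 1)" if lt: "t < b - 1" for t
  proof -
    obtain z where z: "t < z" "z < b - 1" "T (b - 1) - T t = (b - 1 - t) / H z"
      using MVT2[of t "b - 1" T "\<lambda>t. 1 / H t"] T_deriv' lt by auto
    have "1 / H (b - 1) \<le> 1 / H z" using H_mono[of z "b - 1"] z H_pos by (intro divide_left_mono) auto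
    then show ?thesis using z lt by (simp add: mult_left_mono divide_inverse)
  qed
  from this[of "b - 1 - (\<bar>T (b - 1) - y\<bar> + 1) * H (b - 1)"] show ?thesis
    using H_pos[of "b - 1"] by (intro exI[of _ "b - 1 - (\<bar>T (b - 1) - y\<bar> + 1) * H (b - 1)"]) (auto simp: abs_if split: if_splits)
qed

lemma T_bounded_above:
  assumes c: "c > 0" "(\<integral>\<^sup>+t\<in>{c..}. ennreal (G t powr (- (1 / (a + 1)))) \<partial>lborel) < \<infinity>"
  shows "\<exists>y. \<forall>t. T t \<le> y"
proof -
  define s0 where "s0 = max b 0"
  define s1 where "s1 = max s0 c"
  define \<delta> where "\<delta> = min 1 (1 / (G s0 + 1))"
  have G0: "G s0 \<ge> 0" using G_mono G_0[of 0] monoD[OF G_mono, of 0 s0] by (simp add: s0_def)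
  have \<delta>: "\<delta> > 0" "\<delta> \<le> 1" "\<delta> * G s0 \<le> 1"
    using G0 by (auto simp: \<delta>_def min_def field_simps)
  have le: "1 / H t \<le> \<delta> powr (- (1 / (a + 1))) * G t powr (- (1 / (a + 1)))" if t: "t \<ge> s1" for t
  proof -
    have Gt: "G t > 0" using t c by (intro G_pos) (auto simp: s1_def)
    have "\<Phi> t = G t + (\<Phi> s0 - G s0)" using \<Phi>_G[of t] t by (simp add: s0_def s1_def)
    then have "G t = \<Phi> t + G s0 - \<Phi> s0" by simp
    then have "\<delta> * G t = \<delta> * \<Phi> t + \<delta> * G s0 - \<delta> * \<Phi> s0"
      by (simp only: right_diff_distrib distrib_left)
    also have "\<dots> \<le> 1 * \<Phi> t + 1 - 0"
      using \<delta> \<Phi>_nonneg by (intro diff_mono add_mono mult_right_mono mult_nonneg_nonneg) auto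
    finally have "(\<delta> * G t) powr (1 / (a + 1)) \<le> H t"
      unfolding H_def using \<delta> Gt a_pos by (intro powr_mono2) auto
    then have "1 / H t \<le> 1 / (\<delta> * G t) powr (1 / (a + 1))"
      using \<delta> Gt H_pos[of t] by (intro divide_left_mono) auto
    then show ?thesis using \<delta> Gt by (simp add: powr_mult powr_minus divide_inverse)
  qed
  obtain J where J: "(\<integral>\<^sup>+t\<in>{c..}. ennreal (G t powr (- (1 / (a + 1)))) \<partial>lborel) = ennreal J" "J \<ge> 0"
    using ennreal_finiteE[OF c(2)] by blast
  let ?D = "\<delta> powr (- (1 / (a + 1)))"
  have "T t \<le> T s1 + ?D * J" if t: "t \<ge> s1" for t
  proof -
    have "ennreal (T t - T s1) = (\<integral>\<^sup>+x. ennreal (1 / H x) * indicator {s1..t} x \<partial>lborel)"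
      using t T_deriv' H_pos by (intro nn_integral_FTC_Icc[symmetric])
        (auto intro: less_imp_le has_field_derivative_at_within)
    also have "\<dots> \<le> (\<integral>\<^sup>+t. ennreal ?D * (ennreal (G t powr (- (1 / (a + 1)))) * indicator {c..} t) \<partial>lborel)"
      using le by (intro nn_integral_mono) (auto simp: indicator_def s1_def ennreal_mult'[symmetric] intro!: ennreal_leI)
    also have "\<dots> = ennreal ?D * (\<integral>\<^sup>+t\<in>{c..}. ennreal (G t powr (- (1 / (a + 1)))) \<partial>lborel)"
      by (intro nn_integral_cmult) measurable
    also have "\<dots> = ennreal (?D * J)" using J by (simp add: ennreal_mult')
    finally show ?thesis using J by (simp add: ennreal_le_iff)
  qed
  moreover have "T t \<le> T s1" if "t \<le> s1" for t using T_less_iff[of s1 t] that by (meson not_le)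
  moreover have "?D * J \<ge> 0" using J by simp
  ultimately have "T t \<le> T s1 + ?D * J" for t
    by (cases "t \<ge> s1") (smt (verit))+
  then show ?thesis by blast
qed

text \<open>In \<open>1 + \<Phi> t \<le> C (t - b + 1) w t\<close> the linear factor is at most a multiple of \<open>(w t)^(1/a)\<close>, because
  \<open>t^(a+1) \<le> C G t \<le> C t w t\<close> for large \<open>t\<close>. This gives \<open>1 + \<Phi> t \<le> C (w t)^((a+1)/a)\<close>. It shows that the first-order
  term of the supersolution inequality is dominated by \<open>w\<close>.\<close>

lemma H_power_le:
  assumes c: "c > 0" "(\<integral>\<^sup>+t\<in>{c..}. ennreal (G t powr (- (1 / (a + 1)))) \<partial>lborel) < \<infinity>"
  shows "\<exists>K>0. \<forall>t\<ge>b. H t powr a \<le> K * w t"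
proof -
  obtain C where C: "C > 0" "\<And>t. t \<ge> 2 * c \<Longrightarrow> t \<le> C * G t powr (1 / (a + 1))"
    using G_grows[OF c] by blast
  define m where "m = w b"
  have m: "m > 0" using w_pos by (simp add: m_def)
  have wm: "w t \<ge> m" if "t \<ge> b" for t using w_mono that by (auto simp: m_def mono_def)
  have lin: "\<exists>D>0. \<forall>t\<ge>b. t - b + 1 \<le> D * w t powr (1 / a)"
  proof -
    have big: "t \<le> C powr ((a + 1) / a) * w t powr (1 / a)" if t: "t \<ge> 2 * c" for t
    proof -
      have t0: "t > 0" using t c by simp
      have "t \<le> C * (t * w t) powr (1 / (a + 1))"
        using C t G_le[of t] t0 G_pos[OF t0] a_pos
        by (intro order_trans[OF C(2)[OF t]] mult_left_mono powr_mono2) auto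
      then have "t powr ((a + 1) / a) \<le> (C * (t * w t) powr (1 / (a + 1))) powr ((a + 1) / a)"
        using t0 a_pos by (intro powr_mono2) auto
      also have "\<dots> = C powr ((a + 1) / a) * (t powr (1 / a) * w t powr (1 / a))"
        using C(1) t0 w_pos[of t] a_pos by (simp add: powr_mult powr_powr)
      finally have "t powr ((a + 1) / a) / t powr (1 / a) \<le> C powr ((a + 1) / a) * w t powr (1 / a)"
        using t0 by (simp add: field_simps)
      moreover have "(a + 1) / a - 1 / a = 1" using a_pos by (simp add: field_simps)
      ultimately show ?thesis using t0 by (simp flip: powr_diff)
    qed
    define E where "E = (2 * c + \<bar>b\<bar> + 1)"
    define D where "D = C powr ((a + 1) / a) + E / m powr (1 / a)"
    have E: "E > 0" using c by (simp add: E_def)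
    have "t - b + 1 \<le> D * w t powr (1 / a)" if t: "t \<ge> b" for t
    proof -
      have "m powr (1 / a) \<le> w t powr (1 / a)" using wm[OF t] m a_pos by (intro powr_mono2) auto
      then have "E / m powr (1 / a) * m powr (1 / a) \<le> E / m powr (1 / a) * w t powr (1 / a)"
        using E m by (intro mult_left_mono) auto
      then have 1: "E \<le> E / m powr (1 / a) * w t powr (1 / a)" using m by simp
      show ?thesis
      proof (cases "t \<ge> 2 * c")
        case True
        then show ?thesis using 1 big[of t] c unfolding D_def E_def by (simp add: distrib_right)
      next
        case False
        then have "t - b + 1 \<le> E" by (simp add: E_def)
        also note 1
        also have "E / m powr (1 / a) * w t powr (1 / a) \<le> D * w t powr (1 / a)"
          unfolding D_def by (intro mult_right_mono) auto
        finally show ?thesis .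
      qed
    qed
    moreover have "D > 0" unfolding D_def using E m C by (intro add_nonneg_pos divide_pos_pos) auto
    ultimately show ?thesis by blast
  qed
  then obtain D where D: "D > 0" "\<And>t. t \<ge> b \<Longrightarrow> t - b + 1 \<le> D * w t powr (1 / a)" by blast
  define C2 where "C2 = (1 / m + 1) * D"
  have C2: "C2 > 0" using m D by (simp add: C2_def add_pos_pos)
  have "H t powr a \<le> C2 powr (a / (a + 1)) * w t" if t: "t \<ge> b" for t
  proof -
    have "1 \<le> 1 / m * (1 * w t)" using wm[OF t] m by (simp add: field_simps)
    also have "\<dots> \<le> 1 / m * ((t - b + 1) * w t)"
      using t m w_pos[of t] by (intro mult_left_mono mult_right_mono) auto
    finally have "1 \<le> 1 / m * ((t - b + 1) * w t)" .
    then have "1 + \<Phi> t \<le> 1 / m * ((t - b + 1) * w t) + 1 * ((t - b + 1) * w t)"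
      using \<Phi>_le[OF t] by linarith
    also have "\<dots> = (1 / m + 1) * ((t - b + 1) * w t)" by (rule distrib_right[symmetric])
    also have "\<dots> \<le> (1 / m + 1) * ((D * w t powr (1 / a)) * w t)"
      using D(2)[OF t] m w_pos[of t] by (intro mult_left_mono mult_right_mono) auto
    also have "\<dots> = C2 * w t powr ((a + 1) / a)"
    proof -
      have "w t powr (1 / a) * w t = w t powr (1 / a) * w t powr 1"
        by (simp only: powr_one[OF less_imp_le[OF w_pos]])
      also have "\<dots> = w t powr (1 / a + 1)" by (rule powr_add[symmetric])
      also have "1 / a + 1 = (a + 1) / a" using a_pos by (simp add: field_simps)
      finally show ?thesis by (simp add: C2_def mult_ac)
    qed
    finally have "(1 + \<Phi> t) powr (a / (a + 1)) \<le> (C2 * w t powr ((a + 1) / a)) powr (a / (a + 1))"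
      using \<Phi>_nonneg[of t] a_pos by (intro powr_mono2) auto
    also have "\<dots> = C2 powr (a / (a + 1)) * w t"
      using C2 w_pos[of t] a_pos by (simp add: powr_mult powr_powr)
    finally show ?thesis unfolding H_def powr_powr by simp
  qed
  then show ?thesis using C2 by (intro exI[of _ "C2 powr (a / (a + 1))"]) auto
qed

end

context growth
begin

lemma separable_ode_exists: "\<exists>\<Phi> T. separable_ode w a b \<Phi> T"
proof -
  obtain F where F: "\<And>t. (F has_real_derivative ramp b t * w t) (at t)"
    using antiderivative_exists[of "\<lambda>t. ramp b t * w t"] by (auto intro!: continuous_intros ramp_cont w_cont)
  define \<Phi> where "\<Phi> t = F t - F (b - 1)" for t
  have \<Phi>: "(\<Phi> has_real_derivative ramp b t * w t) (at t)" for t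
    unfolding \<Phi>_def by (auto intro!: derivative_eq_intros F)
  have "continuous_on UNIV \<Phi>" using \<Phi> by (meson DERIV_isCont continuous_at_imp_continuous_on)
  then have "continuous_on UNIV (\<lambda>t. (1 + max 0 (\<Phi> t)) powr (- (1 / (a + 1))))"
    by (intro continuous_intros) (auto simp: add_nonneg_eq_0_iff)
  then obtain T where "\<And>t. (T has_real_derivative (1 + max 0 (\<Phi> t)) powr (- (1 / (a + 1)))) (at t)"
    using antiderivative_exists by blast
  then have "separable_ode w a b \<Phi> T"
    using \<Phi> by unfold_locales (auto simp: \<Phi>_def)
  then show ?thesis by blast
qed

end


section \<open>Regularity of radial profiles\<close>

lemma S_mat_eq: "has_eigenvalues M l \<Longrightarrow> S_mat k M = elem_sym k l"
  unfolding S_mat_def eigenvalues_def by (rule elem_sym_eigenvalues_unique) (rule someI)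

lemma filterlim_norm_at_right: "filterlim (norm :: real^'n \<Rightarrow> real) (at_right 0) (at 0)"
  unfolding filterlim_at by (auto simp: eventually_at_filter intro!: tendsto_eq_intros)

lemma abs_powr_mult_self: "y > 0 \<Longrightarrow> \<bar>y\<bar> powr (p - 2) * y = y powr (p - 1)" for y :: real
proof -
  assume y: "y > 0"
  have "y powr (p - 2 + 1) = y powr (p - 2) * y powr 1" by (rule powr_add)
  then show ?thesis using y by simp
qed

lemma has_derivative_abs_powr_mult_self:
  assumes S: "open S" "r \<in> S" and pos: "\<And>s. s \<in> S \<Longrightarrow> \<phi>1 s > 0" and d: "(\<phi>1 has_real_derivative d) (at r)"
  shows "((\<lambda>r. \<bar>\<phi>1 r\<bar> powr (p - 2) * \<phi>1 r) has_real_derivative (p - 1) * \<phi>1 r powr (p - 2) * d) (at r)"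
proof -
  have "((\<lambda>r. \<phi>1 r powr (p - 1)) has_real_derivative (p - 1) * \<phi>1 r powr (p - 1 - 1) * d) (at r)"
    using DERIV_chain2[OF has_real_derivative_powr[OF pos[OF S(2)]] d] .
  then have "((\<lambda>r. \<phi>1 r powr (p - 1)) has_real_derivative (p - 1) * \<phi>1 r powr (p - 2) * d) (at r)" by simp
  then show ?thesis
  proof (rule has_field_derivative_transform_within_open[OF _ S])
    fix s assume "s \<in> S"
    then have "\<phi>1 s > 0" by (rule pos)
    then show "\<phi>1 s powr (p - 1) = \<bar>\<phi>1 s\<bar> powr (p - 2) * \<phi>1 s"
      by (rule abs_powr_mult_self[symmetric])
  qed
qed

locale radial_profile =
  fixes \<phi> \<phi>1 \<phi>2 :: "real \<Rightarrow> real"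
  assumes d1: "\<And>r. r > 0 \<Longrightarrow> (\<phi> has_real_derivative \<phi>1 r) (at r)"
    and d2: "\<And>r. r > 0 \<Longrightarrow> (\<phi>1 has_real_derivative \<phi>2 r) (at r)"
    and c2: "continuous_on {0<..} \<phi>2"
    and c0: "continuous_on {0..} \<phi>"
    and lim0: "(\<phi>1 \<longlongrightarrow> 0) (at_right 0)"
begin

lemma has_derivative_off_0:
  fixes x :: "real^'n"
  assumes "x \<noteq> 0"
  shows "((\<lambda>x. \<phi> (norm x)) has_derivative (\<lambda>h. ((\<phi>1 (norm x) / norm x) *\<^sub>R x) \<bullet> h)) (at x)"
  using assms by (intro has_derivative_radial d1) auto

lemma has_derivative_at_0: "((\<lambda>x :: real^'n. \<phi> (norm x)) has_derivative (\<lambda>h. 0)) (at 0)"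
  unfolding has_derivative_at_alt
proof (intro conjI allI impI)
  fix e :: real assume e: "e > 0"
  then obtain d where d: "d > 0" "\<And>r. 0 < r \<Longrightarrow> r < d \<Longrightarrow> \<bar>\<phi>1 r\<bar> < e"
    using lim0[THEN tendstoD, OF e] unfolding eventually_at_right_field by (auto simp: dist_real_def)
  have "\<bar>\<phi> r - \<phi> 0\<bar> \<le> e * r" if r: "0 < r" "r < d" for r
  proof -
    have "\<exists>l z. 0 < z \<and> z < r \<and> DERIV \<phi> z :> l \<and> \<phi> r - \<phi> 0 = (r - 0) * l"
      using r d1 by (intro MVT continuous_on_subset[OF c0]) (auto simp: real_differentiable_def)
    then obtain l z where z: "0 < z" "z < r" "DERIV \<phi> z :> l" "\<phi> r - \<phi> 0 = r * l" by auto
    then have "l = \<phi>1 z" using d1 DERIV_unique by blast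
    then have "\<bar>l\<bar> \<le> e" using d(2)[of z] z r by auto
    then show ?thesis using z(4) r by (simp add: abs_mult mult.commute mult_left_mono)
  qed
  note key = this
  have "norm (\<phi> (norm y) - \<phi> (norm (0 :: real^'n)) - 0) \<le> e * norm (y - 0)" if "norm (y - 0) < d" for y :: "real^'n"
    using key[of "norm y"] that by (cases "y = 0") simp_all
  then show "\<exists>d>0. \<forall>y :: real^'n. norm (y - 0) < d \<longrightarrow> norm (\<phi> (norm y) - \<phi> (norm (0 :: real^'n)) - 0) \<le> e * norm (y - 0)"
    using d(1) by blast
qed simp

lemma differentiable: "(\<lambda>x :: real^'n. \<phi> (norm x)) differentiable (at x)"
  using has_derivative_off_0 has_derivative_at_0 by (cases "x = 0") (auto intro: differentiableI)

lemma grad_radial: "grad (\<lambda>x. \<phi> (norm x)) x = (\<phi>1 (norm x) / norm x) *\<^sub>R x"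
proof (cases "x = 0")
  case True
  have "((\<lambda>x :: real^'n. \<phi> (norm x)) has_derivative (\<lambda>h. 0 \<bullet> h)) (at 0)"
    using has_derivative_at_0 by simp
  then show ?thesis using grad_eqI True by fastforce
qed (intro grad_eqI has_derivative_off_0)

lemma partial_radial: "partial i (\<lambda>x. \<phi> (norm x)) x = (\<phi>1 (norm x) / norm x) * x $ i"
  using arg_cong[OF grad_radial[of x], of "\<lambda>v. v $ i"] by (simp add: grad_def)

lemma has_derivative_partial:
  fixes x :: "real^'n"
  assumes "x \<noteq> 0"
  shows "(partial i (\<lambda>x. \<phi> (norm x)) has_derivative
     (\<lambda>h. (radial_jac (\<phi>2 (norm x)) (\<phi>1 (norm x) / norm x) x *v h) $ i)) (at x)"
proof -
  have "((\<lambda>x. ((\<phi>1 (norm x) / norm x) *\<^sub>R x) $ i) has_derivative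
     (\<lambda>h. (radial_jac (\<phi>2 (norm x)) (\<phi>1 (norm x) / norm x) x *v h) $ i)) (at x)"
    using assms by (intro bounded_linear.has_derivative[OF bounded_linear_vec_nth] has_derivative_radial_field d2) auto
  then show ?thesis by (simp add: partial_radial[abs_def])
qed

lemma partial_partial_radial:
  fixes x :: "real^'n"
  assumes "x \<noteq> 0"
  shows "partial j (partial i (\<lambda>x. \<phi> (norm x))) x = radial_jac (\<phi>2 (norm x)) (\<phi>1 (norm x) / norm x) x $ i $ j"
  using partial_eqI[OF has_derivative_partial[OF assms]] by (simp add: matrix_vector_mul_component inner_axis)

lemma \<phi>1_cont: "continuous_on {0<..} \<phi>1"
  using d2 by (meson DERIV_isCont continuous_at_imp_continuous_on greaterThan_iff)

lemma continuous_on_partial_partial: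
  "continuous_on (UNIV - {0}) (partial j (partial i (\<lambda>x :: real^'n. \<phi> (norm x))))"
proof -
  have n: "norm ` (UNIV - {0 :: real^'n}) \<subseteq> {0<..}" by auto
  have "continuous_on (UNIV - {0}) (\<lambda>x :: real^'n. radial_jac (\<phi>2 (norm x)) (\<phi>1 (norm x) / norm x) x $ i $ j)"
    unfolding radial_jac_def outer_def
    by (simp, intro continuous_intros continuous_on_compose2[OF c2 _ n] continuous_on_compose2[OF \<phi>1_cont _ n]) auto
  then show ?thesis
    by (rule continuous_on_eq) (simp add: partial_partial_radial)
qed

lemma Ck_on_2_off_0: "Ck_on 2 (UNIV - {0}) (\<lambda>x :: real^'n. \<phi> (norm x))"
  unfolding Ck_on_2_iff
  using differentiable differentiableI[OF has_derivative_partial] continuous_on_partial_partial by auto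

lemma continuous_on_partial: "continuous_on UNIV (partial i (\<lambda>x :: real^'n. \<phi> (norm x)))"
proof -
  have "isCont (partial i (\<lambda>x :: real^'n. \<phi> (norm x))) x" for x
  proof (cases "x = 0")
    case True
    have lim: "((\<lambda>x :: real^'n. \<bar>\<phi>1 (norm x)\<bar>) \<longlongrightarrow> 0) (at 0)"
      using filterlim_compose[OF lim0 filterlim_norm_at_right] by (rule tendsto_rabs_zero)
    have bd: "norm (partial i (\<lambda>x. \<phi> (norm x)) x) \<le> \<bar>\<phi>1 (norm x)\<bar>" for x :: "real^'n"
      using mult_left_mono[OF component_le_norm_cart[of x i], of "\<bar>\<phi>1 (norm x)\<bar> / norm x"]
      by (cases "x = 0") (auto simp: partial_radial abs_mult)
    have "(partial i (\<lambda>x :: real^'n. \<phi> (norm x)) \<longlongrightarrow> 0) (at 0)"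
      by (rule Lim_null_comparison[OF always_eventually[OF allI[OF bd]] lim])
    then show ?thesis using True by (simp add: isCont_def partial_radial)
  next
    case False
    then show ?thesis using has_derivative_continuous[OF has_derivative_partial] by blast
  qed
  then show ?thesis by (simp add: continuous_at_imp_continuous_on)
qed

lemma Ck_on_1: "Ck_on 1 UNIV (\<lambda>x :: real^'n. \<phi> (norm x))"
  unfolding Ck_on_1_iff using differentiable continuous_on_partial by auto

lemma partial_partial_bound:
  fixes x :: "real^'n"
  assumes "x \<noteq> 0"
  shows "\<bar>partial j (partial i (\<lambda>x. \<phi> (norm x))) x - (if i = j then \<phi>1 (norm x) / norm x else 0)\<bar>
    \<le> \<bar>\<phi>2 (norm x) - \<phi>1 (norm x) / norm x\<bar>"
proof -
  let ?c = "\<phi>2 (norm x) - \<phi>1 (norm x) / norm x"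
  have "\<bar>x $ i * x $ j\<bar> \<le> norm x * norm x"
    unfolding abs_mult using component_le_norm_cart by (intro mult_mono) auto
  then have "\<bar>?c\<bar> * (\<bar>x $ i * x $ j\<bar> / (norm x)\<^sup>2) \<le> \<bar>?c\<bar> * 1"
    using assms by (intro mult_left_mono) (auto simp: divide_le_eq power2_eq_square)
  moreover have "partial j (partial i (\<lambda>x. \<phi> (norm x))) x - (if i = j then \<phi>1 (norm x) / norm x else 0)
      = ?c * (x $ i * x $ j / (norm x)\<^sup>2)"
    using assms by (simp add: partial_partial_radial radial_jac_def outer_def mat_def)
  ultimately show ?thesis by (simp add: abs_mult)
qed

lemma Ck_on_2:
  assumes a0: "((\<lambda>r. \<phi>1 r / r) \<longlongrightarrow> a0) (at_right 0)"
    and z: "((\<lambda>r. \<phi>2 r - \<phi>1 r / r) \<longlongrightarrow> 0) (at_right 0)"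
  shows "Ck_on 2 UNIV (\<lambda>x :: real^'n. \<phi> (norm x))"
proof -
  let ?u = "\<lambda>x :: real^'n. \<phi> (norm x)"
  have a0': "((\<lambda>x :: real^'n. \<phi>1 (norm x) / norm x) \<longlongrightarrow> a0) (at 0)"
    using filterlim_compose[OF a0 filterlim_norm_at_right] .
  have z': "((\<lambda>x :: real^'n. \<phi>2 (norm x) - \<phi>1 (norm x) / norm x) \<longlongrightarrow> 0) (at 0)"
    using filterlim_compose[OF z filterlim_norm_at_right] .
  have D0: "(partial i ?u has_derivative (\<lambda>h. a0 * h $ i)) (at 0)" for i
    unfolding has_derivative_at_alt
  proof (intro conjI allI impI)
    show "bounded_linear (\<lambda>h :: real^'n. a0 * h $ i)"
      by (intro bounded_linear_const_mult bounded_linear_vec_nth)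
    fix e :: real assume e: "e > 0"
    then obtain d where d: "d > 0" "\<And>x :: real^'n. x \<noteq> 0 \<Longrightarrow> norm x < d \<Longrightarrow> \<bar>\<phi>1 (norm x) / norm x - a0\<bar> < e"
      using a0'[THEN tendstoD, OF e] unfolding eventually_at by (auto simp: dist_real_def)
    have "norm (partial i ?u y - partial i ?u 0 - a0 * (y - 0) $ i) \<le> e * norm (y - 0)" if "norm (y - 0) < d" for y
    proof (cases "y = 0")
      case False
      then have "\<bar>\<phi>1 (norm y) / norm y - a0\<bar> * \<bar>y $ i\<bar> \<le> e * norm y"
        using d(2)[of y] that component_le_norm_cart[of y i] by (intro mult_mono) auto
      then show ?thesis by (simp add: partial_radial abs_mult[symmetric] left_diff_distrib)
    qed (simp add: partial_radial)
    then show "\<exists>d>0. \<forall>y. norm (y - 0) < d \<longrightarrow> norm (partial i ?u y - partial i ?u 0 - a0 * (y - 0) $ i) \<le> e * norm (y - 0)"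
      using d(1) by blast
  qed
  have diff: "partial i ?u differentiable (at x)" for i x
    using D0[of i] has_derivative_partial[of x i] by (cases "x = 0") (auto intro: differentiableI)
  have "isCont (partial j (partial i ?u)) x" for i j x
  proof (cases "x = 0")
    case True
    have P0: "partial j (partial i ?u) 0 = (if i = j then a0 else 0)"
      using partial_eqI[OF D0] by (auto simp: axis_def)
    have "((\<lambda>x. partial j (partial i ?u) x - (if i = j then \<phi>1 (norm x) / norm x else 0)) \<longlongrightarrow> 0) (at 0)"
      using partial_partial_bound[of _ j i]
      by (intro Lim_null_comparison[OF _ tendsto_rabs_zero[OF z']]) (auto simp: eventually_at_filter)
    moreover have "((\<lambda>x :: real^'n. if i = j then \<phi>1 (norm x) / norm x else 0) \<longlongrightarrow> (if i = j then a0 else 0)) (at 0)"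
      using a0' by auto
    ultimately have "((\<lambda>x. partial j (partial i ?u) x - (if i = j then \<phi>1 (norm x) / norm x else 0)
        + (if i = j then \<phi>1 (norm x) / norm x else 0)) \<longlongrightarrow> 0 + (if i = j then a0 else 0)) (at 0)"
      by (rule tendsto_add)
    then show ?thesis using True P0 by (simp add: isCont_def)
  next
    case False
    then show ?thesis using continuous_on_partial_partial[of j i]
      by (simp add: continuous_on_eq_continuous_at open_delete)
  qed
  then show ?thesis unfolding Ck_on_2_iff
    by (intro conjI ballI allI differentiable diff continuous_at_imp_continuous_on) simp
qed

end

text \<open>Both products that occur in \<open>S_k\<close> of a radial function, with the factor \<open>r^(k \<alpha>) y^(k \<beta>)\<close> of the
  equation taken out; \<open>y\<close> stands for \<open>\<phi>'\<close> and \<open>z\<close> for \<open>\<phi>''\<close>.\<close>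

lemma radial_product_powers:
  fixes k :: nat
  assumes k: "1 \<le> k" and y: "y > 0" and r: "r > 0"
  shows "((p - 1) * y powr (p - 2) * z) * (y powr (p - 1) / r) ^ (k - 1)
      = r powr (real k * \<alpha>) * y powr (real k * \<beta>) *
        ((p - 1) * (y powr (real k * (p - 1 - \<beta>) - 1) * z) * r powr (1 - real k * (\<alpha> + 1)))"
    and "(y powr (p - 1) / r) ^ k = r powr (real k * \<alpha>) * y powr (real k * \<beta>) *
        (y powr (real k * (p - 1 - \<beta>)) * r powr (- (real k * (\<alpha> + 1))))"
proof -
  have pw: "(y powr (p - 1) / r) ^ m = y powr (real m * (p - 1)) * r powr (- real m)" for m
  proof -
    have "(y powr (p - 1)) ^ m = y powr (real m * (p - 1))"
      using y by (simp add: powr_realpow[symmetric] powr_powr mult.commute)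
    moreover have "r powr (- real m) = inverse (r ^ m)" using r by (simp add: powr_minus powr_realpow)
    ultimately show ?thesis by (simp only: divide_inverse power_mult_distrib power_inverse)
  qed
  have k1: "real (k - 1) = real k - 1" using k by (simp add: of_nat_diff)
  have e1: "y powr (p - 2) * y powr ((real k - 1) * (p - 1)) = y powr (real k * \<beta>) * y powr (real k * (p - 1 - \<beta>) - 1)"
    unfolding powr_add[symmetric] by (rule arg_cong[of _ _ "(powr) y"]) (simp add: algebra_simps)
  have e2: "r powr (- (real k - 1)) = r powr (real k * \<alpha>) * r powr (1 - real k * (\<alpha> + 1))"
    unfolding powr_add[symmetric] by (rule arg_cong[of _ _ "(powr) r"]) (simp add: algebra_simps)
  have "((p - 1) * y powr (p - 2) * z) * (y powr (p - 1) / r) ^ (k - 1)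
     = (p - 1) * z * (y powr (p - 2) * y powr ((real k - 1) * (p - 1))) * r powr (- (real k - 1))"
    unfolding pw k1 by (simp only: mult_ac)
  then show "((p - 1) * y powr (p - 2) * z) * (y powr (p - 1) / r) ^ (k - 1)
      = r powr (real k * \<alpha>) * y powr (real k * \<beta>) *
        ((p - 1) * (y powr (real k * (p - 1 - \<beta>) - 1) * z) * r powr (1 - real k * (\<alpha> + 1)))"
    unfolding e1 e2 by (simp only: mult_ac)
  have e3: "y powr (real k * (p - 1)) = y powr (real k * \<beta>) * y powr (real k * (p - 1 - \<beta>))"
    unfolding powr_add[symmetric] by (rule arg_cong[of _ _ "(powr) y"]) (simp add: algebra_simps)
  have e4: "r powr (- real k) = r powr (real k * \<alpha>) * r powr (- (real k * (\<alpha> + 1)))"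
    unfolding powr_add[symmetric] by (rule arg_cong[of _ _ "(powr) r"]) (simp add: algebra_simps)
  show "(y powr (p - 1) / r) ^ k = r powr (real k * \<alpha>) * y powr (real k * \<beta>) *
        (y powr (real k * (p - 1 - \<beta>)) * r powr (- (real k * (\<alpha> + 1))))"
    unfolding pw e3 e4 by (simp only: mult_ac)
qed

text \<open>The solution normalised by \<open>\<psi> 0 = 0\<close>. With the cut-off at \<open>b = 0\<close> the full right-hand side \<open>w\<close> is present
  exactly where \<open>\<psi> \<ge> 0\<close>.\<close>

lemma (in separable_ode) entire_ode_solution:
  assumes b: "b = 0" and div: "integral_diverges (\<lambda>t. G t powr (- (1 / (a + 1))))"
  shows "\<exists>\<psi> E E1. (\<forall>y. (\<psi> has_real_derivative E y) (at y)) \<and> (\<forall>y. (E has_real_derivative E1 y) (at y))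
    \<and> continuous_on UNIV E1 \<and> (\<forall>y. E y \<ge> 1) \<and> (\<forall>y. E1 y \<ge> 0) \<and> (\<forall>y\<le>0. \<psi> y \<le> 0)
    \<and> (\<forall>y\<ge>0. E y powr (a - 1) * E1 y = w (\<psi> y) / (a + 1))"
proof -
  have surj: "\<exists>s. y = T s" for y
  proof -
    obtain s t where "T s \<le> y" "y \<le> T t" using T_unbounded_below T_unbounded_above[OF _ div] b by blast
    then show ?thesis using range_T_interval by blast
  qed
  define \<psi> where "\<psi> y = \<Psi> (T 0 + y)" for y
  have T\<psi>: "T (\<psi> y) = T 0 + y" for y using surj[of "T 0 + y"] \<Psi>_T unfolding \<psi>_def by auto
  have d: "(\<psi> has_real_derivative H (\<psi> y)) (at y)" for y
  proof -
    obtain s where s: "T 0 + y = T s" using surj by blast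
    have "(\<Psi> has_real_derivative H s) (at (T 0 + y))" unfolding s by (rule \<Psi>_deriv)
    then have "((\<lambda>y. \<Psi> (T 0 + y)) has_real_derivative H s * 1) (at y)"
      by (rule DERIV_chain2[where g = "\<lambda>y. T 0 + y"]) (auto intro!: derivative_eq_intros)
    then have "(\<psi> has_real_derivative H s) (at y)" unfolding \<psi>_def by simp
    moreover have "s = \<psi> y" unfolding \<psi>_def s \<Psi>_T ..
    ultimately show ?thesis by simp
  qed
  have cont: "continuous_on UNIV \<psi>" using d by (meson DERIV_isCont continuous_at_imp_continuous_on)
  have dE: "((\<lambda>y. H (\<psi> y)) has_real_derivative H1 (\<psi> y) * H (\<psi> y)) (at y)" for y
    by (rule DERIV_chain2[OF H_deriv d])
  have le: "\<psi> y \<le> 0" if "y \<le> 0" for y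
    using T\<psi>[of y] T_less_iff[of 0 "\<psi> y"] that by auto
  have ge: "\<psi> y \<ge> 0" if "y \<ge> 0" for y
    using T\<psi>[of y] T_less_iff[of "\<psi> y" 0] that by auto
  have "H (\<psi> y) powr (a - 1) * (H1 (\<psi> y) * H (\<psi> y)) = w (\<psi> y) / (a + 1)" if "y \<ge> 0" for y
  proof -
    have "H (\<psi> y) powr (a - 1) * (H1 (\<psi> y) * H (\<psi> y)) = (H (\<psi> y) powr (a - 1) * H (\<psi> y) powr 1) * H1 (\<psi> y)"
      using H_pos[of "\<psi> y"] by simp
    also have "\<dots> = H (\<psi> y) powr a * H1 (\<psi> y)" unfolding powr_add[symmetric] by simp
    finally have "H (\<psi> y) powr (a - 1) * (H1 (\<psi> y) * H (\<psi> y)) = ramp b (\<psi> y) * w (\<psi> y) / (a + 1)"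
      unfolding H_power_H1 .
    moreover have "ramp b (\<psi> y) = 1" using ge[OF that] b by (intro ramp(3)) simp
    ultimately show ?thesis by (simp only: mult_1)
  qed
  note pow = this
  have c1: "continuous_on UNIV (\<lambda>y. H1 (\<psi> y) * H (\<psi> y))"
    by (intro continuous_on_mult continuous_on_compose2[OF H1_cont[of UNIV] cont]
        continuous_on_compose2[OF H_cont[of UNIV] cont]) auto
  have nn: "H1 (\<psi> y) * H (\<psi> y) \<ge> 0" for y
    by (intro mult_nonneg_nonneg H1_nonneg less_imp_le[OF H_pos])
  show ?thesis
    by (rule exI[of _ \<psi>], rule exI[of _ "\<lambda>y. H (\<psi> y)"], rule exI[of _ "\<lambda>y. H1 (\<psi> y) * H (\<psi> y)"])
      (intro conjI allI impI d dE c1 H_ge_1 nn le pow)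
qed

text \<open>The substitution \<open>\<psi>(\<tau> + \<Lambda> r^(1+\<sigma>))\<close>; the functions \<open>prof1\<close> and \<open>prof2\<close> below are its
  first two derivatives.\<close>

locale power_profile =
  fixes \<psi> E E1 :: "real \<Rightarrow> real" and \<tau> \<Lambda> \<sigma> :: real
  assumes \<psi>_deriv: "\<And>y. (\<psi> has_real_derivative E y) (at y)" and E_deriv: "\<And>y. (E has_real_derivative E1 y) (at y)"
    and E1_cont: "continuous_on UNIV E1" and \<sigma>: "\<sigma> > 0"
begin

definition "\<mu> = \<Lambda> * (1 + \<sigma>)"
definition "\<rho> r = \<tau> + \<Lambda> * r powr (1 + \<sigma>)"
definition "prof r = \<psi> (\<rho> r)"
definition "prof1 r = \<mu> * r powr \<sigma> * E (\<rho> r)"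
definition "prof2 r = \<mu> * \<sigma> * r powr (\<sigma> - 1) * E (\<rho> r) + \<mu>\<^sup>2 * r powr (2 * \<sigma>) * E1 (\<rho> r)"

lemma \<rho>_cont: "continuous_on {0..} \<rho>"
  unfolding \<rho>_def using \<sigma> by (intro continuous_intros continuous_on_powr') auto

lemma \<psi>_cont: "continuous_on A \<psi>" and E_cont: "continuous_on A E" and E1_cont': "continuous_on A E1"
  using \<psi>_deriv E_deriv by (meson DERIV_isCont continuous_at_imp_continuous_on,
    meson E_deriv DERIV_isCont continuous_at_imp_continuous_on, meson E1_cont continuous_on_subset subset_UNIV)

lemma \<rho>_deriv: "r > 0 \<Longrightarrow> (\<rho> has_real_derivative \<mu> * r powr \<sigma>) (at r)"
  unfolding \<rho>_def \<mu>_def by (auto intro!: derivative_eq_intros)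

lemma prof_deriv: "r > 0 \<Longrightarrow> (prof has_real_derivative prof1 r) (at r)"
  using DERIV_chain2[OF \<psi>_deriv \<rho>_deriv] unfolding prof_def prof1_def by (simp add: mult_ac)

lemma prof1_deriv:
  assumes r: "r > 0"
  shows "(prof1 has_real_derivative prof2 r) (at r)"
proof -
  have "((\<lambda>r. \<mu> * r powr \<sigma> * E (\<rho> r)) has_real_derivative
     (\<mu> * (\<sigma> * r powr (\<sigma> - 1)) * E (\<rho> r) + (E1 (\<rho> r) * (\<mu> * r powr \<sigma>)) * (\<mu> * r powr \<sigma>))) (at r)"
    by (intro DERIV_mult DERIV_cmult has_real_derivative_powr r DERIV_chain2[OF E_deriv \<rho>_deriv])
  moreover have sq: "r powr (2 * \<sigma>) = r powr \<sigma> * r powr \<sigma>" by (simp flip: powr_add)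
  ultimately show ?thesis unfolding prof1_def prof2_def sq by (simp add: power2_eq_square mult_ac)
qed

lemma \<rho>_at_right: "(\<rho> \<longlongrightarrow> \<tau>) (at_right 0)"
proof -
  have "(\<rho> \<longlongrightarrow> \<rho> 0) (at 0 within {0..})"
    using \<rho>_cont unfolding continuous_on_def by (rule bspec) simp
  then have "(\<rho> \<longlongrightarrow> \<rho> 0) (at_right 0)" by (rule tendsto_within_subset) auto
  then show ?thesis using \<sigma> by (simp add: \<rho>_def)
qed

lemma E_at_right: "((\<lambda>r. E (\<rho> r)) \<longlongrightarrow> E \<tau>) (at_right 0)" "((\<lambda>r. E1 (\<rho> r)) \<longlongrightarrow> E1 \<tau>) (at_right 0)"
  using E_cont[of UNIV] E1_cont \<rho>_at_right
  by (auto intro!: isCont_tendsto_compose[OF _ \<rho>_at_right] simp: continuous_on_eq_continuous_at)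

lemma powr_at_right: "s > 0 \<Longrightarrow> ((\<lambda>r. r powr s) \<longlongrightarrow> 0) (at_right (0::real))"
proof -
  assume s: "s > 0"
  have "continuous_on {0..} (\<lambda>r::real. r powr s)" using s by (intro continuous_on_powr') (auto intro: continuous_intros)
  then have "((\<lambda>r::real. r powr s) \<longlongrightarrow> 0 powr s) (at 0 within {0..})"
    unfolding continuous_on_def by (rule bspec) simp
  then have "((\<lambda>r::real. r powr s) \<longlongrightarrow> 0 powr s) (at_right 0)" by (rule tendsto_within_subset) auto
  then show ?thesis using s by simp
qed

sublocale radial_profile prof prof1 prof2
proof
  show "continuous_on {0<..} prof2"
    unfolding prof2_def
    by (intro continuous_intros continuous_on_compose2[OF E_cont[of UNIV]] continuous_on_compose2[OF E1_cont]
        continuous_on_subset[OF \<rho>_cont]) auto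
  show "continuous_on {0..} prof"
    unfolding prof_def by (rule continuous_on_compose2[OF \<psi>_cont[of UNIV] \<rho>_cont]) auto
  show "(prof1 \<longlongrightarrow> 0) (at_right 0)"
    unfolding prof1_def using tendsto_mult[OF tendsto_mult[OF tendsto_const powr_at_right[OF \<sigma>]] E_at_right(1)] by simp
qed (auto intro: prof_deriv prof1_deriv)

lemma prof1_div: "r > 0 \<Longrightarrow> prof1 r / r = \<mu> * r powr (\<sigma> - 1) * E (\<rho> r)"
  by (simp add: prof1_def powr_diff)

lemma prof2_diff: "r > 0 \<Longrightarrow> prof2 r - prof1 r / r = \<mu> * (\<sigma> - 1) * r powr (\<sigma> - 1) * E (\<rho> r) + \<mu>\<^sup>2 * r powr (2 * \<sigma>) * E1 (\<rho> r)"
  unfolding prof1_div prof2_def by (simp add: algebra_simps)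

text \<open>For \<open>\<sigma> > 1\<close> the quotient \<open>\<phi>' / r\<close> tends to \<open>0\<close>, for \<open>\<sigma> = 1\<close> to \<open>\<mu> E(\<tau>)\<close>. In both cases
  \<open>\<phi>'' - \<phi>' / r\<close> tends to \<open>0\<close>, since its leading term carries the factor \<open>\<sigma> - 1\<close>.\<close>

lemma Ck_on_2_prof:
  assumes "\<sigma> \<ge> 1"
  shows "Ck_on 2 UNIV (\<lambda>x :: real^'n. prof (norm x))"
proof -
  have lim: "((\<lambda>r. c * r powr (\<sigma> - 1) * E (\<rho> r)) \<longlongrightarrow> (if \<sigma> = 1 then c * E \<tau> else 0)) (at_right 0)" for c
  proof (cases "\<sigma> = 1")
    case True
    have "((\<lambda>r. c * E (\<rho> r)) \<longlongrightarrow> c * E \<tau>) (at_right 0)" by (intro tendsto_intros E_at_right)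
    then have "((\<lambda>r. c * r powr (\<sigma> - 1) * E (\<rho> r)) \<longlongrightarrow> c * E \<tau>) (at_right 0)"
      by (rule Lim_transform_eventually) (auto simp: True eventually_at_filter)
    then show ?thesis using True by simp
  next
    case False
    then have "\<sigma> - 1 > 0" using assms by simp
    from tendsto_mult[OF tendsto_mult[OF tendsto_const powr_at_right[OF this]] E_at_right(1)]
    show ?thesis using False by simp
  qed
  have 1: "((\<lambda>r. prof1 r / r) \<longlongrightarrow> (if \<sigma> = 1 then \<mu> * E \<tau> else 0)) (at_right 0)"
    using lim[of \<mu>] by (rule Lim_transform_eventually) (auto simp: prof1_div eventually_at_filter)
  have "((\<lambda>r. \<mu> * (\<sigma> - 1) * r powr (\<sigma> - 1) * E (\<rho> r) + \<mu>\<^sup>2 * r powr (2 * \<sigma>) * E1 (\<rho> r)) \<longlongrightarrow>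
     (if \<sigma> = 1 then \<mu> * (\<sigma> - 1) * E \<tau> else 0) + \<mu>\<^sup>2 * 0 * E1 \<tau>) (at_right 0)"
    using \<sigma> by (intro tendsto_add lim tendsto_mult tendsto_const powr_at_right E_at_right(2)) auto
  then have "((\<lambda>r. \<mu> * (\<sigma> - 1) * r powr (\<sigma> - 1) * E (\<rho> r) + \<mu>\<^sup>2 * r powr (2 * \<sigma>) * E1 (\<rho> r)) \<longlongrightarrow> 0) (at_right 0)"
    by (auto split: if_splits)
  then have "((\<lambda>r. prof2 r - prof1 r / r) \<longlongrightarrow> 0) (at_right 0)"
    by (rule Lim_transform_eventually) (auto simp: prof2_diff eventually_at_filter)
  from Ck_on_2[OF 1 this] show ?thesis .
qed

end


section \<open>Local Sobolev regularity across an isolated singularity\<close>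

lemma has_integral_abs_powr:
  assumes "0 \<le> \<tau>" "\<tau> < 1"
  shows "((\<lambda>t. \<bar>t\<bar> powr (- \<tau>)) has_integral 2 / (1 - \<tau>)) {-1..1::real}"
proof -
  have "((\<lambda>t. t powr (- \<tau>)) has_integral (1 powr (- \<tau> + 1) / (- \<tau> + 1))) {0..1::real}"
    using assms by (intro has_integral_powr_from_0) auto
  then have "((\<lambda>t. t powr (- \<tau>)) has_integral 1 / (1 - \<tau>)) {0..1::real}" by simp
  then have 1: "((\<lambda>t. \<bar>t\<bar> powr (- \<tau>)) has_integral 1 / (1 - \<tau>)) {0..1::real}"
    by (rule has_integral_eq[rotated]) simp
  then have "((\<lambda>t. \<bar>- t\<bar> powr (- \<tau>)) has_integral 1 / (1 - \<tau>)) {-1..-0::real}"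
    by (subst has_integral_reflect_real) simp
  then have 2: "((\<lambda>t. \<bar>t\<bar> powr (- \<tau>)) has_integral 1 / (1 - \<tau>)) {-1..0::real}" by simp
  show ?thesis using has_integral_combine[OF _ _ 2 1] by simp
qed

text \<open>The value at \<open>0\<close> is infinite, in contrast to that of \<^const>\<open>powr\<close>, so that \<open>|x|^(-\<tau>)\<close> is bounded by this
  function of one coordinate of \<open>x\<close> everywhere.\<close>

definition abs_powr_top :: "real \<Rightarrow> real \<Rightarrow> ennreal" where
  "abs_powr_top \<tau> t = (if t = 0 then top else ennreal (\<bar>t\<bar> powr (- \<tau>)))"

lemma abs_powr_top_measurable [measurable]: "abs_powr_top \<tau> \<in> borel_measurable borel"
  unfolding abs_powr_top_def by measurable

lemma nn_integral_abs_powr_top_unit: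
  assumes \<tau>: "0 \<le> \<tau>" "\<tau> < 1"
  shows "(\<integral>\<^sup>+s. indicator {0..1} s * abs_powr_top \<tau> (t + s) \<partial>lborel) \<le> ennreal (2 / (1 - \<tau>) + 1)"
proof -
  have "(\<integral>\<^sup>+s. indicator {0..1} s * abs_powr_top \<tau> (t + s) \<partial>lborel) = (\<integral>\<^sup>+s. indicator {0..1} (s - t) * abs_powr_top \<tau> s \<partial>lborel)"
    by (subst nn_integral_real_affine[of _ 1 t]) (auto simp: one_ennreal_def[symmetric])
  also have "\<dots> \<le> (\<integral>\<^sup>+s. abs_powr_top \<tau> s * indicator {-1..1} s + indicator {t..t + 1} s \<partial>lborel)"
  proof (rule nn_integral_mono)
    fix s
    have "abs_powr_top \<tau> s \<le> 1" if "\<bar>s\<bar> > 1"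
    proof -
      have "\<bar>s\<bar> powr (- \<tau>) \<le> 1 powr (- \<tau>)" using that \<tau> by (intro powr_mono2') auto
      then show ?thesis using that by (auto simp: abs_powr_top_def)
    qed
    then show "indicator {0..1} (s - t) * abs_powr_top \<tau> s \<le> abs_powr_top \<tau> s * indicator {-1..1} s + indicator {t..t + 1} s"
      by (cases "\<bar>s\<bar> \<le> 1") (auto simp: indicator_def abs_le_iff)
  qed
  also have "\<dots> = (\<integral>\<^sup>+s. abs_powr_top \<tau> s * indicator {-1..1} s \<partial>lborel) + 1"
    by (subst nn_integral_add) auto
  also have "(\<integral>\<^sup>+s. abs_powr_top \<tau> s * indicator {-1..1} s \<partial>lborel)
      = (\<integral>\<^sup>+s. ennreal (if s \<in> {-1..1} then \<bar>s\<bar> powr (- \<tau>) else 0) \<partial>lborel)"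
    using AE_lborel_singleton[of "0::real"]
    by (intro nn_integral_cong_AE) (auto elim!: eventually_mono simp: abs_powr_top_def indicator_def)
  also have "\<dots> = ennreal (2 / (1 - \<tau>))"
  proof (rule nn_integral_has_integral_lborel)
    show "((\<lambda>s. if s \<in> {-1..1} then \<bar>s\<bar> powr (- \<tau>) else 0) has_integral 2 / (1 - \<tau>)) UNIV"
      unfolding has_integral_restrict_UNIV by (rule has_integral_abs_powr[OF \<tau>])
  qed auto
  also have "ennreal (2 / (1 - \<tau>)) + 1 = ennreal (2 / (1 - \<tau>) + 1)"
    using \<tau> by (simp add: ennreal_plus[symmetric] del: ennreal_plus flip: ennreal_1)
  finally show ?thesis .
qed

lemma nn_integral_translate:
  fixes g :: "real^'n \<Rightarrow> ennreal"
  assumes [measurable]: "g \<in> borel_measurable borel"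
  shows "(\<integral>\<^sup>+x. g (x + c) \<partial>lborel) = (\<integral>\<^sup>+x. g x \<partial>lborel)"
proof -
  have "(\<integral>\<^sup>+x. g x \<partial>lborel) = (\<integral>\<^sup>+x. g x \<partial>distr lborel borel ((+) c))"
    by (simp add: lborel_distr_plus)
  also have "\<dots> = (\<integral>\<^sup>+x. g (c + x) \<partial>lborel)" by (subst nn_integral_distr) auto
  finally show ?thesis by (simp add: add.commute)
qed

lemma measurable_lborel_pairI:
  "f \<in> borel_measurable (borel \<Otimes>\<^sub>M borel) \<Longrightarrow> f \<in> borel_measurable (lborel \<Otimes>\<^sub>M lborel)"
  using measurable_cong_sets[OF sets_pair_measure_cong[OF sets_lborel sets_lborel] refl] by blast

lemma measurable_vec_nth [measurable]: "(\<lambda>x :: real^'n. x $ i) \<in> borel_measurable borel"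
  by (intro borel_measurable_continuous_onI continuous_intros)

text \<open>For \<open>\<tau> < 1\<close> the singularity of \<open>|x|^(-\<tau>)\<close> is integrable already in one coordinate. Translation invariance lets
  the integral over \<open>x\<close> be averaged over the translates \<open>x + s e\<close> with \<open>0 \<le> s \<le> 1\<close>, and after exchanging
  the integrals the inner one is a one-dimensional integral that is bounded uniformly in \<open>x\<close>.\<close>

lemma nn_integral_norm_powr_finite:
  fixes K :: "(real^'n) set"
  assumes \<tau>: "0 \<le> \<tau>" "\<tau> < 1" and K: "compact K"
  shows "(\<integral>\<^sup>+x. indicator K x * ennreal (norm x powr (- \<tau>)) \<partial>lborel) < \<infinity>"
proof -
  let ?i = "undefined :: 'n"
  let ?e = "axis ?i 1 :: real^'n"
  obtain N where N: "\<And>x. x \<in> K \<Longrightarrow> norm x \<le> N"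
    using compact_imp_bounded[OF K] by (auto simp: bounded_iff)
  define B where "B = (cball 0 N :: (real^'n) set)"
  define B' where "B' = (cball 0 (N + 1) :: (real^'n) set)"
  have B [measurable]: "B \<in> sets borel" "B' \<in> sets borel" by (auto simp: B_def B'_def)
  let ?I = "\<integral>\<^sup>+x. indicator B x * abs_powr_top \<tau> (x $ ?i) \<partial>lborel"
  have "(\<integral>\<^sup>+x. indicator K x * ennreal (norm x powr (- \<tau>)) \<partial>lborel) \<le> ?I"
  proof (intro nn_integral_mono mult_mono)
    fix x
    show "ennreal (norm x powr (- \<tau>)) \<le> abs_powr_top \<tau> (x $ ?i)"
      using component_le_norm_cart[of x ?i] \<tau> by (auto simp: abs_powr_top_def intro!: ennreal_leI powr_mono2')
  qed (auto simp: indicator_def B_def N)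
  also have "?I = (\<integral>\<^sup>+s. indicator {0..1} s * ?I \<partial>(lborel :: real measure))"
    by (subst nn_integral_multc) simp_all
  also have "\<dots> = (\<integral>\<^sup>+s. (\<integral>\<^sup>+x. indicator {0..1} s * (indicator B (x + s *\<^sub>R ?e) * abs_powr_top \<tau> ((x + s *\<^sub>R ?e) $ ?i)) \<partial>lborel) \<partial>(lborel :: real measure))"
  proof (rule nn_integral_cong)
    fix s :: real
    have "?I = (\<integral>\<^sup>+x. indicator B (x + s *\<^sub>R ?e) * abs_powr_top \<tau> ((x + s *\<^sub>R ?e) $ ?i) \<partial>lborel)"
      by (rule nn_integral_translate[symmetric]) measurable
    then show "indicator {0..1} s * ?I
        = (\<integral>\<^sup>+x. indicator {0..1} s * (indicator B (x + s *\<^sub>R ?e) * abs_powr_top \<tau> ((x + s *\<^sub>R ?e) $ ?i)) \<partial>lborel)"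
      by (subst nn_integral_cmult) simp_all
  qed
  also have "\<dots> \<le> (\<integral>\<^sup>+s. (\<integral>\<^sup>+x. indicator {0..1} s * (indicator B' x * abs_powr_top \<tau> (x $ ?i + s)) \<partial>lborel) \<partial>(lborel :: real measure))"
  proof (intro nn_integral_mono)
    fix s :: real and x :: "real^'n"
    show "indicator {0..1} s * (indicator B (x + s *\<^sub>R ?e) * abs_powr_top \<tau> ((x + s *\<^sub>R ?e) $ ?i))
      \<le> indicator {0..1} s * (indicator B' x * abs_powr_top \<tau> (x $ ?i + s))"
    proof (cases "s \<in> {0..1} \<and> x + s *\<^sub>R ?e \<in> B")
      case True
      have "norm x \<le> norm (x + s *\<^sub>R ?e) + norm (s *\<^sub>R ?e)"
        using norm_triangle_ineq4[of "x + s *\<^sub>R ?e" "s *\<^sub>R ?e"] by simp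
      also have "\<dots> \<le> N + 1" using True by (intro add_mono) (auto simp: B_def norm_axis_1)
      finally show ?thesis using True by (auto simp: B'_def)
    qed (auto simp: indicator_def)
  qed
  also have "\<dots> = (\<integral>\<^sup>+x. (\<integral>\<^sup>+s. indicator {0..1} s * (indicator B' x * abs_powr_top \<tau> (x $ ?i + s)) \<partial>lborel) \<partial>(lborel :: (real^'n) measure))"
    by (rule lborel_pair.Fubini', rule measurable_lborel_pairI) (unfold split_beta', measurable)
  also have "\<dots> = (\<integral>\<^sup>+x. indicator B' x * (\<integral>\<^sup>+s. indicator {0..1} s * abs_powr_top \<tau> (x $ ?i + s) \<partial>lborel) \<partial>(lborel :: (real^'n) measure))"
    by (simp add: nn_integral_cmult[symmetric] mult_ac)
  also have "\<dots> \<le> (\<integral>\<^sup>+x. indicator B' x * ennreal (2 / (1 - \<tau>) + 1) \<partial>(lborel :: (real^'n) measure))"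
    by (intro nn_integral_mono mult_left_mono nn_integral_abs_powr_top_unit[OF \<tau>]) auto
  also have "\<dots> = ennreal (2 / (1 - \<tau>) + 1) * emeasure lborel B'"
    by (simp add: nn_integral_multc mult.commute)
  also have "\<dots> < \<infinity>"
    unfolding B'_def using emeasure_lborel_cball_finite[of "0 :: real^'n" "N + 1"]
    by (simp add: ennreal_mult_less_top)
  finally show ?thesis .
qed

lemma set_integrable_singular:
  fixes h :: "real^'n \<Rightarrow> real"
  assumes cont: "continuous_on (UNIV - {0}) h" and \<tau>: "0 \<le> \<tau>" "\<tau> < 1"
    and bound: "\<And>x. x \<noteq> 0 \<Longrightarrow> norm x \<le> 1 \<Longrightarrow> \<bar>h x\<bar> \<le> C * norm x powr (- \<tau>)" and K: "compact K"
  shows "integrable lborel (\<lambda>x. indicator K x * h x)" and "h \<in> borel_measurable borel"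
proof -
  show meas [measurable]: "h \<in> borel_measurable borel"
    by (rule borel_measurable_continuous_countable_exceptions[of "{0}"])
      (use cont in \<open>auto simp: Compl_eq_Diff_UNIV\<close>)
  have Km [measurable]: "K \<in> sets borel" using K by (simp add: compact_imp_closed)
  have "compact (h ` (K - ball 0 1))"
    using K by (intro compact_continuous_image continuous_on_subset[OF cont] compact_diff) auto
  then obtain M where M: "\<And>x. x \<in> K - ball 0 1 \<Longrightarrow> \<bar>h x\<bar> \<le> M"
    by (force simp: bounded_iff dest!: compact_imp_bounded)
  define D where "D = \<bar>M\<bar> + \<bar>h 0\<bar>"
  have le: "\<bar>h x\<bar> \<le> \<bar>C\<bar> * norm x powr (- \<tau>) + D" if "x \<in> K" for x
  proof (cases "x \<in> ball 0 1 \<and> x \<noteq> 0")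
    case True
    have "\<bar>h x\<bar> \<le> C * norm x powr (- \<tau>)" using bound[of x] True by auto
    also have "\<dots> \<le> \<bar>C\<bar> * norm x powr (- \<tau>)" by (intro mult_right_mono) auto
    finally show ?thesis by (simp add: D_def)
  next
    case False
    then have "\<bar>h x\<bar> \<le> D" using M[of x] that by (cases "x = 0") (auto simp: D_def)
    moreover have "\<bar>C\<bar> * norm x powr (- \<tau>) \<ge> 0" by simp
    ultimately show ?thesis by linarith
  qed
  show "integrable lborel (\<lambda>x. indicator K x * h x)"
  proof (rule integrableI_bounded)
    have "(\<integral>\<^sup>+x. ennreal (norm (indicator K x * h x)) \<partial>lborel)
       \<le> (\<integral>\<^sup>+x. ennreal \<bar>C\<bar> * (indicator K x * ennreal (norm x powr (- \<tau>))) + ennreal D * indicator K x \<partial>lborel)"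
      using le by (intro nn_integral_mono)
        (auto simp: indicator_def ennreal_mult'[symmetric] ennreal_plus[symmetric] D_def simp del: ennreal_plus intro!: ennreal_leI)
    also have "\<dots> = ennreal \<bar>C\<bar> * (\<integral>\<^sup>+x. indicator K x * ennreal (norm x powr (- \<tau>)) \<partial>lborel) + ennreal D * emeasure lborel K"
      by (simp add: nn_integral_add nn_integral_cmult)
    also have "\<dots> < \<infinity>"
      using nn_integral_norm_powr_finite[OF \<tau> K] emeasure_compact_finite[OF K]
      by (simp add: ennreal_mult_less_top)
    finally show "(\<integral>\<^sup>+x. ennreal (norm (indicator K x * h x)) \<partial>lborel) < \<infinity>" .
  qed measurable
qed

lemma L_loc_singular:
  fixes h :: "real^'n \<Rightarrow> real"
  assumes cont: "continuous_on (UNIV - {0}) h" and s: "0 \<le> s" and \<delta>: "0 < \<delta>" "\<delta> * s < 1"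
    and bound: "\<And>x. x \<noteq> 0 \<Longrightarrow> norm x \<le> 1 \<Longrightarrow> \<bar>h x\<bar> \<le> C * norm x powr (- s)"
  shows "L_loc \<delta> h"
  unfolding L_loc_def
proof (intro conjI allI impI)
  have c: "continuous_on (UNIV - {0}) (\<lambda>x. \<bar>h x\<bar> powr \<delta>)"
    using \<delta> by (intro continuous_on_powr' continuous_intros cont) auto
  have b: "\<bar>\<bar>h x\<bar> powr \<delta>\<bar> \<le> \<bar>C\<bar> powr \<delta> * norm x powr (- (\<delta> * s))" if x: "x \<noteq> 0" "norm x \<le> 1" for x
  proof -
    have "\<bar>h x\<bar> \<le> C * norm x powr (- s)" using bound[OF x] .
    also have "\<dots> \<le> \<bar>C\<bar> * norm x powr (- s)" by (intro mult_right_mono) auto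
    finally have "\<bar>h x\<bar> powr \<delta> \<le> (\<bar>C\<bar> * norm x powr (- s)) powr \<delta>" using \<delta> by (intro powr_mono2) auto
    also have "\<dots> = \<bar>C\<bar> powr \<delta> * norm x powr (- (\<delta> * s))" by (simp add: powr_mult powr_powr mult.commute)
    finally show ?thesis by simp
  qed
  have m: "h \<in> borel_measurable borel"
    by (rule borel_measurable_continuous_countable_exceptions[of "{0}"])
      (use cont in \<open>auto simp: Compl_eq_Diff_UNIV\<close>)
  then show "h \<in> borel_measurable lebesgue" by (intro measurable_completion) simp
  fix K :: "(real^'n) set" assume K: "compact K"
  have ds: "0 \<le> \<delta> * s" using \<delta> s by simp
  have i: "integrable lborel (\<lambda>x. indicator K x * \<bar>h x\<bar> powr \<delta>)"
    by (rule set_integrable_singular(1)[OF c ds \<delta>(2) b K])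
  show "set_integrable lebesgue K (\<lambda>x. \<bar>h x\<bar> powr \<delta>)"
    unfolding set_integrable_def using i
    by (subst integrable_completion) (auto intro: borel_measurable_integrable)
qed

lemma integral_translate:
  fixes g :: "real^'n \<Rightarrow> real"
  assumes [measurable]: "g \<in> borel_measurable borel"
  shows "(\<integral>x. g (x + c) \<partial>lborel) = (\<integral>x. g x \<partial>lborel)"
proof -
  have "(\<integral>x. g x \<partial>lborel) = (\<integral>x. g x \<partial>distr lborel borel ((+) c))"
    by (simp add: lborel_distr_plus)
  also have "\<dots> = (\<integral>x. g (c + x) \<partial>lborel)" by (subst integral_distr) auto
  finally show ?thesis by (simp add: add.commute)
qed

lemma integrable_translate:
  fixes g :: "real^'n \<Rightarrow> real"
  assumes "integrable lborel g"
  shows "integrable lborel (\<lambda>x. g (x + c))"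
proof -
  have [measurable]: "g \<in> borel_measurable borel" using borel_measurable_integrable[OF assms] by simp
  show ?thesis
    using assms nn_integral_translate[of "\<lambda>x. ennreal (norm (g x))" c]
    by (auto simp: integrable_iff_bounded)
qed

text \<open>The same averaging turns the integral of \<open>g = \<partial>_i F\<close> into that of
  \<open>x \<mapsto> \<integral>\<^sub>0\<^sup>1 g(x + s e) ds = F(x + e) - F(x)\<close>, which vanishes. A line meets the origin at most once, and the
  fundamental theorem of calculus tolerates one exceptional point as \<open>F\<close> is continuous.\<close>

lemma integral_partial_zero:
  fixes F g :: "real^'n \<Rightarrow> real"
  assumes F: "integrable lborel F" "continuous_on UNIV F" and g: "integrable lborel g"
    and d: "\<And>x. x \<noteq> 0 \<Longrightarrow> F differentiable (at x) \<and> partial i F x = g x"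
  shows "(\<integral>x. g x \<partial>lborel) = 0"
proof -
  let ?e = "axis i 1 :: real^'n"
  have [measurable]: "g \<in> borel_measurable borel" using borel_measurable_integrable[OF g] by simp
  have [measurable]: "F \<in> borel_measurable borel" using borel_measurable_integrable[OF F(1)] by simp
  let ?k = "\<lambda>(x :: real^'n) s. indicator {0..1} s * g (x + s *\<^sub>R ?e)"
  have int: "integrable (lborel \<Otimes>\<^sub>M lborel) (case_prod ?k)"
  proof (rule integrableI_bounded)
    show m: "case_prod ?k \<in> borel_measurable (lborel \<Otimes>\<^sub>M lborel)"
      by (rule measurable_lborel_pairI) (unfold split_beta', measurable)
    have "(\<integral>\<^sup>+z. ennreal (norm (case_prod ?k z)) \<partial>(lborel \<Otimes>\<^sub>M lborel))
       = (\<integral>\<^sup>+s. (\<integral>\<^sup>+x. ennreal (norm (?k x s)) \<partial>lborel) \<partial>lborel)"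
      by (subst lborel_pair.nn_integral_snd[symmetric]) (use m in \<open>auto\<close>)
    also have "\<dots> = (\<integral>\<^sup>+s. indicator {0..1} s * (\<integral>\<^sup>+x. ennreal (norm (g x)) \<partial>lborel) \<partial>(lborel :: real measure))"
    proof (rule nn_integral_cong)
      fix s :: real
      have "(\<integral>\<^sup>+x. ennreal (norm (?k x s)) \<partial>lborel) = (\<integral>\<^sup>+x. indicator {0..1} s * ennreal (norm (g (x + s *\<^sub>R ?e))) \<partial>lborel)"
        by (intro nn_integral_cong) (auto simp: indicator_def)
      also have "\<dots> = indicator {0..1} s * (\<integral>\<^sup>+x. ennreal (norm (g (x + s *\<^sub>R ?e))) \<partial>lborel)"
        by (rule nn_integral_cmult) simp
      also have "(\<integral>\<^sup>+x. ennreal (norm (g (x + s *\<^sub>R ?e))) \<partial>lborel) = (\<integral>\<^sup>+x. ennreal (norm (g x)) \<partial>lborel)"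
        by (rule nn_integral_translate) simp
      finally show "(\<integral>\<^sup>+x. ennreal (norm (?k x s)) \<partial>lborel) = indicator {0..1} s * (\<integral>\<^sup>+x. ennreal (norm (g x)) \<partial>lborel)" .
    qed
    also have "\<dots> = (\<integral>\<^sup>+x. ennreal (norm (g x)) \<partial>lborel)" by (simp add: nn_integral_multc)
    also have "\<dots> < \<infinity>" using g by (simp add: integrable_iff_bounded)
    finally show "(\<integral>\<^sup>+z. ennreal (norm (case_prod ?k z)) \<partial>(lborel \<Otimes>\<^sub>M lborel)) < \<infinity>" .
  qed
  have "(\<integral>x. g x \<partial>lborel) = (\<integral>s. indicator {0..1} s * (\<integral>x. g x \<partial>lborel) \<partial>(lborel :: real measure))" by simp
  also have "\<dots> = (\<integral>s. (\<integral>x. ?k x s \<partial>lborel) \<partial>lborel)"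
    by (simp add: integral_translate)
  also have "\<dots> = (\<integral>x. (\<integral>s. ?k x s \<partial>lborel) \<partial>lborel)"
    by (rule lborel_pair.Fubini_integral[OF int])
  also have "\<dots> = (\<integral>x. F (x + ?e) - F x \<partial>lborel)"
  proof (rule integral_cong_AE)
    show "(\<lambda>x. \<integral>s. ?k x s \<partial>lborel) \<in> borel_measurable lborel"
      using lborel_pair.integrable_fst[OF int] by (rule borel_measurable_integrable)
    show "AE x in lborel. (\<integral>s. ?k x s \<partial>lborel) = F (x + ?e) - F x"
      using lborel_pair.AE_integrable_fst[OF int]
    proof eventually_elim
      case (elim x)
      have kk: "(\<lambda>s. if s \<in> {0..1} then g (x + s *\<^sub>R ?e) else 0) = ?k x" by (auto simp: indicator_def)
      have "((\<lambda>s. if s \<in> {0..1} then g (x + s *\<^sub>R ?e) else 0) has_integral (\<integral>s. ?k x s \<partial>lborel)) UNIV"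
        unfolding kk by (rule has_integral_integral_lborel[OF elim])
      then have 1: "((\<lambda>s. g (x + s *\<^sub>R ?e)) has_integral (\<integral>s. ?k x s \<partial>lborel)) {0..1}"
        by (simp only: has_integral_restrict_UNIV)
      have "((\<lambda>s. g (x + s *\<^sub>R ?e)) has_integral (F (x + 1 *\<^sub>R ?e) - F (x + 0 *\<^sub>R ?e))) {0..1}"
      proof (rule fundamental_theorem_of_calculus_interior_strong[of "{s. x + s *\<^sub>R ?e = 0}"])
        have "{s. x + s *\<^sub>R ?e = 0} \<subseteq> {- (x $ i)}"
          by (auto simp: vec_eq_iff dest: spec[of _ i])
        then show "finite {s. x + s *\<^sub>R ?e = 0}" by (rule finite_subset) simp
        show "continuous_on {0..1} (\<lambda>s. F (x + s *\<^sub>R ?e))"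
          by (intro continuous_on_compose2[OF F(2)] continuous_intros) auto
        fix s assume "s \<in> {0<..<1} - {s. x + s *\<^sub>R ?e = 0}"
        then have "x + s *\<^sub>R ?e \<noteq> 0" by simp
        from d[OF this] have "F differentiable (at (x + s *\<^sub>R ?e))" "grad F (x + s *\<^sub>R ?e) \<bullet> ?e = g (x + s *\<^sub>R ?e)"
          by (auto simp: inner_axis grad_def)
        then show "((\<lambda>s. F (x + s *\<^sub>R ?e)) has_vector_derivative g (x + s *\<^sub>R ?e)) (at s)"
          using DERIV_along_line[OF has_derivative_grad] by (metis has_real_derivative_iff_has_vector_derivative)
      qed simp
      from has_integral_unique[OF 1 this] show ?case by simp
    qed
  qed simp
  also have "\<dots> = (\<integral>x. F (x + ?e) \<partial>lborel) - (\<integral>x. F x \<partial>lborel)"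
    by (rule Bochner_Integration.integral_diff) (auto intro: F integrable_translate)
  also have "\<dots> = 0" by (simp add: integral_translate)
  finally show ?thesis .
qed

lemma bounded_on_unit_ball:
  fixes h :: "real^'n \<Rightarrow> real"
  assumes "continuous_on UNIV h"
  shows "\<exists>M. \<forall>x\<in>cball 0 1. \<bar>h x\<bar> \<le> M"
proof -
  have "compact (h ` cball 0 1)" by (intro compact_continuous_image continuous_on_subset[OF assms]) auto
  then show ?thesis by (force simp: bounded_iff dest!: compact_imp_bounded)
qed

text \<open>The product rule and the vanishing of the integral of \<open>\<partial>_i (v \<phi>)\<close>.\<close>

lemma weak_partialI:
  fixes v :: "real^'n \<Rightarrow> real"
  assumes c: "continuous_on UNIV v" and d: "\<And>x. x \<noteq> 0 \<Longrightarrow> v differentiable (at x)"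
    and c1: "continuous_on (UNIV - {0}) (partial i v)" and s: "0 \<le> s" "s < 1"
    and bound: "\<And>x. x \<noteq> 0 \<Longrightarrow> norm x \<le> 1 \<Longrightarrow> \<bar>partial i v x\<bar> \<le> C * norm x powr (- s)"
  shows "weak_partial i v (partial i v)"
  unfolding weak_partial_def
proof (intro conjI allI impI)
  obtain M where M: "\<And>x. x \<in> cball 0 1 \<Longrightarrow> \<bar>v x\<bar> \<le> M"
    using bounded_on_unit_ball[OF c] by blast
  show "L_loc 1 v"
    by (rule L_loc_singular[of _ 0 1 M]) (use M c in \<open>auto intro: continuous_on_subset\<close>)
  show "L_loc 1 (partial i v)"
    by (rule L_loc_singular[OF c1 s(1) _ _ bound]) (use s in auto)
  fix \<phi> :: "real^'n \<Rightarrow> real" assume \<phi>: "test_function \<phi>"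
  define K where "K = closure {x. \<phi> x \<noteq> 0}"
  have K: "compact K" using \<phi> unfolding test_function_def K_def by simp
  have C1: "Ck_on 1 UNIV \<phi>" using \<phi> unfolding test_function_def by simp
  then have d\<phi>: "\<phi> differentiable (at x)" and cp\<phi>: "continuous_on UNIV (partial i \<phi>)" for x
    unfolding Ck_on_1_iff by auto
  then have c\<phi>: "continuous_on UNIV \<phi>"
    by (simp add: continuous_at_imp_continuous_on differentiable_imp_continuous_within)
  have out: "\<phi> x = 0" "partial i \<phi> x = 0" if "x \<notin> K" for x
  proof -
    have op: "open (- K)" unfolding K_def by (rule open_Compl[OF closed_closure])
    have z: "\<phi> y = 0" if "y \<in> - K" for y using that closure_subset[of "{x. \<phi> x \<noteq> 0}"] unfolding K_def by auto
    then show "\<phi> x = 0" using that by simp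
    have "((\<lambda>y. 0 :: real) has_derivative (\<lambda>h. 0)) (at x)" by simp
    then have "(\<phi> has_derivative (\<lambda>h. 0)) (at x)"
      by (rule has_derivative_transform_within_open[OF _ op]) (use that z in auto)
    then show "partial i \<phi> x = 0" by (rule partial_eqI)
  qed
  have ind: "indicator K x * (h x * \<phi> x) = h x * \<phi> x" "indicator K x * (h x * partial i \<phi> x) = h x * partial i \<phi> x" for h x
    using out[of x] by (auto simp: indicator_def)
  have int0: "integrable lborel (\<lambda>x. indicator K x * h x)" if h: "continuous_on UNIV h" for h :: "real^'n \<Rightarrow> real"
  proof -
    obtain M where "\<forall>x\<in>cball 0 1. \<bar>h x\<bar> \<le> M" using bounded_on_unit_ball[OF h] by blast
    then show ?thesis
      by (intro set_integrable_singular(1)[OF _ _ _ _ K, of _ 0 M]) (use h in \<open>auto intro: continuous_on_subset\<close>)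
  qed
  have i1: "integrable lborel (\<lambda>x. v x * partial i \<phi> x)"
    using int0[of "\<lambda>x. v x * partial i \<phi> x"] continuous_on_mult[OF c cp\<phi>] by (simp add: ind)
  have i3: "integrable lborel (\<lambda>x. v x * \<phi> x)"
    using int0[of "\<lambda>x. v x * \<phi> x"] continuous_on_mult[OF c c\<phi>] by (simp add: ind)
  obtain M where M: "\<forall>x\<in>cball 0 1. \<bar>\<phi> x\<bar> \<le> M" using bounded_on_unit_ball[OF c\<phi>] by blast
  have "integrable lborel (\<lambda>x. indicator K x * (partial i v x * \<phi> x))"
  proof (rule set_integrable_singular(1)[OF _ s _ K, of _ "\<bar>C\<bar> * \<bar>M\<bar>"])
    show "continuous_on (UNIV - {0}) (\<lambda>x. partial i v x * \<phi> x)"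
      by (intro continuous_on_mult c1 continuous_on_subset[OF c\<phi>]) auto
    fix x :: "real^'n" assume x: "x \<noteq> 0" "norm x \<le> 1"
    have "C * norm x powr (- s) \<le> \<bar>C\<bar> * norm x powr (- s)" by (intro mult_right_mono) auto
    then have "\<bar>partial i v x\<bar> \<le> \<bar>C\<bar> * norm x powr (- s)" using bound[OF x] by linarith
    moreover have "\<bar>\<phi> x\<bar> \<le> \<bar>M\<bar>" using M x by force
    ultimately have "\<bar>partial i v x\<bar> * \<bar>\<phi> x\<bar> \<le> (\<bar>C\<bar> * norm x powr (- s)) * \<bar>M\<bar>" by (intro mult_mono) auto
    then show "\<bar>partial i v x * \<phi> x\<bar> \<le> \<bar>C\<bar> * \<bar>M\<bar> * norm x powr (- s)" by (simp add: abs_mult mult_ac)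
  qed
  then have i2: "integrable lborel (\<lambda>x. partial i v x * \<phi> x)" by (simp add: ind)
  have "(\<integral>x. v x * partial i \<phi> x + partial i v x * \<phi> x \<partial>lborel) = 0"
  proof (rule integral_partial_zero[OF i3 continuous_on_mult[OF c c\<phi>] Bochner_Integration.integrable_add[OF i1 i2]])
    fix x :: "real^'n" assume x: "x \<noteq> 0"
    have "((\<lambda>x. v x * \<phi> x) has_derivative (\<lambda>h. v x * frechet_derivative \<phi> (at x) h + frechet_derivative v (at x) h * \<phi> x)) (at x)"
      using d[OF x] d\<phi>[of x] by (intro has_derivative_mult) (auto simp: frechet_derivative_works)
    then show "(\<lambda>x. v x * \<phi> x) differentiable (at x) \<and> partial i (\<lambda>x. v x * \<phi> x) x = v x * partial i \<phi> x + partial i v x * \<phi> x"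
      using partial_eqI differentiableI unfolding partial_def by blast
  qed
  then have eq: "(\<integral>x. v x * partial i \<phi> x \<partial>lborel) = - (\<integral>x. partial i v x * \<phi> x \<partial>lborel)"
    using i1 i2 by simp
  show "integral\<^sup>L lebesgue (\<lambda>x. v x * partial i \<phi> x) = - integral\<^sup>L lebesgue (\<lambda>x. partial i v x * \<phi> x)"
    using borel_measurable_integrable[OF i1] borel_measurable_integrable[OF i2] eq
    by (simp add: integral_completion)
qed

lemma Sobolev_locI:
  fixes v :: "real^'n \<Rightarrow> real"
  assumes C1: "Ck_on 1 UNIV v" and C2: "Ck_on 2 (UNIV - {0}) v" and s: "0 \<le> s" "s < 1"
    and bound: "\<And>i j x. x \<noteq> 0 \<Longrightarrow> norm x \<le> 1 \<Longrightarrow> \<bar>partial j (partial i v) x\<bar> \<le> C * norm x powr (- s)"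
    and \<delta>: "0 < \<delta>" "\<delta> * s < 1"
  shows "Sobolev_loc 2 \<delta> v"
proof -
  have L: "L_loc \<delta> h" if h: "continuous_on UNIV h" for h :: "real^'n \<Rightarrow> real"
  proof -
    obtain M where "\<forall>x\<in>cball 0 1. \<bar>h x\<bar> \<le> M" using bounded_on_unit_ball[OF h] by blast
    then show ?thesis
      by (intro L_loc_singular[of h 0 \<delta> M]) (use h \<delta> in \<open>auto intro: continuous_on_subset\<close>)
  qed
  have dv: "v differentiable (at x)" and cp: "continuous_on UNIV (partial i v)" for i x
    using C1 unfolding Ck_on_1_iff by auto
  then have cv: "continuous_on UNIV v"
    by (simp add: continuous_at_imp_continuous_on differentiable_imp_continuous_within)
  have w1: "weak_partial i v (partial i v)" for i
  proof -
    obtain M where "\<forall>x\<in>cball 0 1. \<bar>partial i v x\<bar> \<le> M" using bounded_on_unit_ball[OF cp] by blast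
    then show ?thesis
      by (intro weak_partialI[of v i 0 M]) (use cv dv cp in \<open>auto intro: continuous_on_subset\<close>)
  qed
  have c2: "continuous_on (UNIV - {0}) (partial j (partial i v))"
    and d2: "\<And>x. x \<noteq> 0 \<Longrightarrow> partial i v differentiable (at x)" for i j
    using C2 unfolding Ck_on_2_iff by auto
  have w2: "weak_partial j (partial i v) (partial j (partial i v))" for i j
    by (rule weak_partialI[OF cp d2 c2 s bound])
  have L2: "L_loc \<delta> (partial j (partial i v))" for i j
    by (rule L_loc_singular[OF c2 s(1) \<delta> bound])
  show ?thesis unfolding numeral_2_eq_2 Sobolev_loc.simps
    using L[OF cv] L[OF cp] w1 w2 L2 by blast
qed


section \<open>Existence of entire subsolutions\<close>

lemma power_of_weight:
  assumes "r > 0" "y > 0"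
  shows "(r powr \<alpha> * y powr \<beta> * c) ^ k = r powr (real k * \<alpha>) * y powr (real k * \<beta>) * c ^ k"
  using assms by (simp add: power_mult_distrib powr_realpow[symmetric] powr_powr mult.commute)

text \<open>Of the sum that defines \<open>S_k\<close> a single term \<open>m a^(k-1)\<close>, the one that contains \<open>\<phi>''\<close>, is enough. All
  eigenvalues are positive, hence so are all \<open>S_i\<close>.\<close>

lemma (in radial_profile) radial_subsolution:
  fixes k :: nat
  assumes k: "1 \<le> k" "k \<le> CARD('n)" and p: "p > 1"
    and pos: "\<And>r. r > 0 \<Longrightarrow> \<phi>1 r > 0" "\<And>r. r > 0 \<Longrightarrow> \<phi>2 r > 0" and f: "\<And>t. f t > (0::real)"
    and ineq: "\<And>r. r > 0 \<Longrightarrow> f (\<phi> r) ^ k \<le>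
      (p - 1) * (\<phi>1 r powr (real k * (p - 1 - \<beta>) - 1) * \<phi>2 r) * r powr (1 - real k * (\<alpha> + 1))"
  shows "entire_admissible_subsolution p k \<alpha> \<beta> f (\<lambda>x :: real^'n. \<phi> (norm x))"
    and "nontrivial (\<lambda>x :: real^'n. \<phi> (norm x))"
proof -
  let ?u = "\<lambda>x :: real^'n. \<phi> (norm x)"
  define m where "m r = (p - 1) * \<phi>1 r powr (p - 2) * \<phi>2 r" for r
  define a where "a r = \<phi>1 r powr (p - 1) / r" for r
  have ma: "m r > 0" "a r > 0" if "r > 0" for r
    using that pos[OF that] p by (auto simp: m_def a_def)
  have g: "((\<lambda>r. \<bar>\<phi>1 r\<bar> powr (p - 2) * \<phi>1 r) has_real_derivative m (norm x)) (at (norm x))" if "x \<noteq> 0" for x :: "real^'n"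
    unfolding m_def by (rule has_derivative_abs_powr_mult_self[of "{0<..}"]) (use pos d2 that in auto)
  have U: "open (UNIV - {0 :: real^'n})" by (intro open_delete open_UNIV)
  have diff: "p_field p ?u differentiable (at x)"
    and ev: "has_eigenvalues (jacobian (p_field p ?u) (at x)) (spike undefined (m (norm x)) (a (norm x)))" if x: "x \<noteq> 0" for x
  proof -
    have xU: "x \<in> UNIV - {0}" using x by simp
    have e: "\<bar>\<phi>1 (norm x)\<bar> powr (p - 2) * \<phi>1 (norm x) / norm x = a (norm x)"
      unfolding a_def using abs_powr_mult_self[OF pos(1)] x by simp
    note R = radial_p_field[OF U xU _ _ g[OF x], of \<phi>, unfolded e]
    show "p_field p ?u differentiable (at x)"
      by (rule differentiableI[OF R(1)]) (use d1 in auto)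
    show "has_eigenvalues (jacobian (p_field p ?u) (at x)) (spike undefined (m (norm x)) (a (norm x)))"
      by (rule R(2)) (use d1 in auto)
  qed
  show "entire_admissible_subsolution p k \<alpha> \<beta> f ?u"
    unfolding entire_admissible_subsolution_def
  proof (intro conjI ballI Ck_on_1 Ck_on_2_off_0)
    show "admissible p k (UNIV - {0}) ?u"
      unfolding admissible_def
    proof (intro ballI conjI diff)
      fix x :: "real^'n" assume "x \<in> UNIV - {0}"
      then have x: "x \<noteq> 0" and r: "norm x > 0" by auto
      show "\<exists>l. has_eigenvalues (jacobian (p_field p ?u) (at x)) l \<and> l \<in> Gamma_cone k"
        using ev[OF x] spike_in_Gamma_cone[OF ma(1)[OF r] ma(2)[OF r] k(2)] by blast
    qed simp
    fix x :: "real^'n" assume "x \<in> UNIV - {0}"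
    then have x: "x \<noteq> 0" by simp
    define r where "r = norm x"
    have r: "r > 0" using x by (simp add: r_def)
    have ng: "norm (grad ?u x) = \<phi>1 r"
      unfolding grad_radial using x pos(1)[OF r] by (simp add: r_def)
    define y where "y = r powr \<alpha> * \<phi>1 r powr \<beta> * f (\<phi> r)"
    have y: "y \<ge> 0" using f[of "\<phi> r"] by (simp add: y_def)
    have "y ^ k = r powr (real k * \<alpha>) * \<phi>1 r powr (real k * \<beta>) * f (\<phi> r) ^ k"
      unfolding y_def by (rule power_of_weight[OF r pos(1)[OF r]])
    also have "\<dots> \<le> r powr (real k * \<alpha>) * \<phi>1 r powr (real k * \<beta>) *
      ((p - 1) * (\<phi>1 r powr (real k * (p - 1 - \<beta>) - 1) * \<phi>2 r) * r powr (1 - real k * (\<alpha> + 1)))"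
      using ineq[OF r] by (intro mult_left_mono) auto
    also have "\<dots> = m r * a r ^ (k - 1)"
      unfolding m_def a_def by (rule radial_product_powers(1)[OF k(1) pos(1)[OF r] r, symmetric])
    also have "\<dots> \<le> elem_sym k (spike undefined (m r) (a r) :: real^'n)"
      using ma[OF r] k by (intro elem_sym_spike_lower) auto
    also have "\<dots> = S_mat k (jacobian (p_field p ?u) (at x))"
      unfolding r_def by (rule S_mat_eq[OF ev[OF x], symmetric])
    finally have "root k (y ^ k) \<le> root k (S_mat k (jacobian (p_field p ?u) (at x)))"
      using k(1) by (intro real_root_le_mono) auto
    then have "y \<le> root k (S_mat k (jacobian (p_field p ?u) (at x)))"
      using k(1) y by (simp add: real_root_power_cancel)
    moreover have "ext_power (norm x) \<alpha> * ext_power (norm (grad ?u x)) \<beta> * ereal (f (?u x)) = ereal y"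
      unfolding ng r_def[symmetric] y_def ext_power_def using r pos(1)[OF r] by simp
    ultimately show "ext_power (norm x) \<alpha> * ext_power (norm (grad ?u x)) \<beta> * ereal (f (?u x))
        \<le> ereal (root k (S_mat k (jacobian (p_field p ?u) (at x))))" by simp
  qed
  show "nontrivial ?u"
    unfolding nontrivial_def
  proof
    assume "\<exists>c. \<forall>x. ?u x = c"
    then obtain c where "?u = (\<lambda>x. c)" by blast
    then have "grad ?u (axis undefined 1) = 0"
      by (intro grad_eqI) simp
    moreover have "norm (axis undefined 1 :: real^'n) = 1" by (simp add: norm_axis_1)
    ultimately have "\<phi>1 1 *\<^sub>R (axis undefined 1 :: real^'n) = 0" by (simp add: grad_radial)
    then show False using pos(1)[of 1] \<open>norm (axis undefined 1 :: real^'n) = 1\<close> by (auto simp: axis_eq_0_iff)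
  qed
qed

lemma (in power_profile) second_derivative_bound:
  assumes \<sigma>1: "\<sigma> < 1"
  shows "\<exists>C. \<forall>i j. \<forall>x :: real^'n. x \<noteq> 0 \<longrightarrow> norm x \<le> 1 \<longrightarrow>
    \<bar>partial j (partial i (\<lambda>x. prof (norm x))) x\<bar> \<le> C * norm x powr (- (1 - \<sigma>))"
proof -
  have "continuous_on {0..1} (\<lambda>r. \<bar>E (\<rho> r)\<bar> + \<bar>E1 (\<rho> r)\<bar>)"
    by (intro continuous_intros continuous_on_compose2[OF E_cont[of UNIV]] continuous_on_compose2[OF E1_cont]
        continuous_on_subset[OF \<rho>_cont]) auto
  then have "\<exists>z\<in>{0..1}. \<forall>r\<in>{0..1}. \<bar>E (\<rho> r)\<bar> + \<bar>E1 (\<rho> r)\<bar> \<le> \<bar>E (\<rho> z)\<bar> + \<bar>E1 (\<rho> z)\<bar>"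
    by (intro continuous_attains_sup) auto
  then obtain z where z: "\<And>r. r \<in> {0..1} \<Longrightarrow> \<bar>E (\<rho> r)\<bar> + \<bar>E1 (\<rho> r)\<bar> \<le> \<bar>E (\<rho> z)\<bar> + \<bar>E1 (\<rho> z)\<bar>"
    by blast
  define M where "M = \<bar>E (\<rho> z)\<bar> + \<bar>E1 (\<rho> z)\<bar>"
  have M: "\<bar>E (\<rho> r)\<bar> \<le> M" "\<bar>E1 (\<rho> r)\<bar> \<le> M" if "0 \<le> r" "r \<le> 1" for r
    using z[of r] that by (auto simp: M_def)
  define C where "C = \<bar>\<mu>\<bar> * M + (\<bar>\<mu> * (\<sigma> - 1)\<bar> * M + \<mu>\<^sup>2 * M)"
  have "\<bar>partial j (partial i (\<lambda>x. prof (norm x))) x\<bar> \<le> C * norm x powr (- (1 - \<sigma>))"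
    if x: "x \<noteq> 0" "norm x \<le> 1" for i j and x :: "real^'n"
  proof -
    define r where "r = norm x"
    have r: "0 < r" "r \<le> 1" using x by (auto simp: r_def)
    let ?R = "r powr (\<sigma> - 1)"
    have R: "?R \<ge> 1" using r \<sigma>1 powr_mono2'[of "1 - \<sigma>" r 1] powr_mono'[of "\<sigma> - 1" 0 r] by simp
    have r2: "r powr (2 * \<sigma>) \<le> ?R"
      using powr_mono'[of "\<sigma> - 1" "2 * \<sigma>" r] r \<sigma> by simp
    have 1: "\<bar>prof1 r / r\<bar> \<le> \<bar>\<mu>\<bar> * M * ?R"
    proof -
      have "\<bar>\<mu>\<bar> * ?R * \<bar>E (\<rho> r)\<bar> \<le> \<bar>\<mu>\<bar> * ?R * M" using M r by (intro mult_left_mono) auto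
      then show ?thesis using r by (simp add: prof1_div abs_mult mult_ac)
    qed
    have 2: "\<bar>prof2 r - prof1 r / r\<bar> \<le> (\<bar>\<mu> * (\<sigma> - 1)\<bar> * M + \<mu>\<^sup>2 * M) * ?R"
    proof -
      have "\<bar>\<mu> * (\<sigma> - 1) * ?R * E (\<rho> r)\<bar> \<le> \<bar>\<mu> * (\<sigma> - 1)\<bar> * ?R * M"
        using M(1)[of r] r by (simp only: abs_mult) (intro mult_mono; simp)
      moreover have "\<bar>\<mu>\<^sup>2 * r powr (2 * \<sigma>) * E1 (\<rho> r)\<bar> \<le> \<mu>\<^sup>2 * ?R * M"
        using M(2)[of r] r r2 by (simp only: abs_mult) (intro mult_mono; simp)
      ultimately have "\<bar>prof2 r - prof1 r / r\<bar> \<le> \<bar>\<mu> * (\<sigma> - 1)\<bar> * ?R * M + \<mu>\<^sup>2 * ?R * M"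
        unfolding prof2_diff[OF r(1)] by (intro order_trans[OF abs_triangle_ineq] add_mono)
      then show ?thesis by (simp add: algebra_simps)
    qed
    have "\<bar>partial j (partial i (\<lambda>x. prof (norm x))) x\<bar> \<le> \<bar>prof1 r / r\<bar> + \<bar>prof2 r - prof1 r / r\<bar>"
    proof -
      let ?P = "partial j (partial i (\<lambda>x. prof (norm x))) x" and ?A = "if i = j then prof1 r / r else 0"
      have "\<bar>?P\<bar> \<le> \<bar>?A\<bar> + \<bar>?P - ?A\<bar>" by linarith
      also have "\<dots> \<le> \<bar>prof1 r / r\<bar> + \<bar>prof2 r - prof1 r / r\<bar>"
      proof (rule add_mono)
        show "\<bar>?P - ?A\<bar> \<le> \<bar>prof2 r - prof1 r / r\<bar>"
          unfolding r_def by (rule partial_partial_bound[OF x(1)])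
      qed simp
      finally show ?thesis .
    qed
    also have "\<dots> \<le> C * ?R" using 1 2 unfolding C_def distrib_right by linarith
    finally show ?thesis by (simp add: r_def)
  qed
  then show ?thesis by blast
qed

lemma powr_large: "a > 0 \<Longrightarrow> \<exists>\<mu>\<ge>1. \<mu> powr a \<ge> (L :: real)"
  by (intro exI[of _ "(max 1 L) powr (1 / a)"]) (auto simp: powr_powr intro!: ge_one_powr_ge_zero)

lemma powr_small: "a > 0 \<Longrightarrow> c > 0 \<Longrightarrow> C \<ge> 0 \<Longrightarrow> \<exists>l>0. l \<le> 1 \<and> l \<le> c \<and> C * l powr a < (1 :: real)"
proof -
  assume a: "a > 0" and c: "c > 0" and C: "C \<ge> 0"
  define l where "l = min (min 1 c) ((1 / (C + 1)) powr (1 / a))"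
  have l: "l > 0" "l \<le> 1" "l \<le> c" "l \<le> (1 / (C + 1)) powr (1 / a)" using c C by (auto simp: l_def)
  have "l powr a \<le> ((1 / (C + 1)) powr (1 / a)) powr a" using l a by (intro powr_mono2) auto
  also have "\<dots> = 1 / (C + 1)" using a C by (simp add: powr_powr)
  finally have "C * l powr a \<le> C * (1 / (C + 1))" using C by (intro mult_left_mono) auto
  also have "\<dots> < 1" using C by simp
  finally show ?thesis using l by blast
qed

text \<open>For \<open>r \<le> 1\<close> the profile is at most \<open>0\<close>, so \<open>f(\<phi>) \<le> f(0)\<close>, and the term of \<open>\<phi>''\<close> that comes from differentiating
  \<open>r^\<sigma>\<close> is large enough. For \<open>r \<ge> 1\<close> the profile is nonnegative and the term that comes from
  the autonomous equation is large enough. Each condition is a lower bound on \<open>\<mu>0\<close>.\<close>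

lemma existence_of_subsolution:
  fixes f :: "real \<Rightarrow> real" and k :: nat
  assumes k: "1 \<le> k" "k \<le> CARD('n::finite)"
    and f: "\<And>t. f t > 0" "mono f" "continuous_on UNIV f"
    and \<alpha>: "-1 < \<alpha>" and \<beta>: "\<beta> < p - 1" and p: "p > 1"
    and div: "integral_diverges (\<lambda>t. growth.G (\<lambda>s. f s ^ k) t powr (- (1 / (real k * (p - 1 - \<beta>) + 1))))"
  shows "\<exists>u :: real^'n \<Rightarrow> real.
         entire_admissible_subsolution p k \<alpha> \<beta> f u \<and> nontrivial u \<and>
         (p \<le> \<alpha> + \<beta> + 2 \<longrightarrow> Ck_on 2 UNIV u) \<and>
         (p > \<alpha> + \<beta> + 2 \<longrightarrow>
            Ck_on 2 (UNIV - {0}) u \<and>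
            (\<forall>\<delta>. 1 < \<delta> \<and> \<delta> < (p - \<beta> - 1) / (p - \<alpha> - \<beta> - 2) \<longrightarrow> Sobolev_loc 2 \<delta> u))"
proof -
  define a where "a = real k * (p - 1 - \<beta>)"
  define \<sigma> where "\<sigma> = (\<alpha> + 1) / (p - 1 - \<beta>)"
  have a: "a > 0" using k \<beta> by (simp add: a_def)
  have \<sigma>: "\<sigma> > 0" using \<alpha> \<beta> by (simp add: \<sigma>_def)
  have \<sigma>a: "\<sigma> * a = real k * (\<alpha> + 1)" using \<beta> by (simp add: \<sigma>_def a_def)
  have fk: "f s ^ k \<le> f t ^ k" if "s \<le> t" for s t
    using that f(1)[of s] monoD[OF f(2)] by (intro power_mono) (auto intro: less_imp_le)
  interpret growth "\<lambda>s. f s ^ k" a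
    using f fk a by unfold_locales (auto intro!: continuous_intros monoI)
  obtain \<Phi> T where "separable_ode (\<lambda>s. f s ^ k) a 0 \<Phi> T" using separable_ode_exists by blast
  then interpret separable_ode "\<lambda>s. f s ^ k" a 0 \<Phi> T .
  obtain \<psi> E E1 where \<psi>: "\<And>y. (\<psi> has_real_derivative E y) (at y)" "\<And>y. (E has_real_derivative E1 y) (at y)"
      "continuous_on UNIV E1" and E: "\<And>y. E y \<ge> 1" "\<And>y. E1 y \<ge> 0" and \<psi>0: "\<And>y. y \<le> 0 \<Longrightarrow> \<psi> y \<le> 0"
    and HH: "\<And>y. y \<ge> 0 \<Longrightarrow> E y powr (a - 1) * E1 y = f (\<psi> y) ^ k / (a + 1)"
    using entire_ode_solution[OF refl div[folded a_def]] by blast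
  \<comment> \<open>the first summand serves the region \<open>r \<le> 1\<close>, the second one \<open>r \<ge> 1\<close>\<close>
  define L where "L = f 0 ^ k / ((p - 1) * \<sigma>) + (a + 1) / (p - 1)"
  have L: "L \<ge> f 0 ^ k / ((p - 1) * \<sigma>)" "L \<ge> (a + 1) / (p - 1)"
    using p \<sigma> a f(1)[of 0] by (auto simp: L_def intro!: divide_nonneg_pos mult_pos_pos less_imp_le)
  obtain \<mu>0 where \<mu>0: "\<mu>0 \<ge> 1" "\<mu>0 powr a \<ge> L" using powr_large[OF a] by blast
  \<comment> \<open>the factor \<open>1 / (1 + \<sigma>)\<close> makes \<open>\<mu>0\<close> the constant in front of \<open>r^\<sigma> E\<close> in \<open>\<phi>'\<close>; the profile vanishes at \<open>r = 1\<close>\<close>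
  interpret P: power_profile \<psi> E E1 "- \<mu>0 / (1 + \<sigma>)" "\<mu>0 / (1 + \<sigma>)" \<sigma>
    using \<psi> \<sigma> by unfold_locales
  have \<mu>: "P.\<mu> = \<mu>0" unfolding P.\<mu>_def using \<sigma> by simp
  have Epos: "E y > 0" for y using E(1)[of y] by linarith
  have pos1: "P.prof1 r > 0" if "r > 0" for r
    unfolding P.prof1_def \<mu> using \<mu>0 that Epos by simp
  have pos2: "P.prof2 r > 0" if "r > 0" for r
    unfolding P.prof2_def \<mu> using \<mu>0 that Epos E(2) \<sigma> by (intro add_pos_nonneg) auto
  have ineq: "f (P.prof r) ^ k \<le>
      (p - 1) * (P.prof1 r powr (real k * (p - 1 - \<beta>) - 1) * P.prof2 r) * r powr (1 - real k * (\<alpha> + 1))"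
    if r: "r > 0" for r
  proof -
    let ?y = "P.\<rho> r"
    have A1: "P.prof1 r powr (a - 1) = \<mu>0 powr (a - 1) * r powr (\<sigma> * (a - 1)) * E ?y powr (a - 1)"
      unfolding P.prof1_def \<mu> using \<mu>0 r Epos[of ?y] by (simp add: powr_mult powr_powr)
    have A2: "\<mu>0 powr (a - 1) * \<mu>0 = \<mu>0 powr a" using \<mu>0 powr_add[of \<mu>0 "a - 1" 1] by simp
    have "\<mu>0 powr (a + 1) = \<mu>0 powr a * \<mu>0 powr 1" by (rule powr_add)
    then have A3: "\<mu>0 powr (a - 1) * \<mu>0\<^sup>2 = \<mu>0 powr (a + 1)"
      using \<mu>0 A2 by (simp add: power2_eq_square mult.assoc[symmetric])
    have A4: "E ?y powr (a - 1) * E ?y = E ?y powr a" using Epos[of ?y] powr_add[of "E ?y" "a - 1" 1] by simp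
    have A5: "r powr (\<sigma> * (a - 1)) * r powr (\<sigma> - 1) * r powr (1 - real k * (\<alpha> + 1)) = 1"
      unfolding powr_add[symmetric] \<sigma>a[symmetric] using r by (simp add: algebra_simps)
    have A6: "r powr (\<sigma> * (a - 1)) * r powr (2 * \<sigma>) * r powr (1 - real k * (\<alpha> + 1)) = r powr (\<sigma> + 1)"
      unfolding powr_add[symmetric] \<sigma>a[symmetric] by (rule arg_cong[of _ _ "(powr) r"]) (simp add: algebra_simps)
    have alg: "q * ((m * r1 * g) * (m1 * s * r2 * h + m2 * r3 * h1)) * r4
        = q * (s * (m * m1) * (g * h) * (r1 * r2 * r4) + (m * m2) * (r1 * r3 * r4) * (g * h1))"
      for q m r1 g m1 s r2 h m2 r3 h1 r4 :: real by (simp add: algebra_simps)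
    have X: "(p - 1) * (P.prof1 r powr (a - 1) * P.prof2 r) * r powr (1 - real k * (\<alpha> + 1))
        = (p - 1) * (\<sigma> * \<mu>0 powr a * E ?y powr a + \<mu>0 powr (a + 1) * r powr (\<sigma> + 1) * (E ?y powr (a - 1) * E1 ?y))"
      unfolding P.prof2_def \<mu> A1 alg A2 A3 A4 A5 A6 by simp
    show ?thesis unfolding a_def[symmetric] X
    proof (cases "r \<le> 1")
      case True
      have "r powr (1 + \<sigma>) \<le> 1" using True r \<sigma> powr_le1[of "1 + \<sigma>" r] by simp
      then have "\<mu>0 / (1 + \<sigma>) * r powr (1 + \<sigma>) \<le> \<mu>0 / (1 + \<sigma>) * 1" using \<mu>0 \<sigma> by (intro mult_left_mono) auto
      then have "?y \<le> 0" unfolding P.\<rho>_def by simp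
      then have "f (P.prof r) ^ k \<le> f 0 ^ k" unfolding P.prof_def by (intro fk \<psi>0)
      also have "f 0 ^ k = (p - 1) * \<sigma> * (f 0 ^ k / ((p - 1) * \<sigma>))" using p \<sigma> by simp
      also have "\<dots> \<le> (p - 1) * \<sigma> * \<mu>0 powr a" using L \<mu>0 p \<sigma> by (intro mult_left_mono) auto
      also have "\<dots> \<le> (p - 1) * \<sigma> * \<mu>0 powr a * E ?y powr a"
      proof -
        have "E ?y powr a \<ge> 1" using E(1)[of ?y] a by (intro ge_one_powr_ge_zero) auto
        moreover have "(p - 1) * \<sigma> * \<mu>0 powr a \<ge> 0" using p \<sigma> by simp
        ultimately have "(p - 1) * \<sigma> * \<mu>0 powr a * 1 \<le> (p - 1) * \<sigma> * \<mu>0 powr a * E ?y powr a"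
          by (rule mult_left_mono)
        then show ?thesis by simp
      qed
      also have "\<dots> \<le> (p - 1) * \<sigma> * \<mu>0 powr a * E ?y powr a
          + (p - 1) * (\<mu>0 powr (a + 1) * r powr (\<sigma> + 1) * (E ?y powr (a - 1) * E1 ?y))"
        using p E(2)[of ?y] by simp
      finally show "f (P.prof r) ^ k \<le> (p - 1) * (\<sigma> * \<mu>0 powr a * E ?y powr a + \<mu>0 powr (a + 1) * r powr (\<sigma> + 1) * (E ?y powr (a - 1) * E1 ?y))"
        by (simp add: algebra_simps)
    next
      case False
      then have r1: "r \<ge> 1" by simp
      have "r powr (1 + \<sigma>) \<ge> 1" using r1 \<sigma> by (intro ge_one_powr_ge_zero) auto
      then have "\<mu>0 / (1 + \<sigma>) * r powr (1 + \<sigma>) \<ge> \<mu>0 / (1 + \<sigma>) * 1" using \<mu>0 \<sigma> by (intro mult_left_mono) auto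
      then have y0: "?y \<ge> 0" unfolding P.\<rho>_def by simp
      have m: "\<mu>0 powr (a + 1) \<ge> (a + 1) / (p - 1)"
        using L(2) \<mu>0 powr_mono[of a "a + 1" \<mu>0] by linarith
      have w0: "f (P.prof r) ^ k > 0" using f(1) by simp
      have "f (P.prof r) ^ k = (p - 1) * ((a + 1) / (p - 1) * 1 * (f (P.prof r) ^ k / (a + 1)))"
        using p a by simp
      also have "\<dots> \<le> (p - 1) * (\<mu>0 powr (a + 1) * r powr (\<sigma> + 1) * (f (P.prof r) ^ k / (a + 1)))"
        using m r1 \<sigma> p a w0 by (intro mult_left_mono mult_right_mono mult_mono ge_one_powr_ge_zero) auto
      also have "\<dots> = (p - 1) * (\<mu>0 powr (a + 1) * r powr (\<sigma> + 1) * (E ?y powr (a - 1) * E1 ?y))"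
        unfolding HH[OF y0] P.prof_def ..
      also have "\<dots> \<le> (p - 1) * (\<sigma> * \<mu>0 powr a * E ?y powr a + \<mu>0 powr (a + 1) * r powr (\<sigma> + 1) * (E ?y powr (a - 1) * E1 ?y))"
        using p \<sigma> by (intro mult_left_mono) auto
      finally show "f (P.prof r) ^ k \<le> (p - 1) * (\<sigma> * \<mu>0 powr a * E ?y powr a + \<mu>0 powr (a + 1) * r powr (\<sigma> + 1) * (E ?y powr (a - 1) * E1 ?y))" .
    qed
  qed
  let ?u = "\<lambda>x :: real^'n. P.prof (norm x)"
  note sub = P.radial_subsolution[where 'n = 'n, OF k p pos1 pos2 f(1) ineq]
  have C2: "Ck_on 2 UNIV ?u" if "p \<le> \<alpha> + \<beta> + 2"
    using that \<beta> by (intro P.Ck_on_2_prof) (simp add: \<sigma>_def field_simps)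
  have S: "Sobolev_loc 2 \<delta> ?u" if h: "p > \<alpha> + \<beta> + 2" "1 < \<delta>" "\<delta> < (p - \<beta> - 1) / (p - \<alpha> - \<beta> - 2)" for \<delta>
  proof -
    have \<sigma>1: "\<sigma> < 1" using h(1) \<beta> by (simp add: \<sigma>_def field_simps)
    obtain C where C: "\<And>i j (x :: real^'n). x \<noteq> 0 \<Longrightarrow> norm x \<le> 1 \<Longrightarrow>
        \<bar>partial j (partial i ?u) x\<bar> \<le> C * norm x powr (- (1 - \<sigma>))"
      using P.second_derivative_bound[OF \<sigma>1] by blast
    have "1 - \<sigma> = (p - \<alpha> - \<beta> - 2) / (p - \<beta> - 1)" using \<beta> by (simp add: \<sigma>_def field_simps)
    moreover have "\<delta> * (p - \<alpha> - \<beta> - 2) < p - \<beta> - 1" using h by (simp only: pos_less_divide_eq)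
    ultimately have "\<delta> * (1 - \<sigma>) < 1" using \<beta> by (simp add: divide_less_eq)
    then show ?thesis
      using \<sigma> \<sigma>1 h(2) C by (intro Sobolev_locI[of _ "1 - \<sigma>" C] P.Ck_on_1 P.Ck_on_2_off_0) auto
  qed
  show ?thesis using sub C2 S P.Ck_on_2_off_0[where 'n = 'n] by (intro exI[of _ ?u]) blast
qed

section \<open>Necessity of the integral condition\<close>

text \<open>After division by \<open>r^(k \<alpha>) \<phi>'^(k \<beta>)\<close> the two terms of \<open>S_k\<close> for \<open>\<phi>(r) = \<Psi>(T b + l (r - 1))\<close> are at most
  multiples of \<open>l^(a+1) r^(1-\<gamma>) w(\<phi>)\<close> and \<open>l^a H(\<phi>)^a r^(-\<gamma>)\<close>. Here \<open>1 \<le> r \<le> 1 + L / l\<close>, and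
  \<open>H^a \<le> K w\<close> by \<open>H_power_le\<close>, so both are at most a constant times \<open>l^a w(\<phi>)\<close>. For small \<open>l\<close> this is
  less than \<open>w(\<phi>)\<close>.\<close>

lemma necessity_of_divergence:
  fixes f :: "real \<Rightarrow> real" and k :: nat and u :: "real^'n \<Rightarrow> real"
  assumes k: "1 \<le> k" "k \<le> CARD('n)"
    and f: "\<And>t. f t > 0" "mono f" "continuous_on UNIV f"
    and \<alpha>: "-1 < \<alpha>" and \<beta>: "\<beta> < p - 1" and p: "p > 1"
    and u: "entire_admissible_subsolution p k \<alpha> \<beta> f u"
  shows "integral_diverges (\<lambda>t. growth.G (\<lambda>s. f s ^ k) t powr (- (1 / (real k * (p - 1 - \<beta>) + 1))))"
proof (rule ccontr)
  define a where "a = real k * (p - 1 - \<beta>)"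
  assume "\<not> ?thesis"
  then obtain c where c: "c > 0" "(\<integral>\<^sup>+t\<in>{c..}. ennreal (growth.G (\<lambda>s. f s ^ k) t powr (- (1 / (a + 1)))) \<partial>lborel) < \<infinity>"
    unfolding integral_diverges_def a_def by (auto simp: top.not_eq_extremum)
  have a: "a > 0" using k \<beta> by (simp add: a_def)
  have fk: "f s ^ k \<le> f t ^ k" if "s \<le> t" for s t
    using that f(1)[of s] monoD[OF f(2)] by (intro power_mono) (auto intro: less_imp_le)
  have C1: "Ck_on 1 UNIV u" and C2: "Ck_on 2 (UNIV - {0}) u" and adm: "admissible p k (UNIV - {0}) u"
    and sub: "\<And>x. x \<noteq> 0 \<Longrightarrow> ext_power (norm x) \<alpha> * ext_power (norm (grad u x)) \<beta> * ereal (f (u x))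
        \<le> ereal (root k (S_mat k (jacobian (p_field p u) (at x))))"
    using u unfolding entire_admissible_subsolution_def by auto
  have cont: "continuous_on A u" for A
    using C1 unfolding Ck_on_1_iff
    by (meson continuous_at_imp_continuous_on differentiable_imp_continuous_within UNIV_I)
  obtain y where y: "\<And>x. x \<in> cball 0 1 \<Longrightarrow> u x < u y"
    using admissible_sup_not_attained_in_ball[OF C1 C2 adm k p, of 1] by (meson zero_le_one)
  have ny: "norm y > 1" using y[of y] by (meson less_irrefl mem_cball_0 not_le)
  obtain z where z: "z \<in> cball 0 1" "\<And>x. x \<in> cball 0 1 \<Longrightarrow> u x \<le> u z"
    using continuous_attains_sup[OF compact_cball _ cont, of 0 1] by auto
  \<comment> \<open>above the maximum of \<open>u\<close> over the unit ball and below the value that \<open>u\<close> takes at \<open>y\<close>\<close>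
  define b where "b = (u z + u y) / 2"
  have b: "u x < b" if "x \<in> cball 0 1" for x using z(2)[OF that] y[OF z(1)] by (simp add: b_def)
  have by': "b < u y" using y[OF z(1)] by (simp add: b_def)
  interpret growth "\<lambda>s. f s ^ k" a
    using f fk a by unfold_locales (auto intro!: continuous_intros monoI)
  obtain \<Phi> T where "separable_ode (\<lambda>s. f s ^ k) a b \<Phi> T" using separable_ode_exists by blast
  then interpret separable_ode "\<lambda>s. f s ^ k" a b \<Phi> T .
  obtain Y where Y: "\<And>t. T t \<le> Y" using T_bounded_above[OF c] by blast
  obtain K where K: "K > 0" "\<And>t. t \<ge> b \<Longrightarrow> H t powr a \<le> K * f t ^ k" using H_power_le[OF c] by blast
  define L where "L = Y - T b"
  have L: "L \<ge> 0" using Y[of b] by (simp add: L_def)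
  define D where "D = (p - 1) / (a + 1) * (1 + L) + K"
  have D: "D > 0" unfolding D_def using p a L K by (intro add_nonneg_pos) auto
  have "T (u y) - T b > 0" using T_strict[OF by'] by simp
  then have "(T (u y) - T b) / (2 * norm y) > 0" using ny by (intro divide_pos_pos) auto
  then obtain l where l: "l > 0" "l \<le> 1" "l \<le> (T (u y) - T b) / (2 * norm y)" "2 ^ CARD('n) * D * l powr a < 1"
    using powr_small[OF a, of "(T (u y) - T b) / (2 * norm y)" "2 ^ CARD('n) * D"] D by auto
  have ly: "T b + l * (norm y - 1) < T (u y)"
  proof -
    have "2 * norm y > 0" using ny by linarith
    then have "l * (2 * norm y) \<le> T (u y) - T b" using l(3) by (simp only: pos_le_divide_eq)
    then have "l * norm y < T (u y) - T b" using T_strict[OF by'] by simp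
    then show ?thesis using l(1) by (simp add: algebra_simps)
  qed
  \<comment> \<open>an upper bound for the blow-up radius of \<open>\<phi>\<close>\<close>
  define R where "R = 1 + L / l"
  have "L / l \<ge> 0" using L l by simp
  then have "cball 0 R \<noteq> ({} :: (real^'n) set)" by (simp add: R_def)
  then obtain z2 where z2: "z2 \<in> cball 0 R" "\<And>x. x \<in> cball 0 R \<Longrightarrow> u x \<le> u z2"
    using continuous_attains_sup[OF compact_cball _ cont, of 0 R] by blast
  \<comment> \<open>where \<open>\<phi>\<close> reaches \<open>M\<close> it is not less than \<open>u\<close>; this happens at the radius \<open>rM\<close>, and \<open>y\<close> is not outside\<close>
  define M where "M = max (u z2) (u y)"
  define rM where "rM = 1 + (T M - T b) / l"
  have bM: "b < M" using by' by (simp add: M_def)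
  have rM1: "rM > 1" using T_strict[OF bM] l by (simp add: rM_def)
  have rMR: "rM \<le> R" using Y[of M] l by (simp add: rM_def R_def L_def divide_right_mono)
  define \<phi> where "\<phi> r = \<Psi> (T b + l * (r - 1))" for r
  have TM: "T b + l * (rM - 1) = T M" using l by (simp add: rM_def)
  have lin: "T b + l * (r - 1) \<le> T M" if "r \<le> rM" for r
  proof -
    have "l * (r - 1) \<le> l * (rM - 1)" using that l by (intro mult_left_mono) auto
    then show ?thesis using TM by simp
  qed
  have T\<phi>: "T (\<phi> r) = T b + l * (r - 1)" if "1 \<le> r" "r \<le> rM" for r
  proof -
    have "T b \<le> T b + l * (r - 1)" using that l by simp
    from range_T_interval[OF this lin[OF that(2)]] obtain s where "T b + l * (r - 1) = T s" by blast
    then show ?thesis unfolding \<phi>_def by (simp add: \<Psi>_T)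
  qed
  have d1: "(\<phi> has_real_derivative l * H (\<phi> r)) (at r)" if "1 \<le> r" "r \<le> rM" for r
  proof -
    have "(\<Psi> has_real_derivative H (\<phi> r)) (at (T b + l * (r - 1)))"
      using \<Psi>_deriv[of "\<phi> r"] unfolding T\<phi>[OF that] .
    then have "((\<lambda>r. \<Psi> (T b + l * (r - 1))) has_real_derivative H (\<phi> r) * l) (at r)"
      by (rule DERIV_chain2[where g = "\<lambda>r. T b + l * (r - 1)"]) (auto intro!: derivative_eq_intros)
    then show ?thesis by (simp add: \<phi>_def[abs_def] mult.commute)
  qed
  have \<phi>b: "\<phi> r \<ge> b" if "1 \<le> r" "r \<le> rM" for r
  proof (rule ccontr)
    assume "\<not> ?thesis"
    then have "T (\<phi> r) < T b" by (intro T_strict) simp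
    moreover have "l * (r - 1) \<ge> 0" using that l by simp
    ultimately show False using T\<phi>[OF that] by simp
  qed
  have \<phi>1: "\<phi> 1 = b" unfolding \<phi>_def by (simp add: \<Psi>_T)
  have \<phi>M: "\<phi> rM = M" unfolding \<phi>_def TM by (rule \<Psi>_T)
  define A where "A = cball (0 :: real^'n) rM - ball 0 1"
  have A: "compact A" unfolding A_def by (intro compact_diff compact_cball open_ball)
  have nyM: "norm y \<le> rM"
  proof (rule ccontr)
    assume "\<not> ?thesis"
    then have "l * (rM - 1) \<le> l * (norm y - 1)" using l by (intro mult_left_mono) auto
    then have "T M < T (u y)" using ly TM by linarith
    then have "M < u y" unfolding T_less_iff .
    then show False by (simp add: M_def)
  qed
  have yA: "y \<in> A" using ny nyM by (simp add: A_def)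
  have "continuous_on A (\<lambda>x. u x - \<phi> (norm x))"
  proof (intro continuous_on_diff cont)
    have "continuous_on {1..rM} \<phi>" using d1 by (meson DERIV_isCont atLeastAtMost_iff continuous_at_imp_continuous_on)
    then show "continuous_on A (\<lambda>x. \<phi> (norm x))"
      by (rule continuous_on_compose2) (auto simp: A_def intro!: continuous_intros)
  qed
  then obtain x where x: "x \<in> A" "\<And>x'. x' \<in> A \<Longrightarrow> u x' - \<phi> (norm x') \<le> u x - \<phi> (norm x)"
    using continuous_attains_sup[OF A] yA by blast
  have "\<phi> (norm y) < u y"
    using T_less_iff[of "\<phi> (norm y)" "u y"] T\<phi>[of "norm y"] ny nyM ly by simp
  then have pos: "u x > \<phi> (norm x)" using x(2)[OF yA] by simp
  have "norm x \<noteq> 1" using pos b[of x] \<phi>1 by auto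
  moreover have "norm x \<noteq> rM"
  proof
    assume e: "norm x = rM"
    then have "u x \<le> M" using z2(2)[of x] rMR by (simp add: M_def)
    then show False using pos e \<phi>M by simp
  qed
  ultimately have nx: "1 < norm x" "norm x < rM" using x(1) by (auto simp: A_def)
  define U where "U = ball (0 :: real^'n) rM - cball 0 1"
  have U: "open U" "x \<in> U" "0 \<notin> U" unfolding U_def using nx by (auto intro: open_Diff)
  have UA: "x' \<in> A \<and> 1 < norm x' \<and> norm x' < rM" if "x' \<in> U" for x' using that by (auto simp: U_def A_def)
  define r where "r = norm x"
  have r: "1 < r" "r < rM" using nx by (auto simp: r_def)
  define h1 where "h1 r = l * H (\<phi> r)" for r
  define h2 where "h2 r = l * (H1 (\<phi> r) * (l * H (\<phi> r)))" for r
  have d2: "(h1 has_real_derivative h2 r) (at r)"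
    unfolding h1_def h2_def using r by (intro DERIV_cmult DERIV_chain2[OF H_deriv] d1) auto
  have h1pos: "h1 s > 0" for s unfolding h1_def using l H_pos by simp
  have h2nn: "h2 s \<ge> 0" for s unfolding h2_def using l H_pos[of "\<phi> s"] H1_nonneg by (intro mult_nonneg_nonneg) auto
  define m where "m = (p - 1) * h1 r powr (p - 2) * h2 r"
  define e where "e = h1 r powr (p - 1) / r"
  have g: "((\<lambda>r. \<bar>h1 r\<bar> powr (p - 2) * h1 r) has_real_derivative m) (at (norm x))"
    unfolding m_def r_def[symmetric] by (rule has_derivative_abs_powr_mult_self[of UNIV]) (use h1pos d2 in auto)
  have ee: "\<bar>h1 (norm x)\<bar> powr (p - 2) * h1 (norm x) / norm x = e"
    unfolding e_def r_def using abs_powr_mult_self[OF h1pos] by simp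
  have x0: "x \<noteq> 0" using U by auto
  obtain ev where ev: "has_eigenvalues (jacobian (p_field p u) (at x)) ev" "ev \<in> Gamma_cone k"
    using adm x0 unfolding admissible_def by auto
  have du: "(\<phi> has_real_derivative h1 (norm x')) (at (norm x'))" if "x' \<in> U" for x'
    unfolding h1_def using UA[OF that] by (intro d1) auto
  have mx: "u x' - \<phi> (norm x') \<le> u x - \<phi> (norm x)" if "x' \<in> U" for x'
    using x(2) UA[OF that] by auto
  have nz: "h1 (norm x) \<noteq> 0" using h1pos[of "norm x"] by simp
  note cmp = radial_comparison[OF U C2 du d2[unfolded r_def] g mx nz p k(2) order_refl ev, unfolded ee]
  have "grad u x = (h1 (norm x) / norm x) *\<^sub>R x" by (rule cmp(1))
  then have gr: "norm (grad u x) = h1 r" using h1pos[of r] x0 by (simp add: r_def)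
  define S where "S = S_mat k (jacobian (p_field p u) (at x))"
  have Se: "S = elem_sym k ev" unfolding S_def by (rule S_mat_eq[OF ev(1)])
  have S0: "S > 0" using ev(2) k(1) unfolding Se Gamma_cone_def by auto
  have r0: "r > 0" using r by simp
  let ?W = "r powr (real k * \<alpha>) * h1 r powr (real k * \<beta>)"
  have lower: "S \<ge> ?W * f (u x) ^ k"
  proof -
    have "ext_power (norm x) \<alpha> * ext_power (norm (grad u x)) \<beta> * ereal (f (u x)) = ereal (r powr \<alpha> * h1 r powr \<beta> * f (u x))"
      unfolding gr r_def[symmetric] ext_power_def using r0 h1pos[of r] by simp
    then have "r powr \<alpha> * h1 r powr \<beta> * f (u x) \<le> root k S" using sub[OF x0] unfolding S_def by simp
    then have "(r powr \<alpha> * h1 r powr \<beta> * f (u x)) ^ k \<le> root k S ^ k"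
      using f(1)[of "u x"] by (intro power_mono) auto
    also have "root k S ^ k = S" using S0 k(1) by (intro real_root_pow_pos2) auto
    finally show ?thesis unfolding power_of_weight[OF r0 h1pos] .
  qed
  have \<phi>r: "\<phi> r \<ge> b" using r by (intro \<phi>b) auto
  let ?w = "f (\<phi> r) ^ k"
  have w0: "?w > 0" using f(1) by simp
  have t1: "(p - 1) * (h1 r powr (a - 1) * h2 r) * r powr (1 - real k * (\<alpha> + 1)) \<le> (p - 1) / (a + 1) * (1 + L) * l powr a * ?w"
  proof -
    have ha: "h1 r powr (a - 1) = l powr (a - 1) * H (\<phi> r) powr (a - 1)"
      unfolding h1_def using l H_pos[of "\<phi> r"] by (simp add: powr_mult)
    have la: "l powr (a - 1) * l = l powr a" using l powr_add[of l "a - 1" 1] by simp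
    have Ha: "H (\<phi> r) powr (a - 1) * H (\<phi> r) = H (\<phi> r) powr a"
      using H_pos[of "\<phi> r"] powr_add[of "H (\<phi> r)" "a - 1" 1] by simp
    have "h1 r powr (a - 1) * h2 r = (l powr (a - 1) * l) * l * ((H (\<phi> r) powr (a - 1) * H (\<phi> r)) * H1 (\<phi> r))"
      unfolding ha h2_def by (simp only: mult_ac)
    also have "\<dots> = l powr a * l * (?w / (a + 1))"
      unfolding la Ha H_power_H1 ramp(3)[OF \<phi>r] by simp
    finally have eq: "h1 r powr (a - 1) * h2 r = l powr a * l * (?w / (a + 1))" .
    have "r powr (1 - real k * (\<alpha> + 1)) \<le> r powr 1"
      using r \<alpha> by (intro powr_mono) auto
    also have "\<dots> \<le> 1 + L / l" using r rMR by (simp add: R_def)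
    finally have "(l powr a * l * (?w / (a + 1))) * r powr (1 - real k * (\<alpha> + 1)) \<le> (l powr a * l * (?w / (a + 1))) * (1 + L / l)"
      using l w0 a by (intro mult_left_mono mult_nonneg_nonneg) auto
    also have "\<dots> = (l powr a * (?w / (a + 1))) * (l + L)" using l(1) by (simp add: algebra_simps)
    also have "\<dots> \<le> (l powr a * (?w / (a + 1))) * (1 + L)"
      using l(2) w0 a by (intro mult_left_mono mult_nonneg_nonneg) auto
    finally have "(p - 1) * ((l powr a * l * (?w / (a + 1))) * r powr (1 - real k * (\<alpha> + 1))) \<le> (p - 1) * ((l powr a * (?w / (a + 1))) * (1 + L))"
      using p by (intro mult_left_mono) auto
    then show ?thesis unfolding eq by (simp add: mult_ac)
  qed
  have t2: "h1 r powr a * r powr (- (real k * (\<alpha> + 1))) \<le> K * l powr a * ?w"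
  proof -
    have "r powr (- (real k * (\<alpha> + 1))) \<le> r powr 0" using r \<alpha> by (intro powr_mono) auto
    then have "h1 r powr a * r powr (- (real k * (\<alpha> + 1))) \<le> h1 r powr a * 1"
      using r by (intro mult_left_mono) auto
    also have "\<dots> = l powr a * H (\<phi> r) powr a" unfolding h1_def using l H_pos[of "\<phi> r"] by (simp add: powr_mult)
    also have "\<dots> \<le> l powr a * (K * ?w)" using K(2)[OF \<phi>r] by (intro mult_left_mono) auto
    finally show ?thesis by (simp add: mult_ac)
  qed
  have "S \<le> elem_sym k (spike undefined m e :: real^'n)" unfolding Se by (rule cmp(2))
  also have "\<dots> \<le> 2 ^ CARD('n) * (m * e ^ (k - 1) + e ^ k)"
    using p h2nn r0 by (intro elem_sym_spike_upper) (auto simp: m_def e_def)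
  also have "m * e ^ (k - 1) + e ^ k = ?W * ((p - 1) * (h1 r powr (a - 1) * h2 r) * r powr (1 - real k * (\<alpha> + 1))
      + h1 r powr a * r powr (- (real k * (\<alpha> + 1))))"
    unfolding m_def e_def a_def radial_product_powers(1)[OF k(1) h1pos r0, where \<alpha> = \<alpha> and \<beta> = \<beta>]
      radial_product_powers(2)[OF k(1) h1pos r0, where \<alpha> = \<alpha> and \<beta> = \<beta>] by (rule distrib_left[symmetric])
  also have "2 ^ CARD('n) * \<dots> \<le> 2 ^ CARD('n) * (?W * ((p - 1) / (a + 1) * (1 + L) * l powr a * ?w + K * l powr a * ?w))"
    by (intro mult_left_mono add_mono t1 t2) auto
  also have "\<dots> = (2 ^ CARD('n) * D * l powr a) * (?W * ?w)" unfolding D_def by (simp add: algebra_simps)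
  also have "\<dots> < 1 * (?W * ?w)"
    using l(4) r0 h1pos[of r] w0 by (intro mult_strict_right_mono mult_pos_pos) auto
  also have "\<dots> \<le> ?W * f (u x) ^ k"
    using fk[of "\<phi> r" "u x"] pos by (simp add: r_def mult_left_mono)
  finally show False using lower by simp
qed

text \<open>Part (a) needs \<open>\<kappa> \<ge> 1\<close>, which holds as \<open>k (\<alpha> + 1) < 1\<close> by the upper bound on \<open>\<alpha>\<close>.\<close>

theorem theorem4p2:
  fixes f :: "real \<Rightarrow> real" and \<alpha> \<beta> p :: real and k :: nat
  assumes "1 \<le> k" and "k \<le> CARD('n::finite)"
    and "\<And>t. f t > 0" and "mono f" and "continuous_on UNIV f"
    and "-1 < \<alpha>" and "\<alpha> < 1 / real k - 1" and "\<beta> < p - 1" and "p > 1"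
  shows
    "((\<exists>\<epsilon>. 0 < \<epsilon> \<and> \<epsilon> < real k * (\<alpha> + 1) \<and>
        (let \<kappa> = (1 - \<epsilon>) / (real k * (\<alpha> + 1) - \<epsilon>) in
          integral_diverges (\<lambda>t. (integral {0..t} (\<lambda>s. f s powr (\<kappa> * real k)))
             powr (- (1 / (\<kappa> * real k * (p - \<beta> - 1) + 1))))))
      \<longrightarrow>
      (\<exists>u :: real^'n \<Rightarrow> real.
         entire_admissible_subsolution p k \<alpha> \<beta> f u \<and> nontrivial u \<and>
         (p \<le> \<alpha> + \<beta> + 2 \<longrightarrow> Ck_on 2 UNIV u) \<and>
         (p > \<alpha> + \<beta> + 2 \<and> (p - 1) * \<alpha> + \<beta> \<ge> 0 \<longrightarrow>
            Ck_on 2 (UNIV - {0}) u \<and>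
            (\<forall>\<delta>. 1 < \<delta> \<and> \<delta> < (p - \<beta> - 1) / (p - \<alpha> - \<beta> - 2) \<longrightarrow> Sobolev_loc 2 \<delta> u))))
     \<and>
     ((\<exists>u :: real^'n \<Rightarrow> real.
         entire_admissible_subsolution p k \<alpha> \<beta> f u \<and> nontrivial u \<and>
         ((p \<le> \<alpha> + \<beta> + 2 \<and> Ck_on 2 UNIV u) \<or>
          (p > \<alpha> + \<beta> + 2 \<and> (p - 1) * \<alpha> + \<beta> \<ge> 0 \<and>
            Ck_on 2 (UNIV - {0}) u \<and>
            (\<forall>\<delta>. 1 < \<delta> \<and> \<delta> < (p - \<beta> - 1) / (p - \<alpha> - \<beta> - 2) \<longrightarrow> Sobolev_loc 2 \<delta> u))))
      \<longrightarrow>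
      integral_diverges (\<lambda>t. (integral {0..t} (\<lambda>s. f s ^ k))
         powr (- (1 / (real k * (p - \<beta> - 1) + 1)))))"
proof (intro conjI impI)
  have q: "p - \<beta> - 1 = p - 1 - \<beta>" by simp
  define a where "a = real k * (p - 1 - \<beta>)"
  have a: "a > 0" using assms by (simp add: a_def)
  have fk: "f s ^ k \<le> f t ^ k" if "s \<le> t" for s t
    using that assms(3)[of s] monoD[OF assms(4)] by (intro power_mono) (auto intro: less_imp_le)
  interpret growth "\<lambda>s. f s ^ k" a
    using assms fk a by unfold_locales (auto intro!: continuous_intros monoI)
  {
    assume "\<exists>\<epsilon>. 0 < \<epsilon> \<and> \<epsilon> < real k * (\<alpha> + 1) \<and>
        (let \<kappa> = (1 - \<epsilon>) / (real k * (\<alpha> + 1) - \<epsilon>) in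
          integral_diverges (\<lambda>t. (integral {0..t} (\<lambda>s. f s powr (\<kappa> * real k)))
             powr (- (1 / (\<kappa> * real k * (p - \<beta> - 1) + 1)))))"
    then obtain \<epsilon> \<kappa> where \<epsilon>: "0 < \<epsilon>" "\<epsilon> < real k * (\<alpha> + 1)" and \<kappa>: "\<kappa> = (1 - \<epsilon>) / (real k * (\<alpha> + 1) - \<epsilon>)"
      and div: "integral_diverges (\<lambda>t. (integral {0..t} (\<lambda>s. f s powr (\<kappa> * real k)))
             powr (- (1 / (\<kappa> * real k * (p - \<beta> - 1) + 1))))"
      unfolding Let_def by blast
    have "real k * (\<alpha> + 1) < real k * (1 / real k)" using assms(1,7) by (intro mult_strict_left_mono) auto
    then have "real k * (\<alpha> + 1) < 1" using assms(1) by simp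
    then have "\<kappa> \<ge> 1" using \<epsilon> unfolding \<kappa> by (simp add: field_simps)
    moreover have e1: "f s powr (\<kappa> * real k) = (f s ^ k) powr \<kappa>" for s
      using assms(3)[of s] by (simp add: powr_realpow[symmetric] powr_powr mult.commute)
    moreover have e2: "\<kappa> * real k * (p - \<beta> - 1) = \<kappa> * a" by (simp add: a_def q)
    ultimately have "integral_diverges (\<lambda>t. G t powr (- (1 / (a + 1))))"
      using div by (intro diverges_of_kappa_diverges) (simp_all only: e1 e2)
    from existence_of_subsolution[where 'n = 'n, OF assms(1-6,8,9) this[unfolded a_def]]
    show "\<exists>u :: real^'n \<Rightarrow> real.
         entire_admissible_subsolution p k \<alpha> \<beta> f u \<and> nontrivial u \<and>
         (p \<le> \<alpha> + \<beta> + 2 \<longrightarrow> Ck_on 2 UNIV u) \<and>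
         (p > \<alpha> + \<beta> + 2 \<and> (p - 1) * \<alpha> + \<beta> \<ge> 0 \<longrightarrow>
            Ck_on 2 (UNIV - {0}) u \<and>
            (\<forall>\<delta>. 1 < \<delta> \<and> \<delta> < (p - \<beta> - 1) / (p - \<alpha> - \<beta> - 2) \<longrightarrow> Sobolev_loc 2 \<delta> u))"
      by blast
  next
    assume "\<exists>u :: real^'n \<Rightarrow> real.
         entire_admissible_subsolution p k \<alpha> \<beta> f u \<and> nontrivial u \<and>
         ((p \<le> \<alpha> + \<beta> + 2 \<and> Ck_on 2 UNIV u) \<or>
          (p > \<alpha> + \<beta> + 2 \<and> (p - 1) * \<alpha> + \<beta> \<ge> 0 \<and>
            Ck_on 2 (UNIV - {0}) u \<and>
            (\<forall>\<delta>. 1 < \<delta> \<and> \<delta> < (p - \<beta> - 1) / (p - \<alpha> - \<beta> - 2) \<longrightarrow> Sobolev_loc 2 \<delta> u)))"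
    then obtain u :: "real^'n \<Rightarrow> real" where u: "entire_admissible_subsolution p k \<alpha> \<beta> f u" by blast
    show "integral_diverges (\<lambda>t. (integral {0..t} (\<lambda>s. f s ^ k)) powr (- (1 / (real k * (p - \<beta> - 1) + 1))))"
      using necessity_of_divergence[OF assms(1-6,8,9) u] unfolding G_def q .
  }
qed

end
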